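(* Let $f:\mathbb W\to\mathbb R$ be a measurable function with $\mathbb E_\nu\left[|f|(1+e^{-f})\right]<\infty$. If there exists some $u\in\widetilde{\mathcal D}_\tau\cap L^2_a(\nu,H)$ such that $W^u$ is $\nu$-a.s. left-invertible and $$\frac{d(W^u\nu)}{d\nu}=\frac{e^{-f}}{\mathbb E_\nu\left[e^{-f}\,\middle|\,\mathcal F_\tau\right]},$$ then, $\nu$-a.s., $$-\log\mathbb E_\nu\left[e^{-f}\,\middle|\,\mathcal F_\tau\right]=\inf_{\alpha\in\widetilde{\mathcal D}_\tau\cap L^2_a(\nu,H)}\mathbb E_\nu\left[f\circ W^\alpha+\frac12|\alpha|_H^2\,\middle|\,\mathcal F_\tau\right].$$
   Context: Basic setting. $n\ge1$; $\mathbb W=C([0,1],\mathbb R^n)$ with a probability measure $\nu$; $W$ is the coordinate process, $(\mathcal F_t)$ its filtration (all filtrations are completed with respect to $\nu$), $\tau$ a stopping time of $(\mathcal F_t)$. $H=\{\int_0^\cdot\dot h(s)ds:\dot h\in L^2([0,1];\mathbb R^n)\}$, $|h|_H^2=\int_0^1|\dot h(s)|^2ds$. For $p\ge0$, $L^p_a(\nu,H)$ is the set of $u\in L^p(\nu,H)$ with $\dot u$ $(\mathcal F_t)$-adapted ($L^0$ = all measurable maps). $\mathcal D=\{u\in L^0_a(\nu,H):\dot u\text{ is } d\nu\times dt\text{-a.s. bounded}\}$. For $u\in L^0_a(\nu,H)$: $\pi_\tau u=\int_0^\cdot\dot u(s)1_{s\le\tau}ds$, $(I-\pi_\tau)u=\int_0^\cdot\dot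 u(s)1_{s>\tau}ds$. For a $\nu$-Brownian motion $\beta$: $\delta_\beta v=\int_0^1\dot v(s)d\beta(s)$, $\rho(\delta_\beta v)=\exp(\int_0^1\dot v\,d\beta-\frac12\int_0^1|\dot v|^2ds)$, and $G_p(\nu,\beta)=\{u\in L^p_a(\nu,H):\mathbb E_\nu[\rho(-\delta_\beta u)]=1\}$. Standing assumption: there are a $\nu$-Brownian motion $\beta$ and adapted processes $(W^u)_{u\in\mathcal D}$ (viewed as maps $\mathbb W\to\mathbb W$) such that: (i) $\beta$ and $W$ have the same filtration; (ii) $W^0=W$; (iii) for $u\in\mathcal D$ the law of $W^u$ under $\tilde\nu^u$, $d\tilde\nu^u=\rho(-\delta_\beta u)d\nu$, equals the law of $W$ under $\nu$; (iv) $\beta\circ W^u=\beta+u$ for $u\in\mathcal D$; (v) $W^u\circ W^v=W^{v+u\circ W^v}$ $\nu$-a.s. for $u,v\in\mathcal D$; (vi) $(W^u(s\wedge\tau))_{s\le1}=(W^{\pi_\tau u}(s\wedge\tau))_{s\le1}$ for $u\in\mathcal D$. Extended class. $\widetilde{\mathcal D}$ is a fixed set to which $u\mapsto W^u$ is extended such that: (i) $\mathcal D\subset\widetilde{\mathcal D}\subset G_2(\nu,\beta)$; (ii) $W^u$ is adapted for $u\in\widetilde{\mathcal D}$; (iii) for $u\in\widetilde{\mathcal D}$ the law of $W^u$ under $\tilde\nu^u$, $d\tilde\nu^u=\rho(-\delta_\beta u)d\nu$, equals the law of $W$ under $\nu$; (iv) $\beta\circ W^u=\beta+u$ for $u\in\widetilde{\mathcal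 D}$; (v) $W^u\circ W^v=W^{v+u\circ W^v}$ $\nu$-a.s. whenever $u,v,v+u\circ W^v\in\widetilde{\mathcal D}$; (vi) there is $\widetilde{\widetilde{\mathcal D}}$ with $\widetilde{\mathcal D}\subset\widetilde{\widetilde{\mathcal D}}\subset L^0_a(\nu,H)$ and $\widetilde{\mathcal D}=\widetilde{\widetilde{\mathcal D}}\cap G_2(\nu,\beta)$ such that for every $u\in\widetilde{\mathcal D}$ for which the equation $u+v\circ W^u=0$ (unknown $v$) has a solution in $G_0(\nu,\beta)$, it has a solution in $\widetilde{\widetilde{\mathcal D}}$; (vii) $(W^u(s\wedge\tau))_{s\le1}=(W^{\pi_\tau u}(s\wedge\tau))_{s\le1}$ whenever $u,\pi_\tau u\in\widetilde{\mathcal D}$. Under these conditions $W^u\nu\sim\nu$ for $u\in\widetilde{\mathcal D}$. $\widetilde{\mathcal D}_\tau=\widetilde{\mathcal D}\cap(I-\pi_\tau)L^0_a(\nu,H)$. A measurable $U:\mathbb W\to\mathbb W$ is $\nu$-a.s. left-invertible if $U\nu\ll\nu$ and there is a measurable $V:\mathbb W\to\mathbb W$ with $V\circ U=I_{\mathbb W}$ $\nu$-a.s. The infimum of a family of random variables is understood as the $\nu$-essential infimum; conditional expectations may take the value $+\infty$. *)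

theory Defs
  imports "HOL-Probability.Probability"
begin

text \<open>
  A path \<open>w \<in> C([0,1], \<real>\<^sup>n)\<close> is a function on \<open>real\<close> that is continuous on \<open>[0,1]\<close> and
  \<open>undefined\<close> elsewhere. The trace of the product \<open>\<sigma>\<close>-algebra, generated by the coordinates,
  is the Borel \<open>\<sigma>\<close>-algebra of the uniform norm.
\<close>

type_synonym 'n path = "real \<Rightarrow> real^'n"

definition path_space :: "'n::finite path measure" where
  "path_space = restrict_space (\<Pi>\<^sub>M t\<in>{0..1}. borel) {w. continuous_on {0..1} w}"

definition path_zero :: "'n::finite path" where
  "path_zero = (\<lambda>t\<in>{0..1}. 0)"

definition path_uminus :: "'n::finite path \<Rightarrow> 'n path" where
  "path_uminus x = (\<lambda>t\<in>{0..1}. - x t)"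

definition path_add :: "'n::finite path \<Rightarrow> 'n path \<Rightarrow> 'n path" where
  "path_add x y = (\<lambda>t\<in>{0..1}. x t + y t)"

text \<open>
  The index ranges over all of \<open>\<real>\<close>, as required for \<^const>\<open>stopping_time\<close> and the locale
  \<^locale>\<open>filtration\<close>: the \<open>\<sigma>\<close>-algebra is trivial (null and conull sets) for \<open>t < 0\<close> and
  constant for \<open>t \<ge> 1\<close>.
\<close>

definition completed_filtration ::
    "'a measure \<Rightarrow> ('a \<Rightarrow> 'n::finite path) \<Rightarrow> real \<Rightarrow> 'a measure" where
  "completed_filtration M X t =
     sigma (space M)
       ({(\<lambda>\<omega>. X \<omega> s) -` B \<inter> space M | s B. s \<in> {0..1} \<and> s \<le> t \<and> B \<in> sets borel}
        \<union> null_sets (completion M))"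

definition canonical_filtration :: "'n::finite path measure \<Rightarrow> real \<Rightarrow> 'n path measure" where
  "canonical_filtration \<nu> = completed_filtration \<nu> (\<lambda>w. w)"

definition stopped_algebra ::
    "'n::finite path measure \<Rightarrow> ('n path \<Rightarrow> real) \<Rightarrow> 'n path measure" where
  "stopped_algebra \<nu> \<tau> = filtration.pre_sigma (space \<nu>) (canonical_filtration \<nu>) \<tau>"

definition adapted_map :: "'n::finite path measure \<Rightarrow> ('n path \<Rightarrow> 'n path) \<Rightarrow> bool" where
  "adapted_map \<nu> U \<longleftrightarrow>
     U \<in> space \<nu> \<rightarrow> space path_space \<and>
     (\<forall>t\<in>{0..1}. (\<lambda>w. U w t) \<in> borel_measurable (canonical_filtration \<nu> t))"

definition brownian_motion :: "'a measure \<Rightarrow> ('a \<Rightarrow> 'n::finite path) \<Rightarrow> bool" where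
  "brownian_motion M B \<longleftrightarrow>
     B \<in> completion M \<rightarrow>\<^sub>M path_space \<and>
     (AE \<omega> in M. B \<omega> 0 = 0) \<and>
     (\<forall>s t. 0 \<le> s \<and> s < t \<and> t \<le> 1 \<longrightarrow>
        distributed (completion M) lborel (\<lambda>\<omega>. B \<omega> t - B \<omega> s)
          (\<lambda>x. ennreal (\<Prod>i\<in>UNIV. normal_density 0 (sqrt (t - s)) (x $ i))) \<and>
        prob_space.indep_set (completion M) (sets (completed_filtration M B s))
          {(\<lambda>\<omega>. B \<omega> t - B \<omega> s) -` A \<inter> space M | A. A \<in> sets borel})"

definition is_cm_deriv :: "'n::finite path \<Rightarrow> (real \<Rightarrow> real^'n) \<Rightarrow> bool" where
  "is_cm_deriv h d \<longleftrightarrow>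
     d \<in> borel_measurable lborel \<and>
     set_integrable lborel {0..1} (\<lambda>s. (norm (d s))\<^sup>2) \<and>
     (\<forall>t\<in>{0..1}. h t = (LINT s:{0..t}|lborel. d s))"

definition cm_space :: "'n::finite path set" where
  "cm_space = {h \<in> space path_space. \<exists>d. is_cm_deriv h d}"

text \<open>Derivatives are unique almost everywhere on \<open>[0,1]\<close>; one of them is chosen.\<close>

definition cm_deriv :: "'n::finite path \<Rightarrow> real \<Rightarrow> real^'n" where
  "cm_deriv h = (SOME d. is_cm_deriv h d)"

definition cm_norm :: "'n::finite path \<Rightarrow> real" where
  "cm_norm h = sqrt (LINT s:{0..1}|lborel. (norm (cm_deriv h s))\<^sup>2)"

text \<open>
  Elements of \<open>L\<^sup>0(\<nu>, H)\<close> are represented by maps, not by classes modulo \<open>\<nu>\<close>. Adaptedness and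
  boundedness concern the derivative as a \<open>d\<nu> \<times> dt\<close>-class, so they are stated for a jointly
  measurable version \<open>d\<close>.
\<close>

definition adapted_version ::
    "'n::finite path measure \<Rightarrow> ('n path \<Rightarrow> 'n path) \<Rightarrow> ('n path \<Rightarrow> real \<Rightarrow> real^'n) \<Rightarrow> bool" where
  "adapted_version \<nu> u d \<longleftrightarrow>
     (\<lambda>(w, s). d w s) \<in> borel_measurable (completion \<nu> \<Otimes>\<^sub>M lborel) \<and>
     (\<forall>t\<in>{0..1}. (\<lambda>w. d w t) \<in> borel_measurable (canonical_filtration \<nu> t)) \<and>
     (AE w in \<nu>. is_cm_deriv (u w) (d w))"

definition L0a :: "'n::finite path measure \<Rightarrow> ('n path \<Rightarrow> 'n path) set" where
  "L0a \<nu> = {u. u \<in> completion \<nu> \<rightarrow>\<^sub>M path_space \<and> u ` space \<nu> \<subseteq> cm_space \<and>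
              (\<exists>d. adapted_version \<nu> u d)}"

text \<open>For \<open>p = 0\<close> the integrability condition is void, since \<open>x powr 0 \<in> {0, 1}\<close>.\<close>

definition Lpa :: "real \<Rightarrow> 'n::finite path measure \<Rightarrow> ('n path \<Rightarrow> 'n path) set" where
  "Lpa p \<nu> = {u \<in> L0a \<nu>. integrable (completion \<nu>) (\<lambda>w. cm_norm (u w) powr p)}"

definition bounded_drifts :: "'n::finite path measure \<Rightarrow> ('n path \<Rightarrow> 'n path) set" where
  "bounded_drifts \<nu> = {u \<in> L0a \<nu>. \<exists>d C. adapted_version \<nu> u d \<and>
     (AE (w, s) in completion \<nu> \<Otimes>\<^sub>M lborel. s \<in> {0..1} \<longrightarrow> norm (d w s) \<le> C)}"

definition cm_before :: "('n::finite path \<Rightarrow> real) \<Rightarrow> ('n path \<Rightarrow> 'n path) \<Rightarrow> 'n path \<Rightarrow> 'n path" where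
  "cm_before \<tau> u w =
     (\<lambda>t\<in>{0..1}. LINT s:{0..t}|lborel. indicat_real {..\<tau> w} s *\<^sub>R cm_deriv (u w) s)"

definition cm_after :: "('n::finite path \<Rightarrow> real) \<Rightarrow> ('n path \<Rightarrow> 'n path) \<Rightarrow> 'n path \<Rightarrow> 'n path" where
  "cm_after \<tau> u w =
     (\<lambda>t\<in>{0..1}. LINT s:{0..t}|lborel. indicat_real {\<tau> w<..} s *\<^sub>R cm_deriv (u w) s)"

definition tendsto_in_prob ::
    "'a measure \<Rightarrow> (nat \<Rightarrow> 'a \<Rightarrow> real) \<Rightarrow> ('a \<Rightarrow> real) \<Rightarrow> bool" where
  "tendsto_in_prob M Z Y \<longleftrightarrow>
     (\<forall>\<epsilon>>0. (\<lambda>m. measure M {\<omega> \<in> space M. \<bar>Z m \<omega> - Y \<omega>\<bar> > \<epsilon>}) \<longlonglongrightarrow> 0)"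

text \<open>
  The data \<open>k, t, \<xi>\<close> stand for the integrand taking the value \<open>\<xi> i\<close> on \<open>(t i, t (i + 1)]\<close> for
  \<open>i < k\<close> and \<open>0\<close> elsewhere.
\<close>

definition elementary_data ::
    "'n::finite path measure \<Rightarrow> nat \<Rightarrow> (nat \<Rightarrow> real) \<Rightarrow> (nat \<Rightarrow> 'n path \<Rightarrow> real^'n) \<Rightarrow> bool" where
  "elementary_data \<nu> k t \<xi> \<longleftrightarrow>
     0 \<le> t 0 \<and> t k \<le> 1 \<and>
     (\<forall>i<k. t i \<le> t (Suc i) \<and>
            \<xi> i \<in> borel_measurable (canonical_filtration \<nu> (t i)) \<and>
            bounded (\<xi> i ` space \<nu>))"

definition elementary_integrand ::
    "nat \<Rightarrow> (nat \<Rightarrow> real) \<Rightarrow> (nat \<Rightarrow> 'n::finite path \<Rightarrow> real^'n) \<Rightarrow> 'n path \<Rightarrow> real \<Rightarrow> real^'n" where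
  "elementary_integrand k t \<xi> w s = (\<Sum>i<k. indicat_real {t i<..t (Suc i)} s *\<^sub>R \<xi> i w)"

definition elementary_integral ::
    "('n::finite path \<Rightarrow> 'n path) \<Rightarrow> nat \<Rightarrow> (nat \<Rightarrow> real) \<Rightarrow> (nat \<Rightarrow> 'n path \<Rightarrow> real^'n)
      \<Rightarrow> 'n path \<Rightarrow> real" where
  "elementary_integral \<beta> k t \<xi> w = (\<Sum>i<k. \<xi> i w \<bullet> (\<beta> w (t (Suc i)) - \<beta> w (t i)))"

definition is_ito_integral ::
    "'n::finite path measure \<Rightarrow> ('n path \<Rightarrow> 'n path) \<Rightarrow> ('n path \<Rightarrow> 'n path)
      \<Rightarrow> ('n path \<Rightarrow> real) \<Rightarrow> bool" where
  "is_ito_integral \<nu> \<beta> v X \<longleftrightarrow>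
     X \<in> borel_measurable (completion \<nu>) \<and>
     (\<exists>k t \<xi>. (\<forall>m. elementary_data \<nu> (k m) (t m) (\<xi> m)) \<and>
        tendsto_in_prob (completion \<nu>)
          (\<lambda>m w. LINT s:{0..1}|lborel.
             (norm (elementary_integrand (k m) (t m) (\<xi> m) w s - cm_deriv (v w) s))\<^sup>2)
          (\<lambda>w. 0) \<and>
        tendsto_in_prob (completion \<nu>) (\<lambda>m. elementary_integral \<beta> (k m) (t m) (\<xi> m)) X)"

text \<open>The limit in probability defining \<open>\<delta>\<^sub>\<beta> v\<close> is unique up to \<open>\<nu>\<close>-null sets; one version is chosen.\<close>

definition ito ::
    "'n::finite path measure \<Rightarrow> ('n path \<Rightarrow> 'n path) \<Rightarrow> ('n path \<Rightarrow> 'n path) \<Rightarrow> 'n path \<Rightarrow> real" where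
  "ito \<nu> \<beta> v = (SOME X. is_ito_integral \<nu> \<beta> v X)"

definition wick_exp ::
    "'n::finite path measure \<Rightarrow> ('n path \<Rightarrow> 'n path) \<Rightarrow> ('n path \<Rightarrow> 'n path) \<Rightarrow> 'n path \<Rightarrow> real" where
  "wick_exp \<nu> \<beta> v w = exp (ito \<nu> \<beta> v w - 1 / 2 * (cm_norm (v w))\<^sup>2)"

text \<open>\<open>\<rho>(- \<delta>\<^sub>\<beta> u)\<close> is read as \<open>\<rho>(\<delta>\<^sub>\<beta> (- u))\<close>.\<close>

definition girsanov_density ::
    "'n::finite path measure \<Rightarrow> ('n path \<Rightarrow> 'n path) \<Rightarrow> ('n path \<Rightarrow> 'n path) \<Rightarrow> 'n path \<Rightarrow> real" where
  "girsanov_density \<nu> \<beta> u = wick_exp \<nu> \<beta> (\<lambda>w. path_uminus (u w))"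

definition girsanov_measure ::
    "'n::finite path measure \<Rightarrow> ('n path \<Rightarrow> 'n path) \<Rightarrow> ('n path \<Rightarrow> 'n path) \<Rightarrow> 'n path measure" where
  "girsanov_measure \<nu> \<beta> u = density (completion \<nu>) (\<lambda>w. ennreal (girsanov_density \<nu> \<beta> u w))"

definition G_class ::
    "real \<Rightarrow> 'n::finite path measure \<Rightarrow> ('n path \<Rightarrow> 'n path) \<Rightarrow> ('n path \<Rightarrow> 'n path) set" where
  "G_class p \<nu> \<beta> = {u \<in> Lpa p \<nu>. (LINT w|completion \<nu>. girsanov_density \<nu> \<beta> u w) = 1}"

definition shift_comp ::
    "(('n::finite path \<Rightarrow> 'n path) \<Rightarrow> 'n path \<Rightarrow> 'n path)
      \<Rightarrow> ('n path \<Rightarrow> 'n path) \<Rightarrow> ('n path \<Rightarrow> 'n path) \<Rightarrow> 'n path \<Rightarrow> 'n path" where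
  "shift_comp W u v w = path_add (v w) (u (W v w))"

text \<open>
  The stopping time is only required to be nonnegative; values above \<open>1\<close> play the role of
  \<open>\<infinity>\<close>. Identities between maps on path space hold \<open>\<nu>\<close>-almost surely.
\<close>

locale shift_family =
  fixes \<nu> :: "'n::finite path measure"
    and \<tau> :: "'n path \<Rightarrow> real"
    and \<beta> :: "'n path \<Rightarrow> 'n path"
    and W :: "('n path \<Rightarrow> 'n path) \<Rightarrow> 'n path \<Rightarrow> 'n path"
  assumes prob_nu: "prob_space \<nu>"
    and sets_nu: "sets \<nu> = sets path_space"
    and tau_stopping: "stopping_time (canonical_filtration \<nu>) \<tau>"
    and tau_nonneg: "\<And>w. w \<in> space \<nu> \<Longrightarrow> 0 \<le> \<tau> w"
    and beta_brownian: "brownian_motion \<nu> \<beta>"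
    and W_adapted: "\<And>u. u \<in> bounded_drifts \<nu> \<Longrightarrow> adapted_map \<nu> (W u)"
    and same_filtration: "\<And>t. t \<in> {0..1} \<Longrightarrow>
          sets (completed_filtration \<nu> \<beta> t) = sets (canonical_filtration \<nu> t)"
    and W_zero: "AE w in \<nu>. W (\<lambda>_. path_zero) w = w"
    and W_law: "\<And>u. u \<in> bounded_drifts \<nu> \<Longrightarrow>
          distr (girsanov_measure \<nu> \<beta> u) path_space (W u) = distr \<nu> path_space (\<lambda>w. w)"
    and beta_W: "\<And>u. u \<in> bounded_drifts \<nu> \<Longrightarrow>
          AE w in \<nu>. \<beta> (W u w) = path_add (\<beta> w) (u w)"
    and W_comp: "\<And>u v. u \<in> bounded_drifts \<nu> \<Longrightarrow> v \<in> bounded_drifts \<nu> \<Longrightarrow>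
          AE w in \<nu>. W u (W v w) = W (shift_comp W u v) w"
    and W_stopped: "\<And>u. u \<in> bounded_drifts \<nu> \<Longrightarrow>
          AE w in \<nu>. \<forall>s\<in>{0..1}. W u w (min s (\<tau> w)) = W (cm_before \<tau> u) w (min s (\<tau> w))"

definition inverse_drift ::
    "'n::finite path measure \<Rightarrow> (('n path \<Rightarrow> 'n path) \<Rightarrow> 'n path \<Rightarrow> 'n path)
      \<Rightarrow> ('n path \<Rightarrow> 'n path) \<Rightarrow> ('n path \<Rightarrow> 'n path) \<Rightarrow> bool" where
  "inverse_drift \<nu> W u v \<longleftrightarrow> (AE w in \<nu>. path_add (u w) (v (W u w)) = path_zero)"

locale extended_shift_family = shift_family \<nu> \<tau> \<beta> W
  for \<nu> :: "'n::finite path measure" and \<tau> \<beta> W +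
  fixes Dt :: "('n path \<Rightarrow> 'n path) set"
  assumes D_subset_Dt: "bounded_drifts \<nu> \<subseteq> Dt"
    and Dt_subset_G2: "Dt \<subseteq> G_class 2 \<nu> \<beta>"
    and Dt_adapted: "\<And>u. u \<in> Dt \<Longrightarrow> adapted_map \<nu> (W u)"
    and Dt_law: "\<And>u. u \<in> Dt \<Longrightarrow>
          distr (girsanov_measure \<nu> \<beta> u) path_space (W u) = distr \<nu> path_space (\<lambda>w. w)"
    and Dt_beta_W: "\<And>u. u \<in> Dt \<Longrightarrow> AE w in \<nu>. \<beta> (W u w) = path_add (\<beta> w) (u w)"
    and Dt_comp: "\<And>u v. u \<in> Dt \<Longrightarrow> v \<in> Dt \<Longrightarrow> shift_comp W u v \<in> Dt \<Longrightarrow>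
          AE w in \<nu>. W u (W v w) = W (shift_comp W u v) w"
    and Dt_inverse: "\<exists>Dtt. Dt \<subseteq> Dtt \<and> Dtt \<subseteq> L0a \<nu> \<and> Dt = Dtt \<inter> G_class 2 \<nu> \<beta> \<and>
          (\<forall>u\<in>Dt. (\<exists>v\<in>G_class 0 \<nu> \<beta>. inverse_drift \<nu> W u v) \<longrightarrow>
                   (\<exists>v\<in>Dtt. inverse_drift \<nu> W u v))"
    and Dt_stopped: "\<And>u. u \<in> Dt \<Longrightarrow> cm_before \<tau> u \<in> Dt \<Longrightarrow>
          AE w in \<nu>. \<forall>s\<in>{0..1}. W u w (min s (\<tau> w)) = W (cm_before \<tau> u) w (min s (\<tau> w))"

definition drifts_after ::
    "'n::finite path measure \<Rightarrow> ('n path \<Rightarrow> real) \<Rightarrow> ('n path \<Rightarrow> 'n path) set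
      \<Rightarrow> ('n path \<Rightarrow> 'n path) set" where
  "drifts_after \<nu> \<tau> Dt = {u \<in> Dt. \<exists>v\<in>L0a \<nu>. AE w in \<nu>. u w = cm_after \<tau> v w}"

definition left_invertible :: "'n::finite path measure \<Rightarrow> ('n path \<Rightarrow> 'n path) \<Rightarrow> bool" where
  "left_invertible \<nu> U \<longleftrightarrow>
     U \<in> completion \<nu> \<rightarrow>\<^sub>M path_space \<and>
     absolutely_continuous \<nu> (distr (completion \<nu>) path_space U) \<and>
     (\<exists>V \<in> completion \<nu> \<rightarrow>\<^sub>M path_space. AE w in \<nu>. V (U w) = w)"

text \<open>
  The conditional expectation with values in \<open>(-\<infinity>, \<infinity>]\<close>, meaningful when the conditional
  expectation of the negative part is finite almost surely.
\<close>

definition ext_cond_exp :: "'a measure \<Rightarrow> 'a measure \<Rightarrow> ('a \<Rightarrow> real) \<Rightarrow> 'a \<Rightarrow> ereal" where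
  "ext_cond_exp M F X \<omega> =
     enn2ereal (nn_cond_exp M F (\<lambda>x. ennreal (X x)) \<omega>)
     - enn2ereal (nn_cond_exp M F (\<lambda>x. ennreal (- X x)) \<omega>)"

definition is_ess_inf :: "'a measure \<Rightarrow> ('a \<Rightarrow> ereal) set \<Rightarrow> ('a \<Rightarrow> ereal) \<Rightarrow> bool" where
  "is_ess_inf M A X \<longleftrightarrow>
     X \<in> borel_measurable M \<and>
     (\<forall>Y\<in>A. AE \<omega> in M. X \<omega> \<le> Y \<omega>) \<and>
     (\<forall>Z\<in>borel_measurable M. (\<forall>Y\<in>A. AE \<omega> in M. Z \<omega> \<le> Y \<omega>) \<longrightarrow> (AE \<omega> in M. Z \<omega> \<le> X \<omega>))"

end

theory Submission
  imports Defs
begin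

text \<open>
  Put \<open>L = E[e\<^sup>-\<^sup>f | \<F>\<^sub>\<tau>]\<close> and \<open>q = e\<^sup>-\<^sup>f / L\<close>. For a drift \<open>\<alpha>\<close> starting after \<open>\<tau>\<close>, the map \<open>W\<^sup>\<alpha>\<close> leaves
  the events of \<open>\<F>\<^sub>\<tau>\<close> invariant up to null sets, because it shifts the Brownian motion generating the
  filtration only after \<open>\<tau>\<close>. Hence \<open>L \<circ> W\<^sup>\<alpha> = L\<close>, and the law of \<open>W\<^sup>\<alpha>\<close> under the Girsanov density
  \<open>\<rho> = exp (X - |\<alpha>|\<^sup>2 / 2)\<close>, \<open>X = - \<integral> \<alpha> d\<beta>\<close>, gives \<open>E[\<rho> (q \<circ> W\<^sup>\<alpha>) | \<F>\<^sub>\<tau>] = 1\<close>. Moreover \<open>E[X | \<F>\<^sub>\<tau>] = 0\<close>.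
  Taking conditional expectations in \<open>log (\<rho> (q \<circ> W\<^sup>\<alpha>)) \<le> \<rho> (q \<circ> W\<^sup>\<alpha>) - 1\<close>, where the left side is
  \<open>X - |\<alpha>|\<^sup>2 / 2 - f \<circ> W\<^sup>\<alpha> - log L\<close>, shows that \<open>- log L\<close> is a lower bound, attained when
  \<open>\<rho> (q \<circ> W\<^sup>\<alpha>) = 1\<close>. The latter holds for the given \<open>u\<close>: if \<open>W\<^sup>u\<close> has density \<open>q\<close>, then \<open>\<rho> (q \<circ> W\<^sup>u)\<close> and
  \<open>1\<close> have the same integral over each preimage of an event under \<open>W\<^sup>u\<close>, and left-invertibility makes
  every event such a preimage.
\<close>

section \<open>Brownian motion relative to a filtration\<close>

text \<open>The stochastic exponential of a drift restricted to an event A is not known to have mean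
  one, so the localised Girsanov formula cannot be taken for granted. Limits of elementary
  integrands and Fatou give it only as an inequality, for the drift
  \<open>indicat_real A w *\<^sub>R d w s\<close> with A in the past of \<tau>; this integrand stays
  adapted because d vanishes up to \<tau>. The same inequality holds for the complement of A, and
  the two add up to an equality, namely the prescribed law of \<open>W \<alpha>\<close>. Hence both
  are equalities. This fixes the joint behaviour of A and of preimages under
  \<open>W \<alpha>\<close>, and the invariance of A follows. Two encodings shape the rest. The Ito
  integral and the derivative of a drift are chosen by \<open>SOME\<close>, so everything is done
  for a jointly measurable version of the derivative, and the choice is identified afterwards by
  locality of the integral. The cost need not be integrable, so positive and negative parts are
  conditioned separately, and the logarithmic inequality is first rearranged into sums of
  nonnegative terms.\<close>

definition gauss :: "real \<Rightarrow> real^'n::finite \<Rightarrow> real" where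
  "gauss \<delta> x = (\<Prod>i\<in>UNIV. normal_density 0 (sqrt \<delta>) (x $ i))"

section \<open>Integrals against the centred Gaussian density in n dimensions\<close>

lemma gauss_nonneg [simp]: "0 \<le> gauss \<delta> x"
  by (simp add: gauss_def prod_nonneg)

lemma gauss_measurable [measurable]: "gauss \<delta> \<in> borel_measurable borel"
  unfolding gauss_def by measurable

lemma gauss_uminus: "gauss \<delta> (- x) = gauss \<delta> x"
  by (simp add: gauss_def normal_density_def)

text \<open>The basis vectors of \<open>real^'n\<close> are exactly the \<open>axis i 1\<close>, so
  Tonelli over \<open>Basis\<close> becomes Tonelli over coordinates after reindexing along this
  injection.\<close>

lemma nn_integral_prod_vec:
  fixes h :: "'n::finite \<Rightarrow> real \<Rightarrow> ennreal"
  assumes [measurable]: "\<And>i. h i \<in> borel_measurable borel"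
  shows "(\<integral>\<^sup>+ (x::real^'n). (\<Prod>i\<in>UNIV. h i (x $ i)) \<partial>lborel) = (\<Prod>i\<in>UNIV. \<integral>\<^sup>+ y. h i y \<partial>lborel)"
proof -
  have inj: "inj (\<lambda>i. axis i (1::real) :: real^'n)"
    by (auto intro!: injI simp: axis_eq_axis)
  have B: "(Basis :: (real^'n) set) = range (\<lambda>i. axis i 1)"
    by (auto simp: Basis_vec_def)
  define g where "g b = h (SOME i. b = axis i 1)" for b :: "real^'n"
  have g: "g (axis i 1) = h i" for i
    unfolding g_def by (rule arg_cong[where f=h]) (auto simp: axis_eq_axis)
  have "(\<integral>\<^sup>+ (x::real^'n). (\<Prod>b\<in>Basis. g b (x \<bullet> b)) \<partial>lborel) = (\<Prod>b\<in>Basis. \<integral>\<^sup>+ y. g b y \<partial>lborel)"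
    by (rule nn_integral_lborel_prod) (auto simp: B g)
  then show ?thesis
    by (simp add: B prod.reindex[OF inj] g inner_axis)
qed

text \<open>The density factorises over coordinates: in the integral of one squared coordinate a
  single factor gives the variance \<delta> and the others have mass 1. Summing over the coordinates
  gives the factor \<open>CARD('n)\<close>.\<close>

lemma nn_integral_gauss_norm_sq:
  assumes \<delta>: "0 < \<delta>"
  shows "(\<integral>\<^sup>+ x. ennreal ((norm x)\<^sup>2) * ennreal (gauss \<delta> (x::real^'n::finite)) \<partial>lborel)
    = ennreal (real CARD('n) * \<delta>)"
proof -
  have coord: "(\<integral>\<^sup>+ x. ennreal ((x $ j)\<^sup>2) * ennreal (gauss \<delta> (x::real^'n)) \<partial>lborel) = ennreal \<delta>" for j
  proof -
    \<comment> \<open>The factor that is 1 except at coordinate j turns the square of one coordinate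
      into a product over all coordinates.\<close>
    have "(\<integral>\<^sup>+ x. ennreal ((x $ j)\<^sup>2) * ennreal (gauss \<delta> (x::real^'n)) \<partial>lborel)
      = (\<integral>\<^sup>+ (x::real^'n). (\<Prod>i\<in>UNIV. (if i = j then ennreal ((x $ i)\<^sup>2) else 1) *
           ennreal (normal_density 0 (sqrt \<delta>) (x $ i))) \<partial>lborel)"
      by (intro nn_integral_cong) (simp add: gauss_def prod.distrib prod_ennreal)
    also have "\<dots> = (\<Prod>i\<in>UNIV. \<integral>\<^sup>+ y. (if i = j then ennreal (y\<^sup>2) else 1) *
           ennreal (normal_density 0 (sqrt \<delta>) y) \<partial>lborel)"
      by (rule nn_integral_prod_vec[where h = "\<lambda>i y. (if i = j then ennreal (y\<^sup>2) else 1) *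
           ennreal (normal_density 0 (sqrt \<delta>) y)"]) auto
    also have "\<dots> = (\<Prod>i\<in>UNIV. if i = j then ennreal \<delta> else 1)"
    proof (rule prod.cong[OF refl])
      fix i :: 'n
      have *: "(\<integral>\<^sup>+ y. ennreal (y\<^sup>2) * ennreal (normal_density 0 (sqrt \<delta>) y) \<partial>lborel) = ennreal \<delta>"
      proof -
        have hb: "has_bochner_integral lborel (\<lambda>x. normal_density 0 (sqrt \<delta>) x * x\<^sup>2) \<delta>"
          using normal_moment_even[of "sqrt \<delta>" 0 1] \<delta> by (simp add: fact_numeral)
        have "(\<integral>\<^sup>+ y. ennreal (normal_density 0 (sqrt \<delta>) y * y\<^sup>2) \<partial>lborel) = ennreal \<delta>"
          using hb by (subst nn_integral_eq_integral)
            (auto simp: has_bochner_integral_iff)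
        then show ?thesis by (simp add: ennreal_mult mult.commute)
      qed
      have **: "(\<integral>\<^sup>+ y. ennreal (normal_density 0 (sqrt \<delta>) y) \<partial>lborel) = 1"
        using \<delta> by (simp add: nn_integral_eq_integral)
      show "(\<integral>\<^sup>+ y. (if i = j then ennreal (y\<^sup>2) else 1) * ennreal (normal_density 0 (sqrt \<delta>) y) \<partial>lborel)
        = (if i = j then ennreal \<delta> else 1)"
        using * ** by auto
    qed
    also have "\<dots> = ennreal \<delta>" by simp
    finally show ?thesis .
  qed
  have "(\<integral>\<^sup>+ x. ennreal ((norm x)\<^sup>2) * ennreal (gauss \<delta> (x::real^'n)) \<partial>lborel)
    = (\<integral>\<^sup>+ x. (\<Sum>j\<in>UNIV. ennreal ((x $ j)\<^sup>2) * ennreal (gauss \<delta> (x::real^'n))) \<partial>lborel)"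
    unfolding power2_norm_eq_inner inner_vec_def
    by (intro nn_integral_cong) (simp add: power2_eq_square sum_distrib_right[symmetric] sum_ennreal)
  also have "\<dots> = (\<Sum>j\<in>(UNIV::'n set). ennreal \<delta>)"
    by (subst nn_integral_sum) (auto simp: coord)
  also have "\<dots> = ennreal (real CARD('n) * \<delta>)"
    using \<delta> by (simp add: ennreal_mult ennreal_of_nat_eq_real_of_nat)
  finally show ?thesis .
qed

text \<open>Completing the square in each coordinate. This is Girsanov's theorem for a single
  increment of duration \<delta> with constant drift a.\<close>

lemma gauss_shift:
  fixes x a :: "real^'n::finite"
  assumes "0 < \<delta>"
  shows "exp (a \<bullet> x - 1 / 2 * (norm a)\<^sup>2 * \<delta>) * gauss \<delta> x = gauss \<delta> (x - \<delta> *\<^sub>R a)"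
proof -
  have "exp (a \<bullet> x - 1 / 2 * (norm a)\<^sup>2 * \<delta>) = (\<Prod>i\<in>UNIV. exp (a $ i * x $ i - 1 / 2 * (a $ i)\<^sup>2 * \<delta>))"
    unfolding power2_norm_eq_inner inner_vec_def
    by (simp add: exp_sum[symmetric] sum_subtractf sum_distrib_left sum_distrib_right power2_eq_square)
  also have "\<dots> * gauss \<delta> x = gauss \<delta> (x - \<delta> *\<^sub>R a)"
    unfolding gauss_def prod.distrib[symmetric]
  proof (rule prod.cong[OF refl])
    fix i
    have "exp (a $ i * x $ i - 1 / 2 * (a $ i)\<^sup>2 * \<delta>) * exp (- (x $ i)\<^sup>2 / (2 * \<delta>))
      = exp (- (x $ i - \<delta> * a $ i)\<^sup>2 / (2 * \<delta>))"
      using assms by (simp add: exp_add[symmetric] field_simps power2_eq_square)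
    then show "exp (a $ i * x $ i - 1 / 2 * (a $ i)\<^sup>2 * \<delta>) * normal_density 0 (sqrt \<delta>) (x $ i)
      = normal_density 0 (sqrt \<delta>) ((x - \<delta> *\<^sub>R a) $ i)"
      using assms by (simp add: normal_density_def)
  qed
  finally show ?thesis .
qed

lemma nn_integral_lborel_uminus:
  fixes f :: "'a::euclidean_space \<Rightarrow> ennreal"
  assumes [measurable]: "f \<in> borel_measurable borel"
  shows "(\<integral>\<^sup>+ x. f (- x) \<partial>lborel) = (\<integral>\<^sup>+ x. f x \<partial>lborel)"
proof -
  have "distr lborel borel (\<lambda>x. - x :: 'a) = lborel"
    using lborel_affine[of "-1" "0 :: 'a"] by (simp add: density_1 one_ennreal_def[symmetric])
  then have "(\<integral>\<^sup>+ x. f x \<partial>lborel) = (\<integral>\<^sup>+ x. f x \<partial>distr lborel borel (\<lambda>x. - x))" by simp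
  also have "\<dots> = (\<integral>\<^sup>+ x. f (- x) \<partial>lborel)"
    by (rule nn_integral_distr) auto
  finally show ?thesis by simp
qed

lemma nn_integral_lborel_translate:
  fixes f :: "'a::euclidean_space \<Rightarrow> ennreal"
  assumes [measurable]: "f \<in> borel_measurable borel"
  shows "(\<integral>\<^sup>+ x. f (x - a) \<partial>lborel) = (\<integral>\<^sup>+ x. f x \<partial>lborel)"
proof -
  have "distr lborel borel (\<lambda>x. x - a) = (lborel :: 'a measure)"
  proof -
    have "(\<lambda>x. x - a) = (+) (- a)" by (auto simp: fun_eq_iff)
    then show ?thesis using lborel_distr_plus[of "- a"] by simp
  qed
  then have "(\<integral>\<^sup>+ x. f x \<partial>lborel) = (\<integral>\<^sup>+ x. f x \<partial>distr lborel borel (\<lambda>x. x - a))" by simp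
  also have "\<dots> = (\<integral>\<^sup>+ x. f (x - a) \<partial>lborel)"
    by (rule nn_integral_distr) auto
  finally show ?thesis by simp
qed

text \<open>Increments are independent of all of \<open>F s\<close>, not merely of the past of
  \<beta>, so integrands may be adapted to F. Completeness of M and \<open>F_null\<close> let
  measurability pass between almost surely equal maps.\<close>

locale brownian_filtration = prob_space M + complete_measure M
  for M :: "'n::finite path measure" +
  fixes F :: "real \<Rightarrow> 'n path measure" and \<beta> :: "'n path \<Rightarrow> 'n path"
  assumes subalg: "\<And>t. subalgebra M (F t)"
    and F_mono: "\<And>s t. s \<le> t \<Longrightarrow> sets (F s) \<subseteq> sets (F t)"
    and F_null: "\<And>t. null_sets M \<subseteq> sets (F t)"
    and \<beta>_adapted: "\<And>t. t \<in> {0..1} \<Longrightarrow> (\<lambda>w. \<beta> w t) \<in> borel_measurable (F t)"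
    and \<beta>_continuous: "\<And>w. w \<in> space M \<Longrightarrow> continuous_on {0..1} (\<beta> w)"
    and \<beta>_increment: "\<And>s t. 0 \<le> s \<Longrightarrow> s < t \<Longrightarrow> t \<le> 1 \<Longrightarrow>
          distributed M lborel (\<lambda>w. \<beta> w t - \<beta> w s) (\<lambda>x. ennreal (gauss (t - s) x))"
    and \<beta>_indep: "\<And>s t. 0 \<le> s \<Longrightarrow> s < t \<Longrightarrow> t \<le> 1 \<Longrightarrow>
          indep_set (sets (F s)) {(\<lambda>w. \<beta> w t - \<beta> w s) -` A \<inter> space M | A. A \<in> sets borel}"
begin

section \<open>Measurability in the past and integration over one increment\<close>

lemma space_F [simp]: "space (F t) = space M"
  using subalg[of t] by (simp add: subalgebra_def)

lemma sets_F_subset: "sets (F t) \<subseteq> sets M"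
  using subalg[of t] by (simp add: subalgebra_def)

lemma measurable_F_imp: "f \<in> F t \<rightarrow>\<^sub>M N \<Longrightarrow> f \<in> M \<rightarrow>\<^sub>M N"
  by (rule measurable_from_subalg[OF subalg])

lemma measurable_F_mono: "f \<in> F s \<rightarrow>\<^sub>M N \<Longrightarrow> s \<le> t \<Longrightarrow> f \<in> F t \<rightarrow>\<^sub>M N"
  using F_mono[of s t] by (auto simp: measurable_def)

text \<open>The preimages under f and g differ only inside a null set; every part of it is null by
  completeness and hence lies in \<open>F t\<close>. Only the range of g is constrained beforehand,
  not its measurability.\<close>

lemma measurable_F_AE:
  assumes f: "f \<in> F t \<rightarrow>\<^sub>M N" and ae: "AE w in M. f w = g w"
    and g: "g \<in> space M \<rightarrow> space N"
  shows "g \<in> F t \<rightarrow>\<^sub>M N"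
proof (rule measurableI)
  fix A assume A: "A \<in> sets N"
  obtain Z where Z: "Z \<in> null_sets M" "{w\<in>space M. f w \<noteq> g w} \<subseteq> Z"
    using ae by (auto elim!: AE_E)
  have "g -` A \<inter> space M = (f -` A \<inter> space M - Z) \<union> (g -` A \<inter> Z \<inter> space M)"
    using Z by auto
  moreover have "g -` A \<inter> Z \<inter> space M \<in> null_sets M"
    by (rule complete2[OF _ Z(1)]) auto
  ultimately show "g -` A \<inter> space (F t) \<in> sets (F t)"
    using measurable_sets[OF f A] F_null[of t] Z(1) by (auto intro!: sets.Un sets.Diff)
qed (use g in auto)

lemma \<beta>_measurable: "t \<in> {0..1} \<Longrightarrow> (\<lambda>w. \<beta> w t) \<in> borel_measurable M"
  by (rule measurable_F_imp[OF \<beta>_adapted])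

text \<open>By independence the joint law of the past and the increment is a product measure, and
  Tonelli integrates the increment out against its Gaussian density. Moments and Girsanov weights of
  an increment all reduce to this formula.\<close>

lemma nn_integral_increment:
  assumes st: "0 \<le> s" "s < t" "t \<le> 1" and G [measurable]: "G \<in> borel_measurable (F s \<Otimes>\<^sub>M borel)"
  shows "(\<integral>\<^sup>+ w. G (w, \<beta> w t - \<beta> w s) \<partial>M)
    = (\<integral>\<^sup>+ w. \<integral>\<^sup>+ x. G (w, x) * ennreal (gauss (t - s) x) \<partial>lborel \<partial>M)"
proof -
  let ?D = "\<lambda>w. \<beta> w t - \<beta> w s"
  have D [measurable]: "?D \<in> borel_measurable M"
    using \<beta>_measurable[of t] \<beta>_measurable[of s] st by simp
  \<comment> \<open>The identity as a random element of \<open>F s\<close>: its law is M restricted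
    to the past, which lets independence be phrased as a product of laws.\<close>
  have id [measurable]: "(\<lambda>w. w) \<in> M \<rightarrow>\<^sub>M F s"
    using sets_F_subset by (auto simp: measurable_def)
  interpret P: prob_space "distr M borel ?D" by (rule prob_space_distr) simp
  interpret Q: prob_space "distr M (F s) (\<lambda>w. w)" by (rule prob_space_distr) simp
  have eq: "distr M (F s) (\<lambda>w. w) \<Otimes>\<^sub>M distr M borel ?D = distr M (F s \<Otimes>\<^sub>M borel) (\<lambda>w. (w, ?D w))"
  proof (rule pair_measure_eqI)
    fix A B assume "A \<in> sets (distr M (F s) (\<lambda>w. w))" "B \<in> sets (distr M borel ?D)"
    then have A [measurable]: "A \<in> sets (F s)" and B [measurable]: "B \<in> sets borel" by auto
    have AM: "A \<in> sets M" using A sets_F_subset[of s] by blast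
    have "prob (A \<inter> (?D -` B \<inter> space M)) = prob A * prob (?D -` B \<inter> space M)"
      by (rule indep_setD[OF \<beta>_indep[OF st] A]) (use B in auto)
    moreover have "(\<lambda>w. (w, ?D w)) -` (A \<times> B) \<inter> space M = A \<inter> (?D -` B \<inter> space M)"
      using sets.sets_into_space[OF AM] by auto
    moreover have "(\<lambda>w. w) -` A \<inter> space M = A"
      using sets.sets_into_space[OF AM] by auto
    ultimately show "emeasure (distr M (F s) (\<lambda>w. w)) A * emeasure (distr M borel ?D) B
        = emeasure (distr M (F s \<Otimes>\<^sub>M borel) (\<lambda>w. (w, ?D w))) (A \<times> B)"
      by (simp add: emeasure_distr emeasure_eq_measure ennreal_mult[symmetric])
  qed (use P.sigma_finite_measure_axioms Q.sigma_finite_measure_axioms in \<open>auto cong: sets_pair_measure_cong\<close>)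
  have dD: "distr M borel ?D = density lborel (\<lambda>x. ennreal (gauss (t - s) x))"
    using \<beta>_increment[OF st] by (simp add: distributed_def cong: distr_cong)
  have "(\<integral>\<^sup>+ w. G (w, ?D w) \<partial>M) = (\<integral>\<^sup>+ z. G z \<partial>distr M (F s \<Otimes>\<^sub>M borel) (\<lambda>w. (w, ?D w)))"
    by (subst nn_integral_distr) auto
  also have "\<dots> = (\<integral>\<^sup>+ w. \<integral>\<^sup>+ x. G (w, x) \<partial>distr M borel ?D \<partial>distr M (F s) (\<lambda>w. w))"
    unfolding eq[symmetric] by (rule P.nn_integral_fst[symmetric]) simp
  also have "\<dots> = (\<integral>\<^sup>+ w. \<integral>\<^sup>+ x. G (w, x) \<partial>distr M borel ?D \<partial>M)"
    by (subst nn_integral_distr) (auto intro!: P.borel_measurable_nn_integral)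
  also have "\<dots> = (\<integral>\<^sup>+ w. \<integral>\<^sup>+ x. G (w, x) * ennreal (gauss (t - s) x) \<partial>lborel \<partial>M)"
  proof (rule nn_integral_cong)
    fix w assume "w \<in> space M"
    then have [measurable]: "(\<lambda>x. G (w, x)) \<in> borel_measurable borel"
      by (intro measurable_compose[OF _ G]) auto
    show "(\<integral>\<^sup>+ x. G (w, x) \<partial>distr M borel ?D) = (\<integral>\<^sup>+ x. G (w, x) * ennreal (gauss (t - s) x) \<partial>lborel)"
      unfolding dD by (subst nn_integral_density) (auto simp: mult.commute)
  qed
  finally show ?thesis .
qed

lemma nn_integral_increment_uminus:
  assumes st: "0 \<le> s" "s < t" "t \<le> 1" and G [measurable]: "G \<in> borel_measurable (F s \<Otimes>\<^sub>M borel)"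
  shows "(\<integral>\<^sup>+ w. G (w, - (\<beta> w t - \<beta> w s)) \<partial>M) = (\<integral>\<^sup>+ w. G (w, \<beta> w t - \<beta> w s) \<partial>M)"
proof -
  have m [measurable]: "(\<lambda>(w, x). G (w, - x)) \<in> borel_measurable (F s \<Otimes>\<^sub>M borel)"
    by measurable
  have "(\<integral>\<^sup>+ w. G (w, - (\<beta> w t - \<beta> w s)) \<partial>M)
    = (\<integral>\<^sup>+ w. \<integral>\<^sup>+ x. G (w, - x) * ennreal (gauss (t - s) x) \<partial>lborel \<partial>M)"
    using nn_integral_increment[OF st m] by simp
  also have "\<dots> = (\<integral>\<^sup>+ w. \<integral>\<^sup>+ x. G (w, x) * ennreal (gauss (t - s) x) \<partial>lborel \<partial>M)"
  proof (rule nn_integral_cong)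
    fix w assume "w \<in> space M"
    then have [measurable]: "(\<lambda>x. G (w, x)) \<in> borel_measurable borel"
      by (intro measurable_compose[OF _ G]) auto
    show "(\<integral>\<^sup>+ x. G (w, - x) * ennreal (gauss (t - s) x) \<partial>lborel)
        = (\<integral>\<^sup>+ x. G (w, x) * ennreal (gauss (t - s) x) \<partial>lborel)"
      using nn_integral_lborel_uminus[of "\<lambda>x. G (w, x) * ennreal (gauss (t - s) x)"]
      by (simp add: gauss_uminus)
  qed
  also have "\<dots> = (\<integral>\<^sup>+ w. G (w, \<beta> w t - \<beta> w s) \<partial>M)"
    using nn_integral_increment[OF st G] by simp
  finally show ?thesis .
qed

text \<open>Cauchy-Schwarz bounds the squared inner product by the product of squared norms. The
  factor \<open>CARD('n)\<close> is lost against the Ito isometry, but cross moments of coordinates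
  never appear, and a bound is enough for the L2 construction.\<close>

lemma nn_integral_increment_sq_le:
  assumes st: "0 \<le> s" "s \<le> t" "t \<le> 1" and \<xi> [measurable]: "\<xi> \<in> borel_measurable (F s)"
  shows "(\<integral>\<^sup>+ w. ennreal ((\<xi> w \<bullet> (\<beta> w t - \<beta> w s))\<^sup>2) \<partial>M)
    \<le> ennreal (real CARD('n)) * (\<integral>\<^sup>+ w. ennreal ((norm (\<xi> w))\<^sup>2 * (t - s)) \<partial>M)"
proof (cases "s = t")
  case True then show ?thesis by simp
next
  case False
  with st have st': "0 \<le> s" "s < t" "t \<le> 1" by auto
  have "(\<integral>\<^sup>+ w. ennreal ((\<xi> w \<bullet> (\<beta> w t - \<beta> w s))\<^sup>2) \<partial>M)
    = (\<integral>\<^sup>+ w. \<integral>\<^sup>+ x. ennreal ((\<xi> w \<bullet> x)\<^sup>2) * ennreal (gauss (t - s) x) \<partial>lborel \<partial>M)"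
    using nn_integral_increment[OF st', of "\<lambda>(w, x). ennreal ((\<xi> w \<bullet> x)\<^sup>2)"] by simp
  also have "\<dots> \<le> (\<integral>\<^sup>+ w. ennreal ((norm (\<xi> w))\<^sup>2) * ennreal (real CARD('n) * (t - s)) \<partial>M)"
  proof (rule nn_integral_mono)
    fix w
    have "(\<integral>\<^sup>+ x. ennreal ((\<xi> w \<bullet> x)\<^sup>2) * ennreal (gauss (t - s) x) \<partial>lborel)
      \<le> (\<integral>\<^sup>+ (x::real^'n). ennreal ((norm (\<xi> w))\<^sup>2) * (ennreal ((norm x)\<^sup>2) * ennreal (gauss (t - s) x)) \<partial>lborel)"
    proof (rule nn_integral_mono)
      fix x :: "real^'n"
      have "(\<xi> w \<bullet> x)\<^sup>2 \<le> (norm (\<xi> w))\<^sup>2 * (norm x)\<^sup>2"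
        using power_mono[OF Cauchy_Schwarz_ineq2[of "\<xi> w" x], of 2] by (simp add: power_mult_distrib)
      then show "ennreal ((\<xi> w \<bullet> x)\<^sup>2) * ennreal (gauss (t - s) x)
        \<le> ennreal ((norm (\<xi> w))\<^sup>2) * (ennreal ((norm x)\<^sup>2) * ennreal (gauss (t - s) x))"
        unfolding mult.assoc[symmetric]
        by (intro mult_right_mono) (simp_all add: ennreal_mult[symmetric] ennreal_leI)
    qed
    also have "\<dots> = ennreal ((norm (\<xi> w))\<^sup>2) * ennreal (real CARD('n) * (t - s))"
      using st' by (subst nn_integral_cmult) (auto simp: nn_integral_gauss_norm_sq)
    finally show "(\<integral>\<^sup>+ x. ennreal ((\<xi> w \<bullet> x)\<^sup>2) * ennreal (gauss (t - s) x) \<partial>lborel)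
      \<le> ennreal ((norm (\<xi> w))\<^sup>2) * ennreal (real CARD('n) * (t - s))" .
  qed
  also have "\<dots> = (\<integral>\<^sup>+ w. ennreal (real CARD('n)) * ennreal ((norm (\<xi> w))\<^sup>2 * (t - s)) \<partial>M)"
    using st' by (intro nn_integral_cong) (simp add: ennreal_mult[symmetric] mult.commute mult.left_commute)
  also have "\<dots> = ennreal (real CARD('n)) * (\<integral>\<^sup>+ w. ennreal ((norm (\<xi> w))\<^sup>2 * (t - s)) \<partial>M)"
    using measurable_F_imp[OF \<xi>] by (intro nn_integral_cmult) simp
  finally show ?thesis .
qed

text \<open>Given the past, the increment and its negative have the same law, so the positive and
  negative parts of the inner product have equal integrals; integrability makes their difference
  0.\<close>

lemma expectation_increment_eq_0:
  assumes st: "0 \<le> s" "s \<le> t" "t \<le> 1" and \<zeta> [measurable]: "\<zeta> \<in> borel_measurable (F s)"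
    and int: "integrable M (\<lambda>w. \<zeta> w \<bullet> (\<beta> w t - \<beta> w s))"
  shows "(\<integral> w. \<zeta> w \<bullet> (\<beta> w t - \<beta> w s) \<partial>M) = 0"
proof (cases "s = t")
  case True then show ?thesis by simp
next
  case False
  with st have st': "0 \<le> s" "s < t" "t \<le> 1" by auto
  have "(\<integral>\<^sup>+ w. ennreal (- (\<zeta> w \<bullet> (\<beta> w t - \<beta> w s))) \<partial>M) = (\<integral>\<^sup>+ w. ennreal (\<zeta> w \<bullet> (\<beta> w t - \<beta> w s)) \<partial>M)"
    using nn_integral_increment_uminus[OF st', of "\<lambda>(w, x). ennreal (\<zeta> w \<bullet> x)"]
    by (simp add: inner_diff_right)
  then show ?thesis
    by (simp add: real_lebesgue_integral_def[OF int])
qed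

text \<open>With the past frozen, \<open>gauss_shift\<close> with a equal to the value of \<xi>
  absorbs the exponential into a translated Gaussian density, and translation invariance of Lebesgue
  measure removes the shift.\<close>

lemma nn_integral_increment_girsanov:
  assumes st: "0 \<le> s" "s \<le> t" "t \<le> 1" and \<xi> [measurable]: "\<xi> \<in> borel_measurable (F s)"
    and G [measurable]: "G \<in> borel_measurable (F s \<Otimes>\<^sub>M borel)"
  shows "(\<integral>\<^sup>+ w. ennreal (exp (\<xi> w \<bullet> (\<beta> w t - \<beta> w s) - 1 / 2 * (norm (\<xi> w))\<^sup>2 * (t - s)))
            * G (w, \<beta> w t - \<beta> w s - (t - s) *\<^sub>R \<xi> w) \<partial>M)
    = (\<integral>\<^sup>+ w. G (w, \<beta> w t - \<beta> w s) \<partial>M)"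
proof (cases "s = t")
  case True then show ?thesis by simp
next
  case False
  with st have st': "0 \<le> s" "s < t" "t \<le> 1" by auto
  have m [measurable]: "(\<lambda>(w, x). ennreal (exp (\<xi> w \<bullet> x - 1 / 2 * (norm (\<xi> w))\<^sup>2 * (t - s)))
      * G (w, x - (t - s) *\<^sub>R \<xi> w)) \<in> borel_measurable (F s \<Otimes>\<^sub>M borel)"
    by measurable
  have "(\<integral>\<^sup>+ w. ennreal (exp (\<xi> w \<bullet> (\<beta> w t - \<beta> w s) - 1 / 2 * (norm (\<xi> w))\<^sup>2 * (t - s)))
            * G (w, \<beta> w t - \<beta> w s - (t - s) *\<^sub>R \<xi> w) \<partial>M)
    = (\<integral>\<^sup>+ w. \<integral>\<^sup>+ x. ennreal (exp (\<xi> w \<bullet> x - 1 / 2 * (norm (\<xi> w))\<^sup>2 * (t - s)))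
      * G (w, x - (t - s) *\<^sub>R \<xi> w) * ennreal (gauss (t - s) x) \<partial>lborel \<partial>M)"
    using nn_integral_increment[OF st' m] by simp
  also have "\<dots> = (\<integral>\<^sup>+ w. \<integral>\<^sup>+ x. G (w, x) * ennreal (gauss (t - s) x) \<partial>lborel \<partial>M)"
  proof (rule nn_integral_cong)
    fix w assume "w \<in> space M"
    then have [measurable]: "(\<lambda>x. G (w, x)) \<in> borel_measurable borel"
      by (intro measurable_compose[OF _ G]) auto
    have "(\<integral>\<^sup>+ x. ennreal (exp (\<xi> w \<bullet> x - 1 / 2 * (norm (\<xi> w))\<^sup>2 * (t - s)))
      * G (w, x - (t - s) *\<^sub>R \<xi> w) * ennreal (gauss (t - s) x) \<partial>lborel)
      = (\<integral>\<^sup>+ x. G (w, x - (t - s) *\<^sub>R \<xi> w) * ennreal (gauss (t - s) (x - (t - s) *\<^sub>R \<xi> w)) \<partial>lborel)"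
      using st' by (intro nn_integral_cong)
        (simp add: gauss_shift[symmetric] ennreal_mult mult_ac)
    also have "\<dots> = (\<integral>\<^sup>+ x. G (w, x) * ennreal (gauss (t - s) x) \<partial>lborel)"
      by (rule nn_integral_lborel_translate) simp
    finally show "(\<integral>\<^sup>+ x. ennreal (exp (\<xi> w \<bullet> x - 1 / 2 * (norm (\<xi> w))\<^sup>2 * (t - s)))
      * G (w, x - (t - s) *\<^sub>R \<xi> w) * ennreal (gauss (t - s) x) \<partial>lborel)
      = (\<integral>\<^sup>+ x. G (w, x) * ennreal (gauss (t - s) x) \<partial>lborel)" .
  qed
  also have "\<dots> = (\<integral>\<^sup>+ w. G (w, \<beta> w t - \<beta> w s) \<partial>M)"
    using nn_integral_increment[OF st' G] by simp
  finally show ?thesis .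
qed

end

section \<open>Elementary integrands\<close>

text \<open>The cells are disjoint, so at most one summand is nonzero at each time and the square of
  the sum has no cross terms.\<close>

lemma elementary_integrand_norm_sq:
  assumes "\<And>i. i < k \<Longrightarrow> t i \<le> t (Suc i)"
  shows "(norm (elementary_integrand k t \<xi> w s))\<^sup>2
    = (\<Sum>i<k. indicat_real {t i<..t (Suc i)} s * (norm (\<xi> i w))\<^sup>2)"
  using assms
proof (induction k)
  case 0
  then show ?case by (simp add: elementary_integrand_def)
next
  case (Suc k)
  have mono: "t i \<le> t j" if "i \<le> j" "j \<le> Suc k" for i j
    using that(1,2)
  proof (induction j rule: dec_induct)
    case (step n) then show ?case using Suc.prems[of n] by auto
  qed simp
  show ?case
  proof (cases "s \<in> {t k<..t (Suc k)}")
    case True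
    have "indicat_real {t i<..t (Suc i)} s = 0" if "i < k" for i
      using True mono[of "Suc i" k] that by (auto simp: indicator_def)
    then show ?thesis using True by (simp add: elementary_integrand_def)
  next
    case False
    then show ?thesis using Suc by (simp add: elementary_integrand_def)
  qed
qed

lemma integral_Ioc_indicator:
  fixes x :: "'a::{banach, second_countable_topology}"
  assumes "a \<le> b"
  shows "integrable lborel (\<lambda>s. indicat_real {a<..b} s *\<^sub>R x)"
    and "(LINT s|lborel. indicat_real {a<..b} s *\<^sub>R x) = (b - a) *\<^sub>R x"
  using assms by auto

text \<open>The squared norm in L2([0,1]), hence the squared Cameron-Martin norm when g is a
  derivative. It is 0 by convention if the squared norm is not integrable, which is why square
  integrability is carried along separately.\<close>

definition energy :: "(real \<Rightarrow> 'a::real_normed_vector) \<Rightarrow> real" where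
  "energy g = (LINT s:{0..1}|lborel. (norm (g s))\<^sup>2)"

lemma energy_nonneg: "0 \<le> energy g"
  unfolding energy_def set_lebesgue_integral_def by (intro integral_nonneg_AE) auto

text \<open>The points of S from a up to b occupy consecutive positions in the sorted enumeration,
  so the filtered sum telescopes. With h an indicator or a path of \<beta>, this compares a coarse
  cell with the finer cells inside it.\<close>

lemma sorted_enum_telescope:
  fixes h :: "real \<Rightarrow> 'a::real_vector"
  assumes S: "finite S" and ab: "a \<in> S" "b \<in> S" "a \<le> b"
  defines "e \<equiv> \<lambda>j. sorted_list_of_set S ! j"
  shows "(\<Sum>j<card S - 1. if a \<le> e j \<and> e j < b then h (e (Suc j)) - h (e j) else 0) = h b - h a"
proof -
  have len: "length (sorted_list_of_set S) = card S" by simp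
  have mono: "e i < e j \<longleftrightarrow> i < j" if "i < card S" "j < card S" for i j
  proof -
    have lt: "e i < e j" if "i < j" "j < card S" for i j
      unfolding e_def using that by (intro sorted_wrt_nth_less[OF strict_sorted_list_of_set]) auto
    show ?thesis using lt[of i j] lt[of j i] that by (cases i j rule: linorder_cases) auto
  qed
  obtain p where p: "p < card S" "a = e p"
    using ab(1) S unfolding e_def by (metis in_set_conv_nth len set_sorted_list_of_set)
  obtain q where q: "q < card S" "b = e q"
    using ab(2) S unfolding e_def by (metis in_set_conv_nth len set_sorted_list_of_set)
  have pq: "p \<le> q" using ab(3) mono[of q p] p q by force
  have "(\<Sum>j<card S - 1. if a \<le> e j \<and> e j < b then h (e (Suc j)) - h (e j) else 0)
    = (\<Sum>j\<in>{p..<q}. h (e (Suc j)) - h (e j))"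
  proof (rule sum.mono_neutral_cong_right)
    show "{p..<q} \<subseteq> {..<card S - 1}" using q by auto
    show "\<forall>i\<in>{..<card S - 1} - {p..<q}. (if a \<le> e i \<and> e i < b then h (e (Suc i)) - h (e i) else 0) = 0"
    proof
      fix i assume i: "i \<in> {..<card S - 1} - {p..<q}"
      then show "(if a \<le> e i \<and> e i < b then h (e (Suc i)) - h (e i) else 0) = 0"
        using mono[of i p] mono[of i q] p q by force
    qed
    fix i assume "i \<in> {p..<q}"
    then show "(if a \<le> e i \<and> e i < b then h (e (Suc i)) - h (e i) else 0) = h (e (Suc i)) - h (e i)"
      using mono[of i p] mono[of i q] p q by force
  qed simp
  also have "\<dots> = h b - h a"
    using sum_Suc_diff'[OF pq, of "\<lambda>j. h (e j)"] p q by simp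
  finally show ?thesis .
qed

section \<open>Elementary stochastic integrals: moments, refinement, truncation, Girsanov\<close>

context brownian_filtration
begin

text \<open>The counterpart of \<open>elementary_data\<close> for an abstract filtration F; the two
  coincide for the canonical filtration.\<close>

definition elementary :: "nat \<Rightarrow> (nat \<Rightarrow> real) \<Rightarrow> (nat \<Rightarrow> 'n path \<Rightarrow> real^'n) \<Rightarrow> bool" where
  "elementary k t \<xi> \<longleftrightarrow> 0 \<le> t 0 \<and> t k \<le> 1 \<and>
     (\<forall>i<k. t i \<le> t (Suc i) \<and> \<xi> i \<in> borel_measurable (F (t i)) \<and> bounded (\<xi> i ` space M))"

lemma elementary_mono:
  assumes e: "elementary k t \<xi>" and "i \<le> j" "j \<le> k" shows "t i \<le> t j"
  using assms(2,3)
proof (induction j rule: dec_induct)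
  case (step n)
  have "t n \<le> t (Suc n)" using e step.prems by (auto simp: elementary_def)
  with step show ?case by auto
qed simp

lemma elementary_bounds:
  assumes "elementary k t \<xi>" "i \<le> k" shows "0 \<le> t i" "t i \<le> 1"
  using elementary_mono[OF assms(1), of 0 i] elementary_mono[OF assms(1), of i k] assms
  by (auto simp: elementary_def)

lemma elementary_step: "elementary k t \<xi> \<Longrightarrow> i < k \<Longrightarrow> t i \<le> t (Suc i)"
  by (auto simp: elementary_def)

lemma elementary_measurable: "elementary k t \<xi> \<Longrightarrow> i < k \<Longrightarrow> \<xi> i \<in> borel_measurable (F (t i))"
  by (auto simp: elementary_def)

lemma elementary_measurable_M: "elementary k t \<xi> \<Longrightarrow> i < k \<Longrightarrow> \<xi> i \<in> borel_measurable M"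
  by (rule measurable_F_imp[OF elementary_measurable])

lemma elementary_Suc_imp: "elementary (Suc k) t \<xi> \<Longrightarrow> elementary k t \<xi>"
  using elementary_bounds(2)[of "Suc k" t \<xi> k] by (auto simp: elementary_def)

lemma elementary_bounded:
  assumes "elementary k t \<xi>" "i < k" obtains B where "\<And>w. w \<in> space M \<Longrightarrow> norm (\<xi> i w) \<le> B"
proof -
  have "bounded (\<xi> i ` space M)" using assms by (simp add: elementary_def)
  then obtain B where "\<forall>x\<in>\<xi> i ` space M. norm x \<le> B" unfolding bounded_iff ..
  then show ?thesis by (intro that[of B]) simp
qed

lemma elementary_energy:
  assumes e: "elementary k t \<xi>"
  shows "energy (elementary_integrand k t \<xi> w) = (\<Sum>i<k. (norm (\<xi> i w))\<^sup>2 * (t (Suc i) - t i))"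
proof -
  have "energy (elementary_integrand k t \<xi> w)
    = (LINT s|lborel. (\<Sum>i<k. indicat_real {t i<..t (Suc i)} s *\<^sub>R (norm (\<xi> i w))\<^sup>2))"
    unfolding energy_def set_lebesgue_integral_def
  proof (rule Bochner_Integration.integral_cong[OF refl])
    fix s
    have "indicat_real {0..1} s * indicat_real {t i<..t (Suc i)} s = indicat_real {t i<..t (Suc i)} s"
      if "i < k" for i
      using elementary_bounds[OF e, of i] elementary_bounds[OF e, of "Suc i"] that
      by (auto simp: indicator_def)
    then have "(\<Sum>i<k. indicat_real {0..1} s * indicat_real {t i<..t (Suc i)} s * (norm (\<xi> i w))\<^sup>2)
      = (\<Sum>i<k. indicat_real {t i<..t (Suc i)} s * (norm (\<xi> i w))\<^sup>2)"
      by (intro sum.cong) auto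
    then show "indicat_real {0..1} s *\<^sub>R (norm (elementary_integrand k t \<xi> w s))\<^sup>2
      = (\<Sum>i<k. indicat_real {t i<..t (Suc i)} s *\<^sub>R (norm (\<xi> i w))\<^sup>2)"
      by (subst elementary_integrand_norm_sq)
        (simp_all only: elementary_step[OF e] sum_distrib_left mult.assoc real_scaleR_def)
  qed
  also have "\<dots> = (\<Sum>i<k. (t (Suc i) - t i) *\<^sub>R (norm (\<xi> i w))\<^sup>2)"
    by (subst Bochner_Integration.integral_sum)
       (auto intro!: sum.cong simp: integral_Ioc_indicator elementary_step[OF e] simp del: real_scaleR_def)
  finally show ?thesis by (simp add: mult.commute)
qed

lemma elementary_energy_measurable:
  "elementary k t \<xi> \<Longrightarrow> (\<lambda>w. energy (elementary_integrand k t \<xi> w)) \<in> borel_measurable M"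
proof -
  assume e: "elementary k t \<xi>"
  have "(\<lambda>w. (norm (\<xi> i w))\<^sup>2 * (t (Suc i) - t i)) \<in> borel_measurable M" if "i < k" for i
    using elementary_measurable_M[OF e that] by simp
  then show ?thesis
    unfolding elementary_energy[OF e] by (intro borel_measurable_sum) simp
qed

lemma elementary_integral_measurable:
  assumes e: "elementary k t \<xi>"
  shows "elementary_integral \<beta> k t \<xi> \<in> borel_measurable (F (t k))"
proof -
  have "(\<lambda>w. \<xi> i w \<bullet> (\<beta> w (t (Suc i)) - \<beta> w (t i))) \<in> borel_measurable (F (t k))" if "i < k" for i
  proof -
    have [measurable]: "\<xi> i \<in> borel_measurable (F (t k))"
      using measurable_F_mono[OF elementary_measurable[OF e that]] elementary_mono[OF e, of i k] that by simp
    have [measurable]: "(\<lambda>w. \<beta> w (t j)) \<in> borel_measurable (F (t k))" if "j \<le> k" for j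
      using measurable_F_mono[OF \<beta>_adapted[of "t j"]] elementary_mono[OF e, of j k] elementary_bounds[OF e, of j] that by simp
    have "(\<lambda>w. \<beta> w (t (Suc i))) \<in> borel_measurable (F (t k))" "(\<lambda>w. \<beta> w (t i)) \<in> borel_measurable (F (t k))"
      using that by auto
    then show ?thesis by simp
  qed
  then show ?thesis
    unfolding elementary_integral_def[abs_def] by (intro borel_measurable_sum) auto
qed

lemma elementary_integral_measurable_M:
  "elementary k t \<xi> \<Longrightarrow> elementary_integral \<beta> k t \<xi> \<in> borel_measurable M"
  by (rule measurable_F_imp[OF elementary_integral_measurable])

text \<open>When a step is added, the cross term pairs the new increment with a vector already known
  at its left end, so it has mean zero, and the new square is bounded by the one-increment estimate.
  Integrability belongs to the induction because the cross term needs it.\<close>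

lemma elementary_integral_sq:
  assumes "elementary k t \<xi>"
  shows "integrable M (\<lambda>w. (elementary_integral \<beta> k t \<xi> w)\<^sup>2) \<and>
    (\<integral> w. (elementary_integral \<beta> k t \<xi> w)\<^sup>2 \<partial>M)
      \<le> real CARD('n) * (\<Sum>i<k. \<integral> w. (norm (\<xi> i w))\<^sup>2 * (t (Suc i) - t i) \<partial>M)"
  using assms
proof (induction k)
  case 0 then show ?case by (simp add: elementary_integral_def)
next
  case (Suc k)
  let ?I = "elementary_integral \<beta> k t \<xi>"
  let ?D = "\<lambda>w. \<beta> w (t (Suc k)) - \<beta> w (t k)"
  note e = Suc.prems
  have e': "elementary k t \<xi>" by (rule elementary_Suc_imp[OF e])
  note b = elementary_bounds[OF e, of k] elementary_bounds[OF e, of "Suc k"] elementary_step[OF e, of k]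
  have \<xi>F [measurable]: "\<xi> k \<in> borel_measurable (F (t k))" using elementary_measurable[OF e, of k] by simp
  have \<xi> [measurable]: "\<xi> k \<in> borel_measurable M" using elementary_measurable_M[OF e, of k] by simp
  have D [measurable]: "?D \<in> borel_measurable M"
    using \<beta>_measurable[of "t k"] \<beta>_measurable[of "t (Suc k)"] b by simp
  have IF [measurable]: "?I \<in> borel_measurable (F (t k))" by (rule elementary_integral_measurable[OF e'])
  have I [measurable]: "?I \<in> borel_measurable M" by (rule elementary_integral_measurable_M[OF e'])
  obtain B where B: "\<And>w. w \<in> space M \<Longrightarrow> norm (\<xi> k w) \<le> B"
    using elementary_bounded[OF e, of k] by auto
  have i1: "integrable M (\<lambda>w. (norm (\<xi> k w))\<^sup>2 * (t (Suc k) - t k))"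
  proof (rule integrable_const_bound[of _ "B\<^sup>2 * (t (Suc k) - t k)"])
    show "AE w in M. norm ((norm (\<xi> k w))\<^sup>2 * (t (Suc k) - t k)) \<le> B\<^sup>2 * (t (Suc k) - t k)"
      using B b by (auto intro!: AE_I2 mult_right_mono power_mono)
  qed simp
  have le: "(\<integral>\<^sup>+ w. ennreal ((\<xi> k w \<bullet> ?D w)\<^sup>2) \<partial>M)
      \<le> ennreal (real CARD('n) * (\<integral> w. (norm (\<xi> k w))\<^sup>2 * (t (Suc k) - t k) \<partial>M))"
  proof -
    have "(\<integral>\<^sup>+ w. ennreal ((norm (\<xi> k w))\<^sup>2 * (t (Suc k) - t k)) \<partial>M)
      = ennreal (\<integral> w. (norm (\<xi> k w))\<^sup>2 * (t (Suc k) - t k) \<partial>M)"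
      using b by (intro nn_integral_eq_integral[OF i1]) simp
    then show ?thesis
      using nn_integral_increment_sq_le[of "t k" "t (Suc k)" "\<xi> k"] b
      by (simp add: ennreal_mult integral_nonneg_AE del: Bochner_Integration.integral_mult_left_zero)
  qed
  have i2: "integrable M (\<lambda>w. (\<xi> k w \<bullet> ?D w)\<^sup>2)"
    using le by (intro integrableI_bounded) (auto simp: less_top[symmetric] top_unique)
  have le2: "(\<integral> w. (\<xi> k w \<bullet> ?D w)\<^sup>2 \<partial>M) \<le> real CARD('n) * (\<integral> w. (norm (\<xi> k w))\<^sup>2 * (t (Suc k) - t k) \<partial>M)"
  proof -
    have "(\<integral>\<^sup>+ w. ennreal ((\<xi> k w \<bullet> ?D w)\<^sup>2) \<partial>M) = ennreal (\<integral> w. (\<xi> k w \<bullet> ?D w)\<^sup>2 \<partial>M)"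
      by (intro nn_integral_eq_integral[OF i2]) simp
    moreover have "0 \<le> real CARD('n) * (\<integral> w. (norm (\<xi> k w))\<^sup>2 * (t (Suc k) - t k) \<partial>M)"
      using b by (intro mult_nonneg_nonneg integral_nonneg_AE) auto
    ultimately show ?thesis using le by (simp add: ennreal_le_iff)
  qed
  have i3: "integrable M (\<lambda>w. (?I w)\<^sup>2)" using Suc.IH[OF e'] by simp
  \<comment> \<open>The product of two square-integrable factors is dominated by the sum of their
    squares.\<close>
  have i4: "integrable M (\<lambda>w. (?I w *\<^sub>R \<xi> k w) \<bullet> ?D w)"
  proof (rule Bochner_Integration.integrable_bound[OF Bochner_Integration.integrable_add[OF i2 i3]])
    show "AE w in M. norm ((?I w *\<^sub>R \<xi> k w) \<bullet> ?D w) \<le> norm ((\<xi> k w \<bullet> ?D w)\<^sup>2 + (?I w)\<^sup>2)"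
    proof (intro AE_I2)
      fix w
      have "2 * \<bar>?I w * (\<xi> k w \<bullet> ?D w)\<bar> \<le> (\<xi> k w \<bullet> ?D w)\<^sup>2 + (?I w)\<^sup>2"
        using sum_squares_bound[of "\<bar>?I w\<bar>" "\<bar>\<xi> k w \<bullet> ?D w\<bar>"] by (simp add: abs_mult mult.assoc)
      then show "norm ((?I w *\<^sub>R \<xi> k w) \<bullet> ?D w) \<le> norm ((\<xi> k w \<bullet> ?D w)\<^sup>2 + (?I w)\<^sup>2)"
        by simp
    qed
  qed measurable
  have z: "(\<integral> w. (?I w *\<^sub>R \<xi> k w) \<bullet> ?D w \<partial>M) = 0"
    using b i4 by (intro expectation_increment_eq_0) auto
  have eq: "(elementary_integral \<beta> (Suc k) t \<xi> w)\<^sup>2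
      = (?I w)\<^sup>2 + 2 * ((?I w *\<^sub>R \<xi> k w) \<bullet> ?D w) + (\<xi> k w \<bullet> ?D w)\<^sup>2" for w
    by (simp add: elementary_integral_def power2_eq_square algebra_simps)
  have int: "integrable M (\<lambda>w. (?I w)\<^sup>2 + 2 * ((?I w *\<^sub>R \<xi> k w) \<bullet> ?D w) + (\<xi> k w \<bullet> ?D w)\<^sup>2)"
    using i2 i3 i4 by (intro Bochner_Integration.integrable_add integrable_mult_right)
  have "(\<integral> w. (?I w)\<^sup>2 + 2 * ((?I w *\<^sub>R \<xi> k w) \<bullet> ?D w) + (\<xi> k w \<bullet> ?D w)\<^sup>2 \<partial>M)
    = (\<integral> w. (?I w)\<^sup>2 + 2 * ((?I w *\<^sub>R \<xi> k w) \<bullet> ?D w) \<partial>M) + (\<integral> w. (\<xi> k w \<bullet> ?D w)\<^sup>2 \<partial>M)"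
    using i2 i3 i4 by (intro Bochner_Integration.integral_add Bochner_Integration.integrable_add integrable_mult_right)
  also have "(\<integral> w. (?I w)\<^sup>2 + 2 * ((?I w *\<^sub>R \<xi> k w) \<bullet> ?D w) \<partial>M)
    = (\<integral> w. (?I w)\<^sup>2 \<partial>M) + (\<integral> w. 2 * ((?I w *\<^sub>R \<xi> k w) \<bullet> ?D w) \<partial>M)"
    using i3 i4 by (intro Bochner_Integration.integral_add integrable_mult_right)
  also have "(\<integral> w. 2 * ((?I w *\<^sub>R \<xi> k w) \<bullet> ?D w) \<partial>M) = 0"
    using z by (subst integral_mult_right_zero) simp
  finally have "(\<integral> w. (?I w)\<^sup>2 + 2 * ((?I w *\<^sub>R \<xi> k w) \<bullet> ?D w) + (\<xi> k w \<bullet> ?D w)\<^sup>2 \<partial>M)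
    \<le> real CARD('n) * (\<Sum>i<k. \<integral> w. (norm (\<xi> i w))\<^sup>2 * (t (Suc i) - t i) \<partial>M)
      + real CARD('n) * (\<integral> w. (norm (\<xi> k w))\<^sup>2 * (t (Suc k) - t k) \<partial>M)"
    using Suc.IH[OF e'] le2 by linarith
  then show ?case
    unfolding eq sum.lessThan_Suc distrib_left using int by blast
qed

lemma elementary_energy_integrable:
  assumes e: "elementary k t \<xi>"
  shows "integrable M (\<lambda>w. energy (elementary_integrand k t \<xi> w))"
    "(\<integral> w. energy (elementary_integrand k t \<xi> w) \<partial>M)
      = (\<Sum>i<k. \<integral> w. (norm (\<xi> i w))\<^sup>2 * (t (Suc i) - t i) \<partial>M)"
proof -
  have i: "integrable M (\<lambda>w. (norm (\<xi> i w))\<^sup>2 * (t (Suc i) - t i))" if i: "i < k" for i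
  proof -
    obtain B where B: "\<And>w. w \<in> space M \<Longrightarrow> norm (\<xi> i w) \<le> B"
      using elementary_bounded[OF e i] by auto
    note [measurable] = elementary_measurable_M[OF e i]
    show ?thesis
    proof (rule integrable_const_bound[of _ "B\<^sup>2 * (t (Suc i) - t i)"])
      show "AE w in M. norm ((norm (\<xi> i w))\<^sup>2 * (t (Suc i) - t i)) \<le> B\<^sup>2 * (t (Suc i) - t i)"
        using B elementary_step[OF e i] by (auto intro!: AE_I2 mult_right_mono power_mono)
    qed simp
  qed
  show "integrable M (\<lambda>w. energy (elementary_integrand k t \<xi> w))"
    unfolding elementary_energy[OF e] using i by (intro Bochner_Integration.integrable_sum) auto
  show "(\<integral> w. energy (elementary_integrand k t \<xi> w) \<partial>M)
      = (\<Sum>i<k. \<integral> w. (norm (\<xi> i w))\<^sup>2 * (t (Suc i) - t i) \<partial>M)"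
    unfolding elementary_energy[OF e] using i by (intro Bochner_Integration.integral_sum) auto
qed

lemma elementary_integral_sq_le:
  assumes e: "elementary k t \<xi>"
  shows "integrable M (\<lambda>w. (elementary_integral \<beta> k t \<xi> w)\<^sup>2)"
    "(\<integral> w. (elementary_integral \<beta> k t \<xi> w)\<^sup>2 \<partial>M)
      \<le> real CARD('n) * (\<integral> w. energy (elementary_integrand k t \<xi> w) \<partial>M)"
  using elementary_integral_sq[OF e] by (simp_all add: elementary_energy_integrable[OF e])

lemma integrable_if_sq_integrable:
  fixes X :: "'n path \<Rightarrow> real"
  assumes [measurable]: "X \<in> borel_measurable M" and "integrable M (\<lambda>w. (X w)\<^sup>2)"
  shows "integrable M X"
proof (rule Bochner_Integration.integrable_bound[OF Bochner_Integration.integrable_add[OF assms(2) integrable_const[of 1]]])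
  show "AE w in M. norm (X w) \<le> norm ((X w)\<^sup>2 + 1)"
  proof (intro AE_I2)
    fix w have "2 * \<bar>X w\<bar> * 1 \<le> \<bar>X w\<bar>\<^sup>2 + 1\<^sup>2" by (rule sum_squares_bound)
    then show "norm (X w) \<le> norm ((X w)\<^sup>2 + 1)" by simp
  qed
qed simp

lemma elementary_integral_integrable:
  "elementary k t \<xi> \<Longrightarrow> integrable M (elementary_integral \<beta> k t \<xi>)"
  by (rule integrable_if_sq_integrable[OF elementary_integral_measurable_M elementary_integral_sq_le(1)])

lemma elementary_integral_expectation:
  assumes "elementary k t \<xi>"
  shows "(\<integral> w. elementary_integral \<beta> k t \<xi> w \<partial>M) = 0"
  using assms
proof (induction k)
  case 0 then show ?case by (simp add: elementary_integral_def)
next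
  case (Suc k)
  let ?I = "elementary_integral \<beta> k t \<xi>"
  let ?D = "\<lambda>w. \<beta> w (t (Suc k)) - \<beta> w (t k)"
  note e = Suc.prems
  have e': "elementary k t \<xi>" by (rule elementary_Suc_imp[OF e])
  note b = elementary_bounds[OF e, of k] elementary_bounds[OF e, of "Suc k"] elementary_step[OF e, of k]
  have eq: "elementary_integral \<beta> (Suc k) t \<xi> = (\<lambda>w. ?I w + \<xi> k w \<bullet> ?D w)"
    by (simp add: elementary_integral_def fun_eq_iff)
  have i: "integrable M ?I" by (rule elementary_integral_integrable[OF e'])
  have i2: "integrable M (\<lambda>w. \<xi> k w \<bullet> ?D w)"
    using Bochner_Integration.integrable_diff[OF elementary_integral_integrable[OF e] i] by (simp add: eq)
  have "(\<integral> w. \<xi> k w \<bullet> ?D w \<partial>M) = 0"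
    using b elementary_measurable[OF e, of k] i2 by (intro expectation_increment_eq_0) auto
  then show ?case using Suc.IH[OF e'] i i2 by (simp add: eq)
qed

text \<open>Passing to a finer grid changes neither the integrand nor the integral. It serves to
  place two integrands on one grid and to insert extra observation times.\<close>

lemma elementary_refine:
  assumes e: "elementary k t \<xi>" and S: "finite S" "t ` {..k} \<subseteq> S" "S \<subseteq> {0..1}"
  obtains \<xi>' where "elementary (card S - 1) (\<lambda>j. sorted_list_of_set S ! j) \<xi>'"
    "\<And>w s. elementary_integrand (card S - 1) (\<lambda>j. sorted_list_of_set S ! j) \<xi>' w s = elementary_integrand k t \<xi> w s"
    "\<And>w. elementary_integral \<beta> (card S - 1) (\<lambda>j. sorted_list_of_set S ! j) \<xi>' w = elementary_integral \<beta> k t \<xi> w"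
proof
  let ?e = "\<lambda>j. sorted_list_of_set S ! j"
  \<comment> \<open>At most one i contributes: the old cell that contains the left end of the new
    one. The condition \<open>t i \<le> ?e j\<close> makes the value known at time
    \<open>?e j\<close>.\<close>
  define \<xi>' where "\<xi>' j w = (\<Sum>i<k. if t i \<le> ?e j \<and> ?e j < t (Suc i) then \<xi> i w else 0)" for j w
  have S0: "S \<noteq> {}" "0 < card S" using S by (auto simp: card_gt_0_iff)
  have in_S: "?e j \<in> S" if "j < card S" for j
    using that S(1) by (metis length_sorted_list_of_set nth_mem set_sorted_list_of_set)
  have tS: "t i \<in> S" if "i \<le> k" for i using S(2) that by auto
  show "elementary (card S - 1) ?e \<xi>'"
    unfolding elementary_def
  proof (intro conjI allI impI)
    show "0 \<le> ?e 0" "?e (card S - 1) \<le> 1" using in_S[of 0] in_S[of "card S - 1"] S0 S(3) by auto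
    fix j assume j: "j < card S - 1"
    show "?e j \<le> ?e (Suc j)"
      using j by (intro sorted_nth_mono) auto
    show "\<xi>' j \<in> borel_measurable (F (?e j))"
      unfolding \<xi>'_def[abs_def]
    proof (intro borel_measurable_sum)
      fix i assume "i \<in> {..<k}"
      then show "(\<lambda>w. if t i \<le> ?e j \<and> ?e j < t (Suc i) then \<xi> i w else 0) \<in> borel_measurable (F (?e j))"
        using measurable_F_mono[OF elementary_measurable[OF e, of i], of "?e j"]
        by (cases "t i \<le> ?e j \<and> ?e j < t (Suc i)") auto
    qed
    have "\<exists>B. \<forall>w\<in>space M. norm (\<xi> i w) \<le> B" if "i < k" for i
      using elementary_bounded[OF e that] by metis
    then obtain B where B: "\<And>i w. i < k \<Longrightarrow> w \<in> space M \<Longrightarrow> norm (\<xi> i w) \<le> B i" by metis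
    have "norm (\<xi>' j w) \<le> (\<Sum>i<k. \<bar>B i\<bar>)" if "w \<in> space M" for w
      unfolding \<xi>'_def
    proof (intro sum_norm_le)
      fix i assume "i \<in> {..<k}"
      then show "norm (if t i \<le> ?e j \<and> ?e j < t (Suc i) then \<xi> i w else 0) \<le> \<bar>B i\<bar>"
        using B[of i w] that by auto
    qed
    then show "bounded (\<xi>' j ` space M)"
      unfolding bounded_iff by blast
  qed
  show "elementary_integrand (card S - 1) ?e \<xi>' w s = elementary_integrand k t \<xi> w s" for w s
  proof -
    \<comment> \<open>Viewed as a function of the end point x, this makes the indicator of a cell a
      difference of two values of \<open>?h\<close>, so the telescoping lemma applies to integrands
      as it does to increments of \<beta>.\<close>
    let ?h = "\<lambda>x. indicat_real {..x} s"
    have ind: "indicat_real {a<..b} s = ?h b - ?h a" if "a \<le> b" for a b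
      using that by (auto simp: indicator_def)
    have mono: "?e j \<le> ?e (Suc j)" if "j < card S - 1" for j
      using that by (intro sorted_nth_mono) auto
    have "elementary_integrand (card S - 1) ?e \<xi>' w s
      = (\<Sum>j<card S - 1. \<Sum>i<k. (if t i \<le> ?e j \<and> ?e j < t (Suc i) then ?h (?e (Suc j)) - ?h (?e j) else 0) *\<^sub>R \<xi> i w)"
      unfolding elementary_integrand_def \<xi>'_def scaleR_sum_right
      by (intro sum.cong refl) (auto simp: ind mono)
    also have "\<dots> = (\<Sum>i<k. (\<Sum>j<card S - 1. if t i \<le> ?e j \<and> ?e j < t (Suc i) then ?h (?e (Suc j)) - ?h (?e j) else 0) *\<^sub>R \<xi> i w)"
      unfolding scaleR_sum_left by (rule sum.swap)
    also have "\<dots> = elementary_integrand k t \<xi> w s"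
      unfolding elementary_integrand_def
    proof (intro sum.cong refl)
      fix i assume i: "i \<in> {..<k}"
      then have "t i \<le> t (Suc i)" using elementary_step[OF e] by auto
      then show "(\<Sum>j<card S - 1. if t i \<le> ?e j \<and> ?e j < t (Suc i) then ?h (?e (Suc j)) - ?h (?e j) else 0) *\<^sub>R \<xi> i w
        = indicat_real {t i<..t (Suc i)} s *\<^sub>R \<xi> i w"
        using i tS[of i] tS[of "Suc i"] by (subst sorted_enum_telescope[OF S(1)]) (auto simp: ind)
    qed
    finally show ?thesis .
  qed
  show "elementary_integral \<beta> (card S - 1) ?e \<xi>' w = elementary_integral \<beta> k t \<xi> w" for w
  proof -
    have "elementary_integral \<beta> (card S - 1) ?e \<xi>' w
      = (\<Sum>j<card S - 1. \<Sum>i<k. \<xi> i w \<bullet> (if t i \<le> ?e j \<and> ?e j < t (Suc i) then \<beta> w (?e (Suc j)) - \<beta> w (?e j) else 0))"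
      unfolding elementary_integral_def \<xi>'_def inner_sum_left
      by (intro sum.cong refl) auto
    also have "\<dots> = (\<Sum>i<k. \<xi> i w \<bullet> (\<Sum>j<card S - 1. if t i \<le> ?e j \<and> ?e j < t (Suc i) then \<beta> w (?e (Suc j)) - \<beta> w (?e j) else 0))"
      unfolding inner_sum_right by (rule sum.swap)
    also have "\<dots> = elementary_integral \<beta> k t \<xi> w"
      unfolding elementary_integral_def
    proof (intro sum.cong refl)
      fix i assume i: "i \<in> {..<k}"
      then have "t i \<le> t (Suc i)" using elementary_step[OF e] by auto
      then show "\<xi> i w \<bullet> (\<Sum>j<card S - 1. if t i \<le> ?e j \<and> ?e j < t (Suc i) then \<beta> w (?e (Suc j)) - \<beta> w (?e j) else 0)
        = \<xi> i w \<bullet> (\<beta> w (t (Suc i)) - \<beta> w (t i))"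
        using i tS[of i] tS[of "Suc i"] by (subst sorted_enum_telescope[OF S(1), where h="\<beta> w"]) auto
    qed
    finally show ?thesis .
  qed
qed

text \<open>Both integrands are moved to the union of their grids, where they can be subtracted cell
  by cell.\<close>

lemma elementary_diff:
  assumes e1: "elementary k1 t1 \<xi>1" and e2: "elementary k2 t2 \<xi>2"
  obtains k t \<xi> where "elementary k t \<xi>"
    "\<And>w s. elementary_integrand k t \<xi> w s = elementary_integrand k1 t1 \<xi>1 w s - elementary_integrand k2 t2 \<xi>2 w s"
    "\<And>w. elementary_integral \<beta> k t \<xi> w = elementary_integral \<beta> k1 t1 \<xi>1 w - elementary_integral \<beta> k2 t2 \<xi>2 w"
proof -
  define S where "S = t1 ` {..k1} \<union> t2 ` {..k2}"
  have S: "finite S" "t1 ` {..k1} \<subseteq> S" "t2 ` {..k2} \<subseteq> S" "S \<subseteq> {0..1}"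
    using elementary_bounds[OF e1] elementary_bounds[OF e2] by (auto simp: S_def)
  obtain \<eta>1 where 1: "elementary (card S - 1) (\<lambda>j. sorted_list_of_set S ! j) \<eta>1"
    "\<And>w s. elementary_integrand (card S - 1) (\<lambda>j. sorted_list_of_set S ! j) \<eta>1 w s = elementary_integrand k1 t1 \<xi>1 w s"
    "\<And>w. elementary_integral \<beta> (card S - 1) (\<lambda>j. sorted_list_of_set S ! j) \<eta>1 w = elementary_integral \<beta> k1 t1 \<xi>1 w"
    by (rule elementary_refine[OF e1 S(1,2,4)], rule that)
  obtain \<eta>2 where 2: "elementary (card S - 1) (\<lambda>j. sorted_list_of_set S ! j) \<eta>2"
    "\<And>w s. elementary_integrand (card S - 1) (\<lambda>j. sorted_list_of_set S ! j) \<eta>2 w s = elementary_integrand k2 t2 \<xi>2 w s"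
    "\<And>w. elementary_integral \<beta> (card S - 1) (\<lambda>j. sorted_list_of_set S ! j) \<eta>2 w = elementary_integral \<beta> k2 t2 \<xi>2 w"
    by (rule elementary_refine[OF e2 S(1,3,4)], rule that)
  show ?thesis
  proof (rule that[of "card S - 1" "\<lambda>j. sorted_list_of_set S ! j" "\<lambda>i w. \<eta>1 i w - \<eta>2 i w"])
    show "elementary (card S - 1) (\<lambda>j. sorted_list_of_set S ! j) (\<lambda>i w. \<eta>1 i w - \<eta>2 i w)"
      using 1(1) 2(1) unfolding elementary_def by (auto intro!: bounded_minus_comp borel_measurable_diff)
    show "elementary_integrand (card S - 1) (\<lambda>j. sorted_list_of_set S ! j) (\<lambda>i w. \<eta>1 i w - \<eta>2 i w) w s
        = elementary_integrand k1 t1 \<xi>1 w s - elementary_integrand k2 t2 \<xi>2 w s" for w s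
      using 1(2)[of w s] 2(2)[of w s] unfolding elementary_integrand_def
      by (simp only: sum_subtractf scaleR_diff_right)
    show "elementary_integral \<beta> (card S - 1) (\<lambda>j. sorted_list_of_set S ! j) (\<lambda>i w. \<eta>1 i w - \<eta>2 i w) w
        = elementary_integral \<beta> k1 t1 \<xi>1 w - elementary_integral \<beta> k2 t2 \<xi>2 w" for w
      using 1(3)[of w] 2(3)[of w] unfolding elementary_integral_def
      by (simp only: sum_subtractf inner_diff_left)
  qed
qed

text \<open>The energy of a cell is fixed by the value of \<xi> at its left end, so it is known
  before the cell is entered whether it would push the accumulated energy above c. Dropping such
  cells keeps the integrand adapted.\<close>

lemma elementary_truncate:
  assumes e: "elementary k t \<xi>" and c: "0 \<le> c"
  obtains \<eta> where "elementary k t \<eta>"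
    "\<And>w. energy (elementary_integrand k t \<eta> w) \<le> c"
    "\<And>w. energy (elementary_integrand k t \<xi> w) \<le> c \<Longrightarrow>
       elementary_integral \<beta> k t \<eta> w = elementary_integral \<beta> k t \<xi> w"
proof
  define a where "a i w = (norm (\<xi> i w))\<^sup>2 * (t (Suc i) - t i)" for i w
  \<comment> \<open>The sum includes the current index i; stopping one cell later would let the
    energy overshoot c.\<close>
  define \<eta> where "\<eta> i w = (if (\<Sum>l\<le>i. a l w) \<le> c then \<xi> i w else 0)" for i w
  have a0: "0 \<le> a i w" if "i < k" for i w
    using elementary_step[OF e that] by (simp add: a_def)
  show e': "elementary k t \<eta>"
    unfolding elementary_def
  proof (intro conjI allI impI)
    show "0 \<le> t 0" "t k \<le> 1" using e by (auto simp: elementary_def)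
    fix i assume i: "i < k"
    show "t i \<le> t (Suc i)" by (rule elementary_step[OF e i])
    have a [measurable]: "a l \<in> borel_measurable (F (t i))" if "l \<le> i" for l
    proof -
      have "\<xi> l \<in> borel_measurable (F (t i))"
        using measurable_F_mono[OF elementary_measurable[OF e, of l]] elementary_mono[OF e, of l i] i that by simp
      then show ?thesis unfolding a_def by simp
    qed
    have [measurable]: "(\<lambda>w. \<Sum>l\<le>i. a l w) \<in> borel_measurable (F (t i))"
      by (intro borel_measurable_sum) (auto intro: a)
    have [measurable]: "\<xi> i \<in> borel_measurable (F (t i))" by (rule elementary_measurable[OF e i])
    show "\<eta> i \<in> borel_measurable (F (t i))"
      unfolding \<eta>_def by measurable
    obtain B where B: "\<And>w. w \<in> space M \<Longrightarrow> norm (\<xi> i w) \<le> B"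
      using elementary_bounded[OF e i] by auto
    have "norm (\<eta> i w) \<le> \<bar>B\<bar>" if "w \<in> space M" for w
      using B[OF that] by (auto simp: \<eta>_def)
    then show "bounded (\<eta> i ` space M)" unfolding bounded_iff by blast
  qed
  show "energy (elementary_integrand k t \<eta> w) \<le> c" for w
  proof -
    have "(\<Sum>i<m. if (\<Sum>l\<le>i. a l w) \<le> c then a i w else 0) \<le> c" if "m \<le> k" for m
      using that
    proof (induction m)
      case 0 then show ?case using c by simp
    next
      case (Suc m)
      show ?case
      proof (cases "(\<Sum>l\<le>m. a l w) \<le> c")
        case True
        have "(\<Sum>i<Suc m. if (\<Sum>l\<le>i. a l w) \<le> c then a i w else 0) \<le> (\<Sum>i<Suc m. a i w)"
          using Suc.prems a0 by (intro sum_mono) auto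
        also have "\<dots> \<le> c" using True by (simp add: lessThan_Suc_atMost)
        finally show ?thesis .
      next
        case False then show ?thesis using Suc by simp
      qed
    qed
    moreover have "energy (elementary_integrand k t \<eta> w) = (\<Sum>i<k. if (\<Sum>l\<le>i. a l w) \<le> c then a i w else 0)"
      unfolding elementary_energy[OF e'] by (intro sum.cong refl) (simp add: \<eta>_def a_def)
    ultimately show ?thesis by simp
  qed
  show "elementary_integral \<beta> k t \<eta> w = elementary_integral \<beta> k t \<xi> w"
    if "energy (elementary_integrand k t \<xi> w) \<le> c" for w
    unfolding elementary_integral_def
  proof (intro sum.cong refl)
    fix i assume i: "i \<in> {..<k}"
    have "(\<Sum>l\<le>i. a l w) \<le> (\<Sum>l<k. a l w)"
      using i a0 by (intro sum_mono2) auto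
    also have "\<dots> \<le> c" using that by (simp add: elementary_energy[OF e] a_def)
    finally show "\<eta> i w \<bullet> (\<beta> w (t (Suc i)) - \<beta> w (t i)) = \<xi> i w \<bullet> (\<beta> w (t (Suc i)) - \<beta> w (t i))"
      by (simp add: \<eta>_def)
  qed
qed

text \<open>A Lenglart-type inequality. It localises stochastic integrals on an event \<open>A\<close> that need not
  belong to any of the past \<open>\<sigma>\<close>-algebras.\<close>

lemma elementary_lenglart:
  assumes e: "elementary k t \<xi>" and c: "0 \<le> c" and \<epsilon>: "0 < \<epsilon>" and A: "A \<in> sets M"
  shows "prob {w\<in>A. \<epsilon> < \<bar>elementary_integral \<beta> k t \<xi> w\<bar>}
    \<le> prob {w\<in>A. c < energy (elementary_integrand k t \<xi> w)} + real CARD('n) * c / \<epsilon>\<^sup>2"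
proof -
  obtain \<eta> where \<eta>: "elementary k t \<eta>" "\<And>w. energy (elementary_integrand k t \<eta> w) \<le> c"
    "\<And>w. energy (elementary_integrand k t \<xi> w) \<le> c \<Longrightarrow>
       elementary_integral \<beta> k t \<eta> w = elementary_integral \<beta> k t \<xi> w"
    using elementary_truncate[OF e c] by blast
  note [measurable] = elementary_integral_measurable_M[OF e] elementary_integral_measurable_M[OF \<eta>(1)]
    elementary_energy_measurable[OF e] A
  let ?J = "elementary_integral \<beta> k t \<eta>"
  \<comment> \<open>Where the energy is at most c the truncated integral is the original one, so the
    event is covered by large energy on A and by a large truncated integral, whose second moment is
    at most \<open>CARD('n) * c\<close>.\<close>
  have "prob {w\<in>A. \<epsilon> < \<bar>elementary_integral \<beta> k t \<xi> w\<bar>}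
    \<le> prob ({w\<in>A. c < energy (elementary_integrand k t \<xi> w)} \<union> {w\<in>space M. \<epsilon>\<^sup>2 \<le> (?J w)\<^sup>2})"
  proof (intro finite_measure_mono subsetI)
    fix w assume w: "w \<in> {w\<in>A. \<epsilon> < \<bar>elementary_integral \<beta> k t \<xi> w\<bar>}"
    show "w \<in> {w\<in>A. c < energy (elementary_integrand k t \<xi> w)} \<union> {w\<in>space M. \<epsilon>\<^sup>2 \<le> (?J w)\<^sup>2}"
    proof (cases "energy (elementary_integrand k t \<xi> w) \<le> c")
      case True
      then have "\<epsilon> \<le> \<bar>?J w\<bar>" using w \<eta>(3)[OF True] by auto
      then have "\<epsilon>\<^sup>2 \<le> \<bar>?J w\<bar>\<^sup>2" using \<epsilon> by (intro power_mono) auto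
      then show ?thesis using w sets.sets_into_space[OF A] by auto
    qed (use w in auto)
  qed measurable
  also have "\<dots> \<le> prob {w\<in>A. c < energy (elementary_integrand k t \<xi> w)} + prob {w\<in>space M. \<epsilon>\<^sup>2 \<le> (?J w)\<^sup>2}"
    by (rule measure_Un_le) measurable
  also have "prob {w\<in>space M. \<epsilon>\<^sup>2 \<le> (?J w)\<^sup>2} \<le> (\<integral> w. (?J w)\<^sup>2 \<partial>M) / \<epsilon>\<^sup>2"
    using \<epsilon> elementary_integral_sq_le(1)[OF \<eta>(1)] by (intro integral_Markov_inequality_measure[where A="{}"]) auto
  also have "\<dots> \<le> real CARD('n) * c / \<epsilon>\<^sup>2"
  proof (intro divide_right_mono)
    have "(\<integral> w. (?J w)\<^sup>2 \<partial>M) \<le> real CARD('n) * (\<integral> w. energy (elementary_integrand k t \<eta> w) \<partial>M)"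
      by (rule elementary_integral_sq_le(2)[OF \<eta>(1)])
    also have "\<dots> \<le> real CARD('n) * (\<integral> w. c \<partial>M)"
      using elementary_energy_integrable(1)[OF \<eta>(1)] \<eta>(2)
      by (intro mult_left_mono integral_mono) auto
    finally show "(\<integral> w. (?J w)\<^sup>2 \<partial>M) \<le> real CARD('n) * c" by (simp add: prob_space)
  qed simp
  finally show ?thesis by simp
qed

text \<open>The function h is the Gaussian transition kernel applied to g. It is obtained before Q
  and y are given, because the induction below uses the same h for the shifted and for the unshifted
  path.\<close>

lemma increment_kernel:
  assumes st: "0 \<le> s" "s \<le> t" "t \<le> 1" and g [measurable]: "g \<in> borel_measurable (borel :: (real^'n) measure)"
  obtains h where "h \<in> borel_measurable borel"
    "\<And>Q y. Q \<in> borel_measurable (F s) \<Longrightarrow> y \<in> borel_measurable (F s) \<Longrightarrow>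
       (\<integral>\<^sup>+ w. Q w * g (y w + (\<beta> w t - \<beta> w s)) \<partial>M) = (\<integral>\<^sup>+ w. Q w * h (y w) \<partial>M)"
proof (cases "s = t")
  case True
  then show ?thesis by (intro that[of g]) auto
next
  case False
  with st have st': "0 \<le> s" "s < t" "t \<le> 1" by auto
  show ?thesis
  proof (rule that[of "\<lambda>y. \<integral>\<^sup>+ x. g (y + x) * ennreal (gauss (t - s) x) \<partial>lborel"])
    fix Q :: "'n path \<Rightarrow> ennreal" and y :: "'n path \<Rightarrow> real^'n"
    assume [measurable]: "Q \<in> borel_measurable (F s)" "y \<in> borel_measurable (F s)"
    have "(\<integral>\<^sup>+ w. Q w * g (y w + (\<beta> w t - \<beta> w s)) \<partial>M)
      = (\<integral>\<^sup>+ w. \<integral>\<^sup>+ x. Q w * g (y w + x) * ennreal (gauss (t - s) x) \<partial>lborel \<partial>M)"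
      using nn_integral_increment[OF st', of "\<lambda>(w, x). Q w * g (y w + x)"] by simp
    also have "\<dots> = (\<integral>\<^sup>+ w. Q w * (\<integral>\<^sup>+ x. g (y w + x) * ennreal (gauss (t - s) x) \<partial>lborel) \<partial>M)"
      by (intro nn_integral_cong) (simp add: mult.assoc nn_integral_cmult)
    finally show "(\<integral>\<^sup>+ w. Q w * g (y w + (\<beta> w t - \<beta> w s)) \<partial>M)
      = (\<integral>\<^sup>+ w. Q w * (\<integral>\<^sup>+ x. g (y w + x) * ennreal (gauss (t - s) x) \<partial>lborel) \<partial>M)" .
  qed measurable
qed

text \<open>Induction on the number of cells, for all g at once: the one-increment formula removes
  the last shift, and integrating the last increment replaces the last factor by a function of the
  preceding grid value, which changes g. Undoing that integration at the end restores the product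
  for the unshifted path.\<close>

lemma elementary_girsanov_grid:
  assumes "elementary k t \<xi>" and "\<And>i. g i \<in> borel_measurable (borel :: (real^'n) measure)"
  shows "(\<integral>\<^sup>+ w. ennreal (exp (elementary_integral \<beta> k t \<xi> w - 1 / 2 * energy (elementary_integrand k t \<xi> w)))
        * (\<Prod>i\<le>k. g i (\<beta> w (t i) - (\<Sum>l<i. (t (Suc l) - t l) *\<^sub>R \<xi> l w))) \<partial>M)
    = (\<integral>\<^sup>+ w. (\<Prod>i\<le>k. g i (\<beta> w (t i))) \<partial>M)"
  using assms
proof (induction k arbitrary: g)
  case 0
  then show ?case by (simp add: elementary_energy elementary_integral_def)
next
  case (Suc k)
  note e = Suc.prems(1) and g [measurable] = Suc.prems(2)
  have e': "elementary k t \<xi>" by (rule elementary_Suc_imp[OF e])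
  note b = elementary_bounds[OF e, of k] elementary_bounds[OF e, of "Suc k"] elementary_step[OF e, of k]
  have st: "0 \<le> t k" "t k \<le> t (Suc k)" "t (Suc k) \<le> 1" using b by auto
  have \<xi>F [measurable]: "\<xi> l \<in> borel_measurable (F (t k))" if "l \<le> k" for l
    using measurable_F_mono[OF elementary_measurable[OF e, of l]] elementary_mono[OF e, of l k] that by simp
  have \<beta>F [measurable]: "(\<lambda>w. \<beta> w (t j)) \<in> borel_measurable (F (t k))" if "j \<le> k" for j
    using measurable_F_mono[OF \<beta>_adapted[of "t j"]] elementary_mono[OF e, of j k]
      elementary_bounds[OF e, of j] that by simp
  define y where "y i w = \<beta> w (t i) - (\<Sum>l<i. (t (Suc l) - t l) *\<^sub>R \<xi> l w)" for i w
  have y [measurable]: "y i \<in> borel_measurable (F (t k))" if "i \<le> k" for i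
    unfolding y_def using that by (intro borel_measurable_diff \<beta>F borel_measurable_sum borel_measurable_scaleR \<xi>F) auto
  define R where "R w = exp (elementary_integral \<beta> k t \<xi> w - 1 / 2 * energy (elementary_integrand k t \<xi> w))" for w
  have "(\<lambda>w. energy (elementary_integrand k t \<xi> w)) \<in> borel_measurable (F (t k))"
    unfolding elementary_energy[OF e']
    by (intro borel_measurable_sum borel_measurable_times borel_measurable_power borel_measurable_norm
        measurable_compose[OF \<xi>F borel_measurable_norm]) (auto intro: \<xi>F)
  then have R [measurable]: "R \<in> borel_measurable (F (t k))"
    unfolding R_def using elementary_integral_measurable[OF e'] by measurable
  define Q where "Q w = ennreal (R w) * (\<Prod>i\<le>k. g i (y i w))" for w
  have Q [measurable]: "Q \<in> borel_measurable (F (t k))"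
    unfolding Q_def
    by (intro borel_measurable_times_ennreal borel_measurable_prod_ennreal measurable_compose[OF R]
        measurable_compose[OF y g]) auto
  define Q0 where "Q0 w = (\<Prod>i\<le>k. g i (\<beta> w (t i)))" for w
  have Q0 [measurable]: "Q0 \<in> borel_measurable (F (t k))"
    unfolding Q0_def by (intro borel_measurable_prod_ennreal measurable_compose[OF \<beta>F g]) auto
  obtain h where h [measurable]: "h \<in> borel_measurable borel"
    and heq: "\<And>Q y. Q \<in> borel_measurable (F (t k)) \<Longrightarrow> y \<in> borel_measurable (F (t k)) \<Longrightarrow>
       (\<integral>\<^sup>+ w. Q w * g (Suc k) (y w + (\<beta> w (t (Suc k)) - \<beta> w (t k))) \<partial>M) = (\<integral>\<^sup>+ w. Q w * h (y w) \<partial>M)"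
    using increment_kernel[OF st g[of "Suc k"]] by blast
  \<comment> \<open>The kernel h is absorbed into the factor at the last remaining grid point, which
    puts the integral into the shape of the induction hypothesis.\<close>
  define g' where "g' i = (if i = k then (\<lambda>x. g k x * h x) else g i)" for i
  have g' [measurable]: "g' i \<in> borel_measurable borel" for i
    unfolding g'_def by simp
  have prod_g': "(\<Prod>i\<le>k. g' i (z i)) = (\<Prod>i\<le>k. g i (z i)) * h (z k)" for z
  proof -
    have "(\<Prod>i\<le>k. g' i (z i)) = (\<Prod>i<k. g' i (z i)) * g' k (z k)"
      by (simp add: lessThan_Suc_atMost[symmetric])
    also have "(\<Prod>i<k. g' i (z i)) = (\<Prod>i<k. g i (z i))"
      by (intro prod.cong) (auto simp: g'_def)
    also have "\<dots> * g' k (z k) = (\<Prod>i\<le>k. g i (z i)) * h (z k)"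
      by (simp add: lessThan_Suc_atMost[symmetric] g'_def mult.assoc)
    finally show ?thesis .
  qed
  have "(\<integral>\<^sup>+ w. ennreal (exp (elementary_integral \<beta> (Suc k) t \<xi> w - 1 / 2 * energy (elementary_integrand (Suc k) t \<xi> w)))
        * (\<Prod>i\<le>Suc k. g i (y i w)) \<partial>M)
    = (\<integral>\<^sup>+ w. ennreal (exp (\<xi> k w \<bullet> (\<beta> w (t (Suc k)) - \<beta> w (t k)) - 1 / 2 * (norm (\<xi> k w))\<^sup>2 * (t (Suc k) - t k)))
        * (Q w * g (Suc k) (y k w + (\<beta> w (t (Suc k)) - \<beta> w (t k) - (t (Suc k) - t k) *\<^sub>R \<xi> k w))) \<partial>M)"
  proof (rule nn_integral_cong)
    fix w
    have 1: "exp (elementary_integral \<beta> (Suc k) t \<xi> w - 1 / 2 * energy (elementary_integrand (Suc k) t \<xi> w))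
      = exp (\<xi> k w \<bullet> (\<beta> w (t (Suc k)) - \<beta> w (t k)) - 1 / 2 * (norm (\<xi> k w))\<^sup>2 * (t (Suc k) - t k)) * R w"
      unfolding R_def exp_add[symmetric] elementary_energy[OF e] elementary_energy[OF e'] elementary_integral_def
      by (rule arg_cong[where f=exp]) (simp add: field_simps)
    have 2: "y (Suc k) w = y k w + (\<beta> w (t (Suc k)) - \<beta> w (t k) - (t (Suc k) - t k) *\<^sub>R \<xi> k w)"
      by (simp add: y_def)
    show "ennreal (exp (elementary_integral \<beta> (Suc k) t \<xi> w - 1 / 2 * energy (elementary_integrand (Suc k) t \<xi> w)))
        * (\<Prod>i\<le>Suc k. g i (y i w))
      = ennreal (exp (\<xi> k w \<bullet> (\<beta> w (t (Suc k)) - \<beta> w (t k)) - 1 / 2 * (norm (\<xi> k w))\<^sup>2 * (t (Suc k) - t k)))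
        * (Q w * g (Suc k) (y k w + (\<beta> w (t (Suc k)) - \<beta> w (t k) - (t (Suc k) - t k) *\<^sub>R \<xi> k w)))"
      unfolding 1 Q_def prod.atMost_Suc 2
      by (simp only: ennreal_mult'[OF less_imp_le[OF exp_gt_zero]] mult.assoc)
  qed
  also have "\<dots> = (\<integral>\<^sup>+ w. Q w * g (Suc k) (y k w + (\<beta> w (t (Suc k)) - \<beta> w (t k))) \<partial>M)"
  proof -
    have [measurable]: "y k \<in> borel_measurable (F (t k))" "\<xi> k \<in> borel_measurable (F (t k))" using y \<xi>F by auto
    show ?thesis
      using nn_integral_increment_girsanov[OF st, of "\<xi> k" "\<lambda>(w, x). Q w * g (Suc k) (y k w + x)"] by simp
  qed
  also have "\<dots> = (\<integral>\<^sup>+ w. Q w * h (y k w) \<partial>M)"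
    by (rule heq[OF Q y]) simp
  also have "\<dots> = (\<integral>\<^sup>+ w. ennreal (R w) * (\<Prod>i\<le>k. g' i (y i w)) \<partial>M)"
    unfolding prod_g' Q_def by (simp only: mult.assoc)
  also have "\<dots> = (\<integral>\<^sup>+ w. (\<Prod>i\<le>k. g' i (\<beta> w (t i))) \<partial>M)"
    unfolding R_def y_def using g' by (intro Suc.IH[OF e'])
  also have "\<dots> = (\<integral>\<^sup>+ w. Q0 w * h (\<beta> w (t k)) \<partial>M)"
    unfolding prod_g' Q0_def ..
  also have "\<dots> = (\<integral>\<^sup>+ w. Q0 w * g (Suc k) (\<beta> w (t k) + (\<beta> w (t (Suc k)) - \<beta> w (t k))) \<partial>M)"
    by (rule heq[symmetric, OF Q0 \<beta>F]) simp
  also have "\<dots> = (\<integral>\<^sup>+ w. (\<Prod>i\<le>Suc k. g i (\<beta> w (t i))) \<partial>M)"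
    by (simp add: Q0_def)
  finally show ?case unfolding y_def .
qed

lemma elementary_girsanov:
  assumes e: "elementary k t \<xi>" and J: "finite J" "J \<subseteq> {0..1}"
    and g: "\<And>s. g s \<in> borel_measurable (borel :: (real^'n) measure)"
  shows "(\<integral>\<^sup>+ w. ennreal (exp (elementary_integral \<beta> k t \<xi> w - 1 / 2 * energy (elementary_integrand k t \<xi> w)))
        * (\<Prod>s\<in>J. g s (\<beta> w s - (LINT r:{0..s}|lborel. elementary_integrand k t \<xi> w r))) \<partial>M)
    = (\<integral>\<^sup>+ w. (\<Prod>s\<in>J. g s (\<beta> w s)) \<partial>M)"
proof -
  define S where "S = t ` {..k} \<union> J"
  define u where "u = (!) (sorted_list_of_set S)"
  define m where "m = card S - 1"
  have S: "finite S" "t ` {..k} \<subseteq> S" "S \<subseteq> {0..1}"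
    using elementary_bounds[OF e] J by (auto simp: S_def)
  have S0: "0 < card S" using S by (auto simp: card_gt_0_iff)
  obtain \<eta> where \<eta>: "elementary m u \<eta>"
    "\<And>w s. elementary_integrand m u \<eta> w s = elementary_integrand k t \<xi> w s"
    "\<And>w. elementary_integral \<beta> m u \<eta> w = elementary_integral \<beta> k t \<xi> w"
    by (rule elementary_refine[OF e S, folded u_def m_def], rule that)
  have bij: "bij_betw u {..m} S"
  proof -
    have "bij_betw (\<lambda>j. sorted_list_of_set S ! j) {..<length (sorted_list_of_set S)} (set (sorted_list_of_set S))"
      by (rule bij_betw_nth) auto
    moreover have "{..<length (sorted_list_of_set S)} = {..m}" using S0 by (auto simp: m_def)
    ultimately show ?thesis using S(1) by (simp add: u_def)
  qed
  \<comment> \<open>Up to a grid point the time integral consists of whole cells: the cells before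
    index i contribute fully and the later ones not at all.\<close>
  have int: "(LINT r:{0..u i}|lborel. elementary_integrand m u \<eta> w r) = (\<Sum>l<i. (u (Suc l) - u l) *\<^sub>R \<eta> l w)"
    if i: "i \<le> m" for i w
  proof -
    have ind: "indicat_real {0..u i} r *\<^sub>R indicat_real {u l<..u (Suc l)} r *\<^sub>R \<eta> l w
      = (if l < i then indicat_real {u l<..u (Suc l)} r *\<^sub>R \<eta> l w else 0)" if l: "l < m" for l r
    proof (cases "l < i")
      case True
      then show ?thesis
        using elementary_bounds(1)[OF \<eta>(1), of l] elementary_mono[OF \<eta>(1), of "Suc l" i] i l
        by (auto simp: indicator_def)
    next
      case False
      then show ?thesis
        using elementary_mono[OF \<eta>(1), of i l] i l by (auto simp: indicator_def)
    qed
    have "(LINT r:{0..u i}|lborel. elementary_integrand m u \<eta> w r)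
      = (LINT r|lborel. (\<Sum>l<m. (if l < i then indicat_real {u l<..u (Suc l)} r *\<^sub>R \<eta> l w else 0)))"
      unfolding set_lebesgue_integral_def elementary_integrand_def scaleR_sum_right
      by (intro Bochner_Integration.integral_cong refl sum.cong, rule ind) simp
    also have "\<dots> = (\<Sum>l<m. (LINT r|lborel. (if l < i then indicat_real {u l<..u (Suc l)} r *\<^sub>R \<eta> l w else 0)))"
    proof (rule Bochner_Integration.integral_sum)
      fix l assume "l \<in> {..<m}"
      then have "integrable lborel (\<lambda>r. indicat_real {u l<..u (Suc l)} r *\<^sub>R \<eta> l w)"
        by (intro integral_Ioc_indicator elementary_step[OF \<eta>(1)]) auto
      then show "integrable lborel (\<lambda>r. if l < i then indicat_real {u l<..u (Suc l)} r *\<^sub>R \<eta> l w else 0)"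
        by (cases "l < i") auto
    qed
    also have "\<dots> = (\<Sum>l<m. if l < i then (u (Suc l) - u l) *\<^sub>R \<eta> l w else 0)"
    proof (intro sum.cong refl)
      fix l assume "l \<in> {..<m}"
      then have "(LINT r|lborel. indicat_real {u l<..u (Suc l)} r *\<^sub>R \<eta> l w) = (u (Suc l) - u l) *\<^sub>R \<eta> l w"
        by (intro integral_Ioc_indicator elementary_step[OF \<eta>(1)]) auto
      then show "(LINT r|lborel. (if l < i then indicat_real {u l<..u (Suc l)} r *\<^sub>R \<eta> l w else 0))
        = (if l < i then (u (Suc l) - u l) *\<^sub>R \<eta> l w else 0)"
        by (cases "l < i") simp_all
    qed
    also have "\<dots> = (\<Sum>l<i. (u (Suc l) - u l) *\<^sub>R \<eta> l w)"
      using i by (intro sum.mono_neutral_cong_right) auto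
    finally show ?thesis .
  qed
  have iu: "elementary_integrand m u \<eta> = elementary_integrand k t \<xi>"
    using \<eta>(2) by (simp add: fun_eq_iff)
  define g' where "g' i = (if u i \<in> J then g (u i) else (\<lambda>_. 1))" for i
  have prod: "(\<Prod>i\<le>m. g' i (z (u i))) = (\<Prod>s\<in>J. g s (z s))" for z
  proof -
    have "(\<Prod>i\<le>m. g' i (z (u i))) = (\<Prod>s\<in>S. if s \<in> J then g s (z s) else 1)"
      by (subst prod.reindex_bij_betw[OF bij, symmetric]) (auto intro!: prod.cong simp: g'_def)
    also have "\<dots> = (\<Prod>s\<in>J. g s (z s))"
      using S(1) by (intro prod.mono_neutral_cong_right) (auto simp: S_def)
    finally show ?thesis .
  qed
  have "(\<integral>\<^sup>+ w. ennreal (exp (elementary_integral \<beta> m u \<eta> w - 1 / 2 * energy (elementary_integrand m u \<eta> w)))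
        * (\<Prod>i\<le>m. g' i (\<beta> w (u i) - (\<Sum>l<i. (u (Suc l) - u l) *\<^sub>R \<eta> l w))) \<partial>M)
    = (\<integral>\<^sup>+ w. (\<Prod>i\<le>m. g' i (\<beta> w (u i))) \<partial>M)"
    by (rule elementary_girsanov_grid[OF \<eta>(1)]) (simp add: g'_def g)
  moreover have "(\<Prod>i\<le>m. g' i (\<beta> w (u i) - (\<Sum>l<i. (u (Suc l) - u l) *\<^sub>R \<eta> l w)))
    = (\<Prod>s\<in>J. g s (\<beta> w s - (LINT r:{0..s}|lborel. elementary_integrand k t \<xi> w r)))" for w
    unfolding prod[symmetric] by (intro prod.cong refl) (simp add: int[unfolded iu])
  ultimately show ?thesis by (simp add: prod \<eta>(3) iu)
qed

end

section \<open>Approximation by step functions\<close>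

definition gridpt :: "nat \<Rightarrow> nat \<Rightarrow> real" where
  "gridpt n i = real i / real n"

lemma gridpt_0 [simp]: "gridpt n 0 = 0"
  by (simp add: gridpt_def)

lemma gridpt_nonneg [simp]: "0 \<le> gridpt n i"
  by (simp add: gridpt_def)

lemma gridpt_le_1: "i \<le> n \<Longrightarrow> gridpt n i \<le> 1"
  by (simp add: gridpt_def divide_le_eq)

lemma gridpt_Suc: "gridpt n (Suc i) = gridpt n i + 1 / real n"
  by (simp add: gridpt_def add_divide_distrib)

lemma gridpt_mono [simp]: "gridpt n i \<le> gridpt n (Suc i)"
  by (simp add: gridpt_Suc)

text \<open>The average is taken over the cell before the one on which it is used, so that for
  adapted g it is known at the left end of the cell. The first cell has no predecessor in [0,1] and
  gets 0.\<close>

definition grid_avg :: "nat \<Rightarrow> (real \<Rightarrow> 'a::euclidean_space) \<Rightarrow> nat \<Rightarrow> 'a" where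
  "grid_avg n g i = (if i = 0 then 0 else
     real n *\<^sub>R (LINT s:{gridpt n (i - 1)<..gridpt n i}|lborel. g s))"

definition grid_step :: "nat \<Rightarrow> (real \<Rightarrow> 'a::euclidean_space) \<Rightarrow> real \<Rightarrow> 'a" where
  "grid_step n g s = (\<Sum>i<n. indicat_real {gridpt n i<..gridpt n (Suc i)} s *\<^sub>R grid_avg n g i)"

lemma grid_step_measurable [measurable]: "grid_step n g \<in> borel_measurable borel"
  unfolding grid_step_def[abs_def] by measurable

lemma set_integrable_subset_unit:
  fixes g :: "real \<Rightarrow> 'a::{banach, second_countable_topology}"
  assumes "set_integrable lborel {0..1} g" "S \<subseteq> {0..1}" "S \<in> sets borel"
  shows "set_integrable lborel S g"
  using set_integrable_subset[OF assms(1)] assms by auto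

lemma grid_interval_subset: "Suc j < n \<Longrightarrow> {gridpt n j<..gridpt n (Suc j)} \<subseteq> {0..1}"
  using gridpt_le_1[of "Suc j" n] gridpt_nonneg[of n j] by (auto intro: order_trans less_imp_le simp del: gridpt_nonneg)

lemma grid_step_diff:
  assumes g: "set_integrable lborel {0..1} g" and h: "set_integrable lborel {0..1} h"
  shows "grid_step n (\<lambda>s. g s - h s) s = grid_step n g s - grid_step n h s"
proof -
  have "grid_avg n (\<lambda>s. g s - h s) i = grid_avg n g i - grid_avg n h i" if "i < n" for i
  proof (cases i)
    case (Suc j)
    have "set_integrable lborel {gridpt n j<..gridpt n (Suc j)} g"
      "set_integrable lborel {gridpt n j<..gridpt n (Suc j)} h"
      using set_integrable_subset_unit[OF g grid_interval_subset[of j n]]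
        set_integrable_subset_unit[OF h grid_interval_subset[of j n]] that Suc by auto
    then show ?thesis
      by (simp add: grid_avg_def Suc set_integral_diff scaleR_diff_right)
  qed (simp add: grid_avg_def)
  then show ?thesis
    unfolding grid_step_def sum_subtractf[symmetric] scaleR_diff_right[symmetric]
    by (intro sum.cong) auto
qed

text \<open>The norm of an average is at most the average of the norm, and the lag by one cell only
  discards the mass of the last cell. The bound is uniform in n, as a density argument
  requires.\<close>

lemma grid_step_contraction:
  assumes h: "set_integrable lborel {0..1} h"
  shows "set_integrable lborel {0..1} (\<lambda>s. norm (grid_step n h s))"
    "(LINT s:{0..1}|lborel. norm (grid_step n h s)) \<le> (LINT s:{0..1}|lborel. norm (h s))"
proof -
  let ?I = "\<lambda>i. {gridpt n i<..gridpt n (Suc i)}"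
  let ?f = "\<lambda>s. \<Sum>i<n. indicat_real (?I i) s *\<^sub>R norm (grid_avg n h i)"
  note mono = gridpt_mono[of n]
  have f: "integrable lborel ?f"
    by (intro Bochner_Integration.integrable_sum integral_Ioc_indicator mono)
  have le: "norm (indicat_real {0..1} s *\<^sub>R norm (grid_step n h s)) \<le> ?f s" for s
  proof -
    have "norm (indicat_real {0..1} s *\<^sub>R norm (grid_step n h s)) \<le> norm (grid_step n h s)"
      by (auto simp: indicator_def)
    also have "\<dots> \<le> ?f s"
      unfolding grid_step_def by (intro sum_norm_le) simp
    finally show ?thesis .
  qed
  show int: "set_integrable lborel {0..1} (\<lambda>s. norm (grid_step n h s))"
    unfolding set_integrable_def
  proof (rule Bochner_Integration.integrable_bound[OF f])
    show "AE s in lborel. norm (indicat_real {0..1} s *\<^sub>R norm (grid_step n h s)) \<le> norm (?f s)"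
      using le by (intro AE_I2 order_trans[OF le]) (simp only: real_norm_def abs_ge_self)
  qed measurable
  have nh: "set_integrable lborel {0..1} (\<lambda>s. norm (h s))"
    using set_integrable_norm[OF h] .
  have "(LINT s:{0..1}|lborel. norm (grid_step n h s)) \<le> (LINT s|lborel. ?f s)"
    unfolding set_lebesgue_integral_def
  proof (rule integral_mono[OF _ f])
    show "integrable lborel (\<lambda>s. indicat_real {0..1} s *\<^sub>R norm (grid_step n h s))"
      using int by (simp add: set_integrable_def)
    show "indicat_real {0..1} s *\<^sub>R norm (grid_step n h s) \<le> ?f s" for s
      using le[of s] unfolding real_norm_def by linarith
  qed
  also have "\<dots> = (\<Sum>i<n. (LINT s|lborel. indicat_real (?I i) s *\<^sub>R norm (grid_avg n h i)))"
    by (intro Bochner_Integration.integral_sum integral_Ioc_indicator mono)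
  also have "\<dots> = (\<Sum>i<n. (gridpt n (Suc i) - gridpt n i) *\<^sub>R norm (grid_avg n h i))"
    by (intro sum.cong refl integral_Ioc_indicator mono)
  also have "\<dots> \<le> (LINT s:{0..1}|lborel. norm (h s))"
  proof (cases n)
    case 0
    then show ?thesis
      by (auto simp: set_lebesgue_integral_def intro!: integral_nonneg_AE)
  next
    case (Suc m)
    \<comment> \<open>The term for index 0 vanishes, so after an index shift cell
      \<open>Suc j\<close> carries the average over cell j.\<close>
    have "(\<Sum>i<n. (gridpt n (Suc i) - gridpt n i) *\<^sub>R norm (grid_avg n h i))
      = (\<Sum>j<m. (1 / real n) * norm (grid_avg n h (Suc j)))"
      unfolding Suc sum.lessThan_Suc_shift by (simp add: grid_avg_def gridpt_Suc)
    also have "\<dots> \<le> (\<Sum>j<m. LINT s:?I j|lborel. norm (h s))"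
    proof (rule sum_mono)
      fix j assume j: "j \<in> {..<m}"
      have "norm (LINT s:?I j|lborel. h s) \<le> (LINT s:?I j|lborel. norm (h s))"
        using set_integral_norm_bound[OF set_integrable_subset_unit[OF h grid_interval_subset]] j Suc by simp
      then show "(1 / real n) * norm (grid_avg n h (Suc j)) \<le> (LINT s:?I j|lborel. norm (h s))"
        using Suc by (simp add: grid_avg_def)
    qed
    also have "\<dots> = (LINT s|lborel. (\<Sum>j<m. indicat_real (?I j) s *\<^sub>R norm (h s)))"
      unfolding set_lebesgue_integral_def
    proof (rule Bochner_Integration.integral_sum[symmetric])
      fix j assume "j \<in> {..<m}"
      then show "integrable lborel (\<lambda>s. indicat_real (?I j) s *\<^sub>R norm (h s))"
        using set_integrable_subset_unit[OF nh grid_interval_subset[of j n]] Suc by (simp add: set_integrable_def)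
    qed
    also have "\<dots> \<le> (LINT s:{0..1}|lborel. norm (h s))"
      unfolding set_lebesgue_integral_def
    proof (rule integral_mono)
      show "integrable lborel (\<lambda>s. \<Sum>j<m. indicat_real (?I j) s *\<^sub>R norm (h s))"
      proof (rule Bochner_Integration.integrable_sum)
        fix j assume "j \<in> {..<m}"
        then show "integrable lborel (\<lambda>s. indicat_real (?I j) s *\<^sub>R norm (h s))"
          using set_integrable_subset_unit[OF nh grid_interval_subset[of j n]] Suc by (simp add: set_integrable_def)
      qed
      show "integrable lborel (\<lambda>s. indicat_real {0..1} s *\<^sub>R norm (h s))"
        using nh by (simp add: set_integrable_def)
      fix s
      \<comment> \<open>Cell indicators are differences of half-line indicators; their sum
        telescopes to the indicator of an interval inside [0,1].\<close>
      let ?H = "\<lambda>j. indicat_real {..gridpt n j} s"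
      have "(\<Sum>j<m. indicat_real (?I j) s) = (\<Sum>j<m. ?H (Suc j) - ?H j)"
      proof (intro sum.cong refl)
        fix j show "indicat_real (?I j) s = ?H (Suc j) - ?H j"
          using mono[of j] by (auto simp: indicator_def simp del: gridpt_mono)
      qed
      also have "\<dots> = ?H m - ?H 0" by (rule sum_lessThan_telescope)
      also have "\<dots> \<le> indicat_real {0..1} s"
      proof -
        have "gridpt n m \<le> 1" using Suc by (intro gridpt_le_1) simp
        then show ?thesis by (auto simp: indicator_def)
      qed
      finally have "(\<Sum>j<m. indicat_real (?I j) s) * norm (h s) \<le> indicat_real {0..1} s * norm (h s)"
        by (rule mult_right_mono) simp
      then show "(\<Sum>j<m. indicat_real (?I j) s *\<^sub>R norm (h s)) \<le> indicat_real {0..1} s *\<^sub>R norm (h s)"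
        by (simp only: sum_distrib_right real_scaleR_def)
    qed
    finally show ?thesis .
  qed
  finally show "(LINT s:{0..1}|lborel. norm (grid_step n h s)) \<le> (LINT s:{0..1}|lborel. norm (h s))" .
qed

lemma grid_step_eq:
  assumes s: "s \<in> {gridpt n i<..gridpt n (Suc i)}" and i: "i < n"
  shows "grid_step n g s = grid_avg n g i"
proof -
  have "indicat_real {gridpt n j<..gridpt n (Suc j)} s = (if j = i then 1 else 0)" for j
  proof -
    have "j = i" if "s \<in> {gridpt n j<..gridpt n (Suc j)}"
    proof -
      have n: "0 < real n" using i by simp
      have "gridpt n j < gridpt n (Suc i)" "gridpt n i < gridpt n (Suc j)"
        using that s by auto
      then have "real j < real (Suc i)" "real i < real (Suc j)"
        using n by (simp_all add: gridpt_def divide_less_cancel)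
      then show ?thesis by linarith
    qed
    then show ?thesis using s by (cases "j = i") (simp, meson indicator_simps(2))
  qed
  then show ?thesis using i by (simp add: grid_step_def if_distrib[of "\<lambda>x. x *\<^sub>R _"] cong: if_cong)
qed

lemma grid_index:
  assumes "0 < s" "s \<le> 1" "0 < n"
  obtains i where "i < n" "s \<in> {gridpt n i<..gridpt n (Suc i)}"
proof -
  \<comment> \<open>The ceiling gives \<open>c - 1 < n * s \<le> c\<close>, matching cells that are
    open on the left and closed on the right; \<open>0 < s\<close> guarantees
    \<open>0 < c\<close>.\<close>
  define c where "c = nat \<lceil>real n * s\<rceil>"
  have ns: "0 < real n * s" "real n * s \<le> real n" using assms by (auto simp: mult_le_cancel_left1)
  then have c1: "real n * s \<le> real c" "real c < real n * s + 1" "0 < c"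
    unfolding c_def by linarith+
  have c2: "c \<le> n" using c1(2) ns(2) by linarith
  show ?thesis
  proof (rule that[of "c - 1"])
    show "c - 1 < n" using c1 c2 by simp
    show "s \<in> {gridpt n (c - 1)<..gridpt n (Suc (c - 1))}"
      using c1 assms by (auto simp: gridpt_def field_simps of_nat_diff)
  qed
qed

text \<open>The value at s is an average over the preceding cell, all of whose points lie within 2/n
  of s.\<close>

lemma grid_step_continuous_tendsto:
  fixes c :: "real \<Rightarrow> 'a::euclidean_space"
  assumes c: "continuous_on UNIV c" and s: "0 < s" "s \<le> 1"
  shows "(\<lambda>n. grid_step n c s) \<longlonglongrightarrow> c s"
proof (rule LIMSEQ_I)
  fix r :: real assume r: "0 < r"
  have "continuous (at s) c" using c by (simp add: continuous_on_eq_continuous_at)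
  then obtain d where d: "0 < d" "\<And>x. dist x s < d \<Longrightarrow> dist (c x) (c s) < r / 2"
    using r unfolding continuous_at_eps_delta by (metis half_gt_zero)
  \<comment> \<open>The bound 2/d puts both the cell of s and the preceding one within distance d of
    s; the bound 1/s keeps s out of the first cell, where the step function is 0.\<close>
  obtain N where N: "real N > 2 / d" "real N > 1 / s"
    using reals_Archimedean2[of "max (2 / d) (1 / s)"] by auto
  show "\<exists>no. \<forall>n\<ge>no. norm (grid_step n c s - c s) < r"
  proof (intro exI allI impI)
    fix n assume "N \<le> n"
    then have n: "real n > 2 / d" "real n > 1 / s" using N by linarith+
    have n0: "0 < real n" using n(1) d by (smt (verit) divide_pos_pos)
    have n2: "2 / real n < d" "1 / real n < s" using n n0 d s by (auto simp: field_simps)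
    obtain i where i: "i < n" "s \<in> {gridpt n i<..gridpt n (Suc i)}"
      using grid_index[OF s] n0 by auto
    obtain j where j: "i = Suc j"
      using i n2(2) by (cases i) (auto simp: gridpt_Suc)
    let ?I = "{gridpt n j<..gridpt n i}"
    have ci: "set_integrable lborel ?I c"
    proof (rule set_integrable_subset)
      show "set_integrable lborel {gridpt n j..gridpt n i} c"
        unfolding set_integrable_def
        by (rule borel_integrable_compact) (auto intro: continuous_on_subset[OF c])
    qed auto
    have cs: "set_integrable lborel ?I (\<lambda>x. c s)"
      unfolding set_integrable_def j by (intro integral_Ioc_indicator) simp
    have "grid_step n c s = real n *\<^sub>R (LINT x:?I|lborel. c x)"
      by (simp add: grid_step_eq[OF i(2,1)] grid_avg_def j)
    moreover have "c s = real n *\<^sub>R (LINT x:?I|lborel. c s)"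
    proof -
      have "(LINT x:?I|lborel. c s) = (1 / real n) *\<^sub>R c s"
        unfolding set_lebesgue_integral_def j by (subst integral_Ioc_indicator) (simp_all add: gridpt_Suc)
      then show ?thesis using n0 by simp
    qed
    ultimately have "grid_step n c s - c s = real n *\<^sub>R (LINT x:?I|lborel. c x - c s)"
      by (subst set_integral_diff(2)[OF ci cs]) (simp add: scaleR_diff_right)
    moreover have "norm (LINT x:?I|lborel. c x - c s) \<le> (LINT x:?I|lborel. r / 2)"
    proof -
      have "norm (LINT x:?I|lborel. c x - c s) \<le> (LINT x:?I|lborel. norm (c x - c s))"
        by (rule set_integral_norm_bound[OF set_integral_diff(1)[OF ci cs]])
      also have "\<dots> \<le> (LINT x:?I|lborel. r / 2)"
      proof (rule set_integral_mono)
        show "set_integrable lborel ?I (\<lambda>x. norm (c x - c s))"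
          by (rule set_integrable_norm[OF set_integral_diff(1)[OF ci cs]])
        show "set_integrable lborel ?I (\<lambda>x. r / 2)"
          unfolding set_integrable_def j by (intro integral_Ioc_indicator) simp
        fix x assume x: "x \<in> ?I"
        have "gridpt n (Suc i) - gridpt n j = 2 / real n"
          unfolding j by (simp add: gridpt_Suc)
        then have "dist x s < d" using x i n2(1) by (auto simp: dist_real_def)
        then show "norm (c x - c s) \<le> r / 2" using d(2)[of x] by (simp add: dist_norm)
      qed
      finally show ?thesis .
    qed
    moreover have "(LINT x:?I|lborel. r / 2) = (1 / real n) * (r / 2)"
      unfolding set_lebesgue_integral_def j by (subst integral_Ioc_indicator) (simp_all add: gridpt_Suc)
    ultimately have "norm (grid_step n c s - c s) = real n * norm (LINT x:?I|lborel. c x - c s)"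
      "norm (LINT x:?I|lborel. c x - c s) \<le> (1 / real n) * (r / 2)"
      by simp_all
    then have "norm (grid_step n c s - c s) \<le> real n * ((1 / real n) * (r / 2))"
      using mult_left_mono[of "norm (LINT x:?I|lborel. c x - c s)" "(1 / real n) * (r / 2)" "real n"] by simp
    then show "norm (grid_step n c s - c s) < r" using r n0 by simp
  qed
qed

lemma grid_avg_norm_le:
  fixes g :: "real \<Rightarrow> 'a::euclidean_space"
  assumes g [measurable]: "g \<in> borel_measurable borel" and B: "\<And>s. norm (g s) \<le> B"
  shows "norm (grid_avg n g i) \<le> B"
proof (cases "i = 0 \<or> n = 0")
  case True
  have "0 \<le> B" using B[of 0] norm_ge_zero[of "g 0"] by linarith
  then show ?thesis using True by (auto simp: grid_avg_def)
next
  case False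
  then obtain j where j: "i = Suc j" and n: "0 < real n" by (cases i) auto
  let ?I = "{gridpt n j<..gridpt n (Suc j)}"
  have Bi: "integrable lborel (\<lambda>s. indicat_real ?I s *\<^sub>R B)"
    by (intro integral_Ioc_indicator) simp
  have "norm (LINT s:?I|lborel. g s) \<le> (LINT s|lborel. indicat_real ?I s *\<^sub>R B)"
    unfolding set_lebesgue_integral_def
  proof (rule order_trans[OF integral_norm_bound integral_mono[OF _ Bi]])
    have "integrable lborel (\<lambda>s. indicat_real ?I s *\<^sub>R g s)"
      by (rule Bochner_Integration.integrable_bound[OF Bi])
         (use B in \<open>auto simp: indicator_def intro!: AE_I2 order_trans[OF B]\<close>)
    then show "integrable lborel (\<lambda>s. norm (indicat_real ?I s *\<^sub>R g s))" by (rule integrable_norm)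
    show "norm (indicat_real ?I s *\<^sub>R g s) \<le> indicat_real ?I s *\<^sub>R B" for s
      using B[of s] by (auto simp: indicator_def)
  qed
  also have "\<dots> = (1 / real n) * B"
    by (subst integral_Ioc_indicator) (simp_all add: gridpt_Suc)
  finally have "real n * norm (LINT s:?I|lborel. g s) \<le> real n * ((1 / real n) * B)"
    using n by (intro mult_left_mono) auto
  then show ?thesis using n j by (simp add: grid_avg_def)
qed

lemma grid_step_norm_le:
  fixes g :: "real \<Rightarrow> 'a::euclidean_space"
  assumes g: "g \<in> borel_measurable borel" and B: "\<And>s. norm (g s) \<le> B" and s: "0 < s" "s \<le> 1"
  shows "norm (grid_step n g s) \<le> B"
proof (cases "n = 0")
  case True
  have "0 \<le> B" using B[of 0] norm_ge_zero[of "g 0"] by linarith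
  then show ?thesis using True by (auto simp: grid_step_def)
next
  case False
  then obtain i where "i < n" "s \<in> {gridpt n i<..gridpt n (Suc i)}"
    using grid_index[OF s, of n] by auto
  then show ?thesis using grid_step_eq[of s n i g] grid_avg_norm_le[OF g B] by simp
qed

lemma AE_pos_unit: "AE s in lborel. s \<in> {0..1::real} \<longrightarrow> 0 < s"
  using AE_lborel_singleton[of "0::real"] by eventually_elim auto

lemma set_integrable_unit_bounded:
  fixes g :: "real \<Rightarrow> 'a::{banach, second_countable_topology}"
  assumes [measurable]: "g \<in> borel_measurable borel" and B: "AE s in lborel. s \<in> {0..1} \<longrightarrow> norm (g s) \<le> B"
  shows "set_integrable lborel {0..1} g"
  unfolding set_integrable_def
proof (rule Bochner_Integration.integrable_bound)
  show "integrable lborel (\<lambda>s::real. indicat_real {0..1} s * B)" by (intro integrable_mult_left integrable_real_indicator) auto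
  show "AE s in lborel. norm (indicat_real {0..1} s *\<^sub>R g s) \<le> norm (indicat_real {0..1} s * B)"
    using B by eventually_elim (auto simp: indicator_def)
qed measurable

lemma set_integral_unit_dominated:
  fixes f :: "nat \<Rightarrow> real \<Rightarrow> real"
  assumes [measurable]: "\<And>n. f n \<in> borel_measurable borel"
    and lim: "AE s in lborel. s \<in> {0..1} \<longrightarrow> (\<lambda>n. f n s) \<longlonglongrightarrow> 0"
    and B: "\<And>n. AE s in lborel. s \<in> {0..1} \<longrightarrow> \<bar>f n s\<bar> \<le> B"
  shows "(\<lambda>n. LINT s:{0..1}|lborel. f n s) \<longlonglongrightarrow> 0"
proof -
  have "(\<lambda>n. LINT s|lborel. indicat_real {0..1} s *\<^sub>R f n s) \<longlonglongrightarrow> (LINT s|(lborel :: real measure). (0::real))"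
  proof (rule integral_dominated_convergence[where w = "\<lambda>s. indicat_real {0..1} s * B" and f = "\<lambda>_. 0"
        and s = "\<lambda>n s. indicat_real {0..1} s *\<^sub>R f n s"])
    show "integrable lborel (\<lambda>s::real. indicat_real {0..1} s * B)" by (intro integrable_mult_left integrable_real_indicator) auto
    show "AE s in lborel. (\<lambda>n. indicat_real {0..1} s *\<^sub>R f n s) \<longlonglongrightarrow> 0"
      using lim by eventually_elim (auto simp: indicator_def)
    show "AE s in lborel. norm (indicat_real {0..1} s *\<^sub>R f n s) \<le> indicat_real {0..1} s * B" for n
      using B[of n] by eventually_elim (auto simp: indicator_def)
  qed measurable
  then show ?thesis by (simp add: set_lebesgue_integral_def)
qed

text \<open>A density argument: g is an almost everywhere limit of continuous functions, on which
  the step functions converge pointwise, and the L1 contraction transfers the approximation error to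
  the step functions.\<close>

lemma grid_step_L1:
  fixes g :: "real \<Rightarrow> 'a::euclidean_space"
  assumes g [measurable]: "g \<in> borel_measurable borel" and B: "\<And>s. norm (g s) \<le> B"
  shows "(\<lambda>n. LINT s:{0..1}|lborel. norm (grid_step n g s - g s)) \<longlonglongrightarrow> 0"
proof -
  have B0: "0 \<le> B" using B[of 0] norm_ge_zero[of "g 0"] by linarith
  have "g \<in> borel_measurable lebesgue" using g by (simp add: measurable_completion)
  then have "g measurable_on UNIV" by (rule lebesgue_measurable_imp_measurable_on) simp
  then obtain N c0 where N: "negligible N" and c0: "\<And>k. continuous_on UNIV (c0 k)"
    and lim0: "\<And>x. x \<notin> N \<Longrightarrow> (\<lambda>k. c0 k x) \<longlonglongrightarrow> g x"
    unfolding measurable_on_def by auto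
  \<comment> \<open>Projecting onto the ball of radius B keeps the approximants continuous and
    convergent to g, and supplies the uniform bound for dominated convergence.\<close>
  define c where "c k x = closest_point (cball 0 B) (c0 k x)" for k :: nat and x
  have cball: "convex (cball (0::'a) B)" "closed (cball (0::'a) B)" "cball (0::'a) B \<noteq> {}"
    using B0 by auto
  have cp: "continuous_on UNIV (closest_point (cball (0::'a) B))"
    by (rule continuous_on_closest_point[OF cball])
  have c: "continuous_on UNIV (c k)" for k
    unfolding c_def using continuous_on_compose2[OF cp c0] by simp
  then have c_meas [measurable]: "c k \<in> borel_measurable borel" for k
    by (rule borel_measurable_continuous_onI)
  have cB: "norm (c k x) \<le> B" for k x
    using closest_point_in_set[OF cball(2,3)] by (simp add: c_def)
  have limc: "(\<lambda>k. c k x) \<longlonglongrightarrow> g x" if "x \<notin> N" for x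
  proof -
    have "(\<lambda>k. closest_point (cball 0 B) (c0 k x)) \<longlonglongrightarrow> closest_point (cball 0 B) (g x)"
      using cp lim0[OF that] by (auto simp: continuous_on_eq_continuous_at intro: isCont_tendsto_compose)
    then show ?thesis using closest_point_self[of "g x" "cball 0 B"] B[of x] by (simp add: c_def)
  qed
  have AE_N: "AE x in lborel. x \<notin> N"
    using N AE_not_in[of N lebesgue] by (simp add: negligible_iff_null_sets AE_completion_iff)
  have \<delta>: "(\<lambda>k. LINT s:{0..1}|lborel. norm (g s - c k s)) \<longlonglongrightarrow> 0"
  proof (rule set_integral_unit_dominated[where B="2 * B"])
    show "AE s in lborel. s \<in> {0..1} \<longrightarrow> (\<lambda>k. norm (g s - c k s)) \<longlonglongrightarrow> 0"
      using AE_N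
    proof eventually_elim
      case (elim s)
      then show ?case using tendsto_norm[OF tendsto_diff[OF tendsto_const[of "g s"] limc[of s]]] by simp
    qed
    show "AE s in lborel. s \<in> {0..1} \<longrightarrow> \<bar>norm (g s - c k s)\<bar> \<le> 2 * B" for k
    proof (intro AE_I2 impI)
      fix s show "\<bar>norm (g s - c k s)\<bar> \<le> 2 * B"
        using norm_triangle_ineq4[of "g s" "c k s"] B[of s] cB[of k s] by simp
    qed
  qed measurable
  show ?thesis
  proof (rule LIMSEQ_I)
    fix r :: real assume r: "0 < r"
    \<comment> \<open>The index k is fixed first: by the contraction, the L1 norms of
      \<open>g - c k\<close> and of its step functions are below r/3 for all n at once. Only the
      continuous function \<open>c k\<close> needs large n.\<close>
    obtain k where k: "norm ((LINT s:{0..1}|lborel. norm (g s - c k s)) - 0) < r / 3"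
      using LIMSEQ_D[OF \<delta>, of "r / 3"] r by auto
    have "(\<lambda>n. LINT s:{0..1}|lborel. norm (grid_step n (c k) s - c k s)) \<longlonglongrightarrow> 0"
    proof (rule set_integral_unit_dominated[where B="2 * B"])
      show "AE s in lborel. s \<in> {0..1} \<longrightarrow> (\<lambda>n. norm (grid_step n (c k) s - c k s)) \<longlonglongrightarrow> 0"
        using AE_pos_unit
      proof eventually_elim
        case (elim s)
        then show ?case
          using tendsto_norm[OF tendsto_diff[OF grid_step_continuous_tendsto[OF c[of k], of s] tendsto_const[of "c k s"]]]
          by auto
      qed
      show "AE s in lborel. s \<in> {0..1} \<longrightarrow> \<bar>norm (grid_step n (c k) s - c k s)\<bar> \<le> 2 * B" for n
        using AE_pos_unit
      proof (eventually_elim, intro impI)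
        fix s :: real assume "s \<in> {0..1} \<longrightarrow> 0 < s" "s \<in> {0..1}"
        then have "norm (grid_step n (c k) s) \<le> B"
          by (intro grid_step_norm_le c_meas cB) auto
        then show "\<bar>norm (grid_step n (c k) s - c k s)\<bar> \<le> 2 * B"
          using norm_triangle_ineq4[of "grid_step n (c k) s" "c k s"] cB[of k s] by simp
      qed
    qed measurable
    then obtain n0 where n0: "\<And>n. n \<ge> n0 \<Longrightarrow> norm ((LINT s:{0..1}|lborel. norm (grid_step n (c k) s - c k s)) - 0) < r / 3"
      using LIMSEQ_D[of _ _ "r / 3"] r by fastforce
    have gi: "set_integrable lborel {0..1} g" and ci: "set_integrable lborel {0..1} (c k)"
      using B cB by (auto intro!: set_integrable_unit_bounded)
    have gci: "set_integrable lborel {0..1} (\<lambda>s. g s - c k s)" by (rule set_integral_diff(1)[OF gi ci])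
    have gci': "set_integrable lborel {0..1} (\<lambda>s. norm (g s - c k s))" by (rule set_integrable_norm[OF gci])
    have si: "set_integrable lborel {0..1} (\<lambda>s. norm (grid_step n (\<lambda>s. g s - c k s) s))" for n
      by (rule grid_step_contraction(1)[OF gci])
    have ti: "set_integrable lborel {0..1} (\<lambda>s. norm (grid_step n h s - h s))"
      if h [measurable]: "h \<in> borel_measurable borel" and hB: "\<And>s. norm (h s) \<le> B" for h n
    proof (rule set_integrable_unit_bounded)
      show "AE s in lborel. s \<in> {0..1} \<longrightarrow> norm (norm (grid_step n h s - h s)) \<le> 2 * B"
        using AE_pos_unit
      proof (eventually_elim, intro impI)
        fix s :: real assume "s \<in> {0..1} \<longrightarrow> 0 < s" "s \<in> {0..1}"
        then have "norm (grid_step n h s) \<le> B"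
          by (intro grid_step_norm_le h hB) auto
        then show "norm (norm (grid_step n h s - h s)) \<le> 2 * B"
          using norm_triangle_ineq4[of "grid_step n h s" "h s"] hB[of s] by simp
      qed
    qed measurable
    show "\<exists>no. \<forall>n\<ge>no. norm ((LINT s:{0..1}|lborel. norm (grid_step n g s - g s)) - 0) < r"
    proof (intro exI allI impI)
      fix n assume n: "n0 \<le> n"
      have "(LINT s:{0..1}|lborel. norm (grid_step n g s - g s))
        \<le> (LINT s:{0..1}|lborel. norm (grid_step n (\<lambda>s. g s - c k s) s) + (norm (grid_step n (c k) s - c k s) + norm (g s - c k s)))"
      proof (rule set_integral_mono)
        show "set_integrable lborel {0..1} (\<lambda>s. norm (grid_step n g s - g s))" by (rule ti[OF g B])
        show "set_integrable lborel {0..1} (\<lambda>s. norm (grid_step n (\<lambda>s. g s - c k s) s) + (norm (grid_step n (c k) s - c k s) + norm (g s - c k s)))"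
          by (intro set_integral_add(1) si ti c_meas cB gci')
        fix s
        have "grid_step n g s - g s = grid_step n (\<lambda>s. g s - c k s) s + ((grid_step n (c k) s - c k s) - (g s - c k s))"
          by (simp add: grid_step_diff[OF gi ci])
        also have "norm \<dots> \<le> norm (grid_step n (\<lambda>s. g s - c k s) s) + (norm (grid_step n (c k) s - c k s) + norm (g s - c k s))"
          by (intro norm_triangle_mono order_refl norm_triangle_ineq4)
        finally show "norm (grid_step n g s - g s) \<le> norm (grid_step n (\<lambda>s. g s - c k s) s) + (norm (grid_step n (c k) s - c k s) + norm (g s - c k s))" .
      qed
      also have "\<dots> = (LINT s:{0..1}|lborel. norm (grid_step n (\<lambda>s. g s - c k s) s))
          + ((LINT s:{0..1}|lborel. norm (grid_step n (c k) s - c k s)) + (LINT s:{0..1}|lborel. norm (g s - c k s)))"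
        using si ti[OF c_meas cB] gci' by (simp add: set_integral_add)
      also have "\<dots> < r"
        using grid_step_contraction(2)[OF gci, of n] k n0[OF n] by auto
      finally have "(LINT s:{0..1}|lborel. norm (grid_step n g s - g s)) < r" .
      moreover have "0 \<le> (LINT s:{0..1}|lborel. norm (grid_step n g s - g s))"
        unfolding set_lebesgue_integral_def by (intro integral_nonneg_AE) auto
      ultimately show "norm ((LINT s:{0..1}|lborel. norm (grid_step n g s - g s)) - 0) < r" by simp
    qed
  qed
qed

section \<open>Adaptedness of time integrals\<close>

context brownian_filtration
begin

lemma finite_measure_subalgebra_F: "finite_measure_subalgebra M (F t)"
  by unfold_locales (rule subalg)

lemma pair_sigma_finite_lborel: "pair_sigma_finite M lborel"
  by (intro pair_sigma_finite.intro sigma_finite_measure_axioms lborel.sigma_finite_measure_axioms)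

lemma integrable_pair_bounded:
  fixes h :: "'n path \<Rightarrow> real \<Rightarrow> real"
  assumes h: "(\<lambda>(w, s). h w s) \<in> borel_measurable (M \<Otimes>\<^sub>M lborel)" and B: "\<And>w s. \<bar>h w s\<bar> \<le> B"
    and S: "S \<in> sets borel" "S \<subseteq> {0..1}"
  shows "integrable (M \<Otimes>\<^sub>M lborel) (\<lambda>(w, s). indicat_real S s * h w s)"
proof -
  interpret P: pair_sigma_finite M lborel by (rule pair_sigma_finite_lborel)
  note [measurable] = h
  have [measurable]: "S \<in> sets borel" by fact
  have Sf: "emeasure lborel S < \<infinity>"
    using emeasure_mono[OF S(2), of lborel] by (auto simp: less_top[symmetric] top_unique)
  have "integrable (M \<Otimes>\<^sub>M lborel) (indicat_real (space M \<times> S))"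
    using Sf by (intro integrable_real_indicator)
      (auto simp: lborel.emeasure_pair_measure_Times emeasure_space_1)
  then have 1: "integrable (M \<Otimes>\<^sub>M lborel) (\<lambda>x. indicat_real (space M \<times> S) x * B)"
    by (rule integrable_mult_left)
  show ?thesis
  proof (rule Bochner_Integration.integrable_bound[OF 1])
    show "AE x in M \<Otimes>\<^sub>M lborel. norm (case x of (w, s) \<Rightarrow> indicat_real S s * h w s) \<le> norm (indicat_real (space M \<times> S) x * B)"
    proof (rule AE_I2)
      fix x :: "'n path \<times> real" assume x: "x \<in> space (M \<Otimes>\<^sub>M lborel)"
      obtain w s where ws: "x = (w, s)" by (cases x)
      have "\<bar>h w s\<bar> \<le> \<bar>B\<bar>" using B[of w s] by linarith
      then show "norm (case x of (w, s) \<Rightarrow> indicat_real S s * h w s) \<le> norm (indicat_real (space M \<times> S) x * B)"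
        using x ws by (auto simp: indicator_def space_pair_measure)
    qed
  qed measurable
qed

text \<open>Joint measurability together with adaptedness does not give progressive measurability, so
  \<open>\<F>\<^sub>b\<close>-measurability of the time integral is obtained by showing that the integral equals its
  own conditional expectation; completeness of \<open>\<F>\<^sub>b\<close> then removes the null set.\<close>

lemma time_integral_measurable_real:
  fixes h :: "'n path \<Rightarrow> real \<Rightarrow> real"
  assumes h: "(\<lambda>(w, s). h w s) \<in> borel_measurable (M \<Otimes>\<^sub>M lborel)" and B: "\<And>w s. \<bar>h w s\<bar> \<le> B"
    and S: "S \<in> sets borel" "S \<subseteq> {0..1}" and adapted: "\<And>s. s \<in> S \<Longrightarrow> (\<lambda>w. h w s) \<in> borel_measurable (F b)"
  shows "(\<lambda>w. LINT s:S|lborel. h w s) \<in> borel_measurable (F b)"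
proof -
  interpret P: pair_sigma_finite M lborel by (rule pair_sigma_finite_lborel)
  interpret C: finite_measure_subalgebra M "F b" by (rule finite_measure_subalgebra_F)
  note [measurable] = h
  have [measurable]: "S \<in> sets borel" by fact
  have hs [measurable]: "(\<lambda>w. h w s) \<in> borel_measurable M" for s
    using measurable_compose[OF measurable_Pair2'[of s lborel M] h] by simp
  define Z where "Z w = (LINT s:S|lborel. h w s)" for w
  \<comment> \<open>Fubini against a bounded multiplier; it is used for the constant 1, for the
    indicator of A, and for the conditional probability of A.\<close>
  have Z_int: "integrable M (\<lambda>w. R w * Z w) \<and>
      (\<integral> w. R w * Z w \<partial>M) = (LINT s|lborel. indicat_real S s * (\<integral> w. R w * h w s \<partial>M))"
    if R [measurable]: "R \<in> borel_measurable M" and R1: "\<And>w. \<bar>R w\<bar> \<le> 1" for R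
  proof -
    have B0: "0 \<le> B" using B[of undefined undefined] by linarith
    have "\<bar>R w * h w s\<bar> \<le> B" for w s
      using mult_mono[OF R1[of w] B[of w s]] by (simp add: abs_mult)
    then have i: "integrable (M \<Otimes>\<^sub>M lborel) (\<lambda>(w, s). indicat_real S s * (R w * h w s))"
      by (intro integrable_pair_bounded S) auto
    have eq: "(LINT s|lborel. indicat_real S s * (R w * h w s)) = R w * Z w" for w
      unfolding Z_def set_lebesgue_integral_def by (subst integral_mult_right_zero[symmetric]) (simp add: mult_ac)
    have eq2: "(\<integral> w. indicat_real S s * (R w * h w s) \<partial>M) = indicat_real S s * (\<integral> w. R w * h w s \<partial>M)" for s
      by (rule integral_mult_right_zero)
    show ?thesis
      using P.integrable_fst[OF i] P.Fubini_integral[OF i] by (simp only: eq eq2)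
  qed
  have Z: "integrable M Z" using Z_int[of "\<lambda>_. 1"] by simp
  then have Zm [measurable]: "Z \<in> borel_measurable M" by simp
  have "AE w in M. real_cond_exp M (F b) Z w = Z w"
  proof (rule density_unique_real)
    show "integrable M (real_cond_exp M (F b) Z)" by (rule C.real_cond_exp_int[OF Z])
    show "integrable M Z" by fact
    fix A assume A [measurable]: "A \<in> sets M"
    let ?R = "real_cond_exp M (F b) (indicat_real A)"
    \<comment> \<open>The conditional probability of A, clipped so that the bound 1 holds everywhere
      and not just almost surely. Each \<open>h w s\<close> with s in S is known at time b, so
      testing it against A or against R gives the same value.\<close>
    define R where "R w = max 0 (min 1 (?R w))" for w
    have iA: "integrable M (indicat_real A)"
      by (intro integrable_real_indicator A) (simp add: emeasure_eq_measure)
    have "AE w in M. ?R w \<ge> 0" by (rule C.real_cond_exp_pos) auto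
    moreover have "AE w in M. ?R w \<le> 1" by (rule C.real_cond_exp_le_c[OF iA]) (auto simp: indicator_def)
    ultimately have RAE: "AE w in M. R w = ?R w" by eventually_elim (auto simp: R_def)
    have [measurable]: "R \<in> borel_measurable (F b)" unfolding R_def by measurable
    have [measurable]: "R \<in> borel_measurable M" unfolding R_def by measurable
    have R1: "\<bar>R w\<bar> \<le> 1" for w by (auto simp: R_def)
    have "(\<integral> w. indicat_real A w * Z w \<partial>M) = (LINT s|lborel. indicat_real S s * (\<integral> w. indicat_real A w * h w s \<partial>M))"
      using Z_int[of "indicat_real A"] by (auto simp: indicator_def)
    also have "\<dots> = (LINT s|lborel. indicat_real S s * (\<integral> w. R w * h w s \<partial>M))"
    proof (intro Bochner_Integration.integral_cong refl)
      fix s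
      show "indicat_real S s * (\<integral> w. indicat_real A w * h w s \<partial>M) = indicat_real S s * (\<integral> w. R w * h w s \<partial>M)"
      proof (cases "s \<in> S")
        case True
        note [measurable] = adapted[OF True]
        have "integrable M (\<lambda>w. h w s * indicat_real A w)"
          by (rule integrable_const_bound[of _ B]) (use B in \<open>auto simp: indicator_def intro!: AE_I2 order_trans[OF _ B]\<close>)
        then have "(\<integral> w. h w s * ?R w \<partial>M) = (\<integral> w. h w s * indicat_real A w \<partial>M)"
          by (rule C.real_cond_exp_intg(2)) measurable
        moreover have "(\<integral> w. h w s * ?R w \<partial>M) = (\<integral> w. h w s * R w \<partial>M)"
          by (rule integral_cong_AE) (use RAE in \<open>auto elim: eventually_mono\<close>)
        ultimately show ?thesis by (simp add: mult.commute)
      qed simp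
    qed
    also have "\<dots> = (\<integral> w. R w * Z w \<partial>M)"
      using Z_int[of R] R1 by auto
    also have "\<dots> = (\<integral> w. R w * real_cond_exp M (F b) Z w \<partial>M)"
      using Z_int[of R] R1 by (intro C.real_cond_exp_intg(2)[symmetric]) auto
    also have "\<dots> = (\<integral> w. real_cond_exp M (F b) Z w * ?R w \<partial>M)"
      by (rule integral_cong_AE) (use RAE in \<open>auto elim: eventually_mono simp: mult.commute\<close>)
    also have "\<dots> = (\<integral> w. real_cond_exp M (F b) Z w * indicat_real A w \<partial>M)"
    proof (rule C.real_cond_exp_intg(2))
      show "integrable M (\<lambda>w. real_cond_exp M (F b) Z w * indicat_real A w)"
        using integrable_mult_indicator[OF A C.real_cond_exp_int(1)[OF Z]] by (simp add: mult.commute)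
    qed measurable
    finally show "(LINT w:A|M. real_cond_exp M (F b) Z w) = (LINT w:A|M. Z w)"
      by (simp add: set_lebesgue_integral_def mult.commute)
  qed
  then have "Z \<in> borel_measurable (F b)"
    by (rule measurable_F_AE[rotated]) auto
  then show ?thesis unfolding Z_def .
qed

lemma time_integral_measurable:
  fixes h :: "'n path \<Rightarrow> real \<Rightarrow> real^'n"
  assumes h: "(\<lambda>(w, s). h w s) \<in> borel_measurable (M \<Otimes>\<^sub>M lborel)" and B: "\<And>w s. norm (h w s) \<le> B"
    and S: "S \<in> sets borel" "S \<subseteq> {0..1}" and adapted: "\<And>s. s \<in> S \<Longrightarrow> (\<lambda>w. h w s) \<in> borel_measurable (F b)"
  shows "(\<lambda>w. LINT s:S|lborel. h w s) \<in> borel_measurable (F b)"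
  unfolding borel_measurable_euclidean_space[of "\<lambda>w. LINT s:S|lborel. h w s"]
proof
  fix e :: "real^'n" assume e: "e \<in> Basis"
  note [measurable] = h
  have "(\<lambda>w. LINT s:S|lborel. h w s \<bullet> e) \<in> borel_measurable (F b)"
  proof (rule time_integral_measurable_real[OF _ _ S])
    show "(\<lambda>(w, s). h w s \<bullet> e) \<in> borel_measurable (M \<Otimes>\<^sub>M lborel)"
      by measurable
    show "\<bar>h w s \<bullet> e\<bar> \<le> B" for w s
      using Basis_le_norm[OF e, of "h w s"] B[of w s] by linarith
    show "(\<lambda>w. h w s \<bullet> e) \<in> borel_measurable (F b)" if "s \<in> S" for s
      using adapted[OF that] by measurable
  qed
  also have "?this \<longleftrightarrow> (\<lambda>w. (LINT s:S|lborel. h w s) \<bullet> e) \<in> borel_measurable (F b)"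
  proof (rule measurable_cong)
    fix w assume "w \<in> space (F b)"
    then have w: "w \<in> space M" by simp
    have hw [measurable]: "h w \<in> borel_measurable borel"
      using measurable_compose[OF measurable_Pair1'[OF w] h] by simp
    have "set_integrable lborel {0..1} (h w)"
      using B by (intro set_integrable_unit_bounded[of _ B]) auto
    then have "set_integrable lborel S (h w)"
      by (rule set_integrable_subset_unit) (use S in auto)
    then show "(LINT s:S|lborel. h w s \<bullet> e) = (LINT s:S|lborel. h w s) \<bullet> e"
      unfolding set_integrable_def set_lebesgue_integral_def
      by (subst integral_inner_left[symmetric]) auto
  qed
  finally show "(\<lambda>w. (LINT s:S|lborel. h w s) \<bullet> e) \<in> borel_measurable (F b)" .
qed

end

section \<open>Square-integrable integrands\<close>

lemma norm_diff_sq_le: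
  fixes a b :: "'a::real_inner"
  shows "(norm (a - b))\<^sup>2 \<le> 2 * (norm a)\<^sup>2 + 2 * (norm b)\<^sup>2"
proof -
  have "0 \<le> (norm (a + b))\<^sup>2" by simp
  then show ?thesis
    by (simp add: power2_norm_eq_inner inner_add inner_diff inner_commute)
qed

section \<open>The space L2(M x [0,1]) and density of elementary integrands\<close>

context brownian_filtration
begin

definition sqint :: "('n path \<Rightarrow> real \<Rightarrow> real^'n) \<Rightarrow> bool" where
  "sqint G \<longleftrightarrow> (\<lambda>(w, s). G w s) \<in> borel_measurable (M \<Otimes>\<^sub>M lborel) \<and>
     integrable (M \<Otimes>\<^sub>M lborel) (\<lambda>(w, s). indicat_real {0..1} s * (norm (G w s))\<^sup>2)"

text \<open>The square of the L2(M x [0,1]) norm; being a square, it obeys the triangle inequality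
  only up to factors 2.\<close>

definition sqnorm :: "('n path \<Rightarrow> real \<Rightarrow> real^'n) \<Rightarrow> real" where
  "sqnorm G = (\<integral>(w, s). indicat_real {0..1} s * (norm (G w s))\<^sup>2 \<partial>(M \<Otimes>\<^sub>M lborel))"

lemma sqint_measurable: "sqint G \<Longrightarrow> (\<lambda>(w, s). G w s) \<in> borel_measurable (M \<Otimes>\<^sub>M lborel)"
  by (simp add: sqint_def)

lemma path_measurable:
  assumes "(\<lambda>(w, s). G w s) \<in> borel_measurable (M \<Otimes>\<^sub>M lborel)" "w \<in> space M"
  shows "G w \<in> borel_measurable borel"
  using measurable_compose[OF measurable_Pair1'[OF assms(2)] assms(1)] by simp

lemma sqnorm_nonneg: "0 \<le> sqnorm G"
  unfolding sqnorm_def by (intro integral_nonneg_AE) auto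

lemma energy_measurable:
  assumes [measurable]: "(\<lambda>(w, s). G w s) \<in> borel_measurable (M \<Otimes>\<^sub>M lborel)"
  shows "(\<lambda>w. energy (G w)) \<in> borel_measurable M"
  unfolding energy_def set_lebesgue_integral_def
  by (rule lborel.borel_measurable_lebesgue_integral) measurable

lemma sqint_energy:
  assumes G: "sqint G"
  shows "integrable M (\<lambda>w. energy (G w))" "(\<integral> w. energy (G w) \<partial>M) = sqnorm G"
    "AE w in M. set_integrable lborel {0..1} (\<lambda>s. (norm (G w s))\<^sup>2)"
proof -
  interpret P: pair_sigma_finite M lborel by (rule pair_sigma_finite_lborel)
  have i: "integrable (M \<Otimes>\<^sub>M lborel) (\<lambda>(w, s). indicat_real {0..1} s * (norm (G w s))\<^sup>2)"
    using G by (simp add: sqint_def)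
  show "integrable M (\<lambda>w. energy (G w))" "(\<integral> w. energy (G w) \<partial>M) = sqnorm G"
    "AE w in M. set_integrable lborel {0..1} (\<lambda>s. (norm (G w s))\<^sup>2)"
    using P.integrable_fst[OF i] P.integral_fst[OF i] P.AE_integrable_fst[OF i]
    by (simp_all add: energy_def sqnorm_def set_lebesgue_integral_def set_integrable_def)
qed

lemma sqint_diff:
  assumes G: "sqint G" and H: "sqint H"
  shows "sqint (\<lambda>w s. G w s - H w s)" "sqnorm (\<lambda>w s. G w s - H w s) \<le> 2 * sqnorm G + 2 * sqnorm H"
proof -
  note [measurable] = sqint_measurable[OF G] sqint_measurable[OF H]
  let ?e = "\<lambda>G (w, s). indicat_real {0..1} s * (norm (G w s))\<^sup>2"
  have iG: "integrable (M \<Otimes>\<^sub>M lborel) (?e G)" and iH: "integrable (M \<Otimes>\<^sub>M lborel) (?e H)"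
    using G H by (simp_all add: sqint_def)
  have i: "integrable (M \<Otimes>\<^sub>M lborel) (\<lambda>x. 2 * ?e G x + 2 * ?e H x)"
    by (intro Bochner_Integration.integrable_add integrable_mult_right iG iH)
  have le: "?e (\<lambda>w s. G w s - H w s) x \<le> 2 * ?e G x + 2 * ?e H x" for x
    using norm_diff_sq_le[of "G (fst x) (snd x)" "H (fst x) (snd x)"]
    by (auto simp: indicator_def split: prod.split)
  have i2: "integrable (M \<Otimes>\<^sub>M lborel) (?e (\<lambda>w s. G w s - H w s))"
  proof (rule Bochner_Integration.integrable_bound[OF i])
    show "AE x in M \<Otimes>\<^sub>M lborel. norm (?e (\<lambda>w s. G w s - H w s) x) \<le> norm (2 * ?e G x + 2 * ?e H x)"
    proof (rule AE_I2)
      fix x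
      have "0 \<le> ?e (\<lambda>w s. G w s - H w s) x" by (auto split: prod.split)
      then show "norm (?e (\<lambda>w s. G w s - H w s) x) \<le> norm (2 * ?e G x + 2 * ?e H x)"
        using le[of x] unfolding real_norm_def by linarith
    qed
  qed measurable
  then show "sqint (\<lambda>w s. G w s - H w s)"
    unfolding sqint_def by auto
  have "sqnorm (\<lambda>w s. G w s - H w s) \<le> (\<integral> x. 2 * ?e G x + 2 * ?e H x \<partial>(M \<Otimes>\<^sub>M lborel))"
    unfolding sqnorm_def by (rule integral_mono[OF i2 i le])
  also have "\<dots> = 2 * sqnorm G + 2 * sqnorm H"
    using iG iH by (simp add: sqnorm_def)
  finally show "sqnorm (\<lambda>w s. G w s - H w s) \<le> 2 * sqnorm G + 2 * sqnorm H" .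
qed

lemma sqnorm_triangle:
  assumes "sqint A" "sqint B" "sqint C"
  shows "sqnorm (\<lambda>w s. A w s - C w s) \<le> 2 * sqnorm (\<lambda>w s. A w s - B w s) + 2 * sqnorm (\<lambda>w s. C w s - B w s)"
  using sqint_diff(2)[OF sqint_diff(1)[OF assms(1,2)] sqint_diff(1)[OF assms(3,2)]] by simp

lemma elementary_integrand_measurable:
  assumes e: "elementary k t \<xi>"
  shows "(\<lambda>(w, s). elementary_integrand k t \<xi> w s) \<in> borel_measurable (M \<Otimes>\<^sub>M lborel)"
proof -
  have "(\<lambda>x. indicat_real {t i<..t (Suc i)} (snd x) *\<^sub>R \<xi> i (fst x)) \<in> borel_measurable (M \<Otimes>\<^sub>M lborel)"
    if "i < k" for i
  proof -
    note [measurable] = elementary_measurable_M[OF e that]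
    show ?thesis by measurable
  qed
  then show ?thesis
    unfolding elementary_integrand_def split_beta by (intro borel_measurable_sum) auto
qed

lemma sqintI:
  assumes [measurable]: "(\<lambda>(w, s). G w s) \<in> borel_measurable (M \<Otimes>\<^sub>M lborel)"
    and "AE w in M. set_integrable lborel {0..1} (\<lambda>s. (norm (G w s))\<^sup>2)"
    and "integrable M (\<lambda>w. energy (G w))"
  shows "sqint G"
proof -
  interpret P: pair_sigma_finite M lborel by (rule pair_sigma_finite_lborel)
  have "integrable (M \<Otimes>\<^sub>M lborel) (\<lambda>(w, s). indicat_real {0..1} s * (norm (G w s))\<^sup>2)"
  proof (rule P.Fubini_integrable)
    have "(\<integral>s. norm (indicat_real {0..1} s * (norm (G w s))\<^sup>2) \<partial>lborel) = energy (G w)" for w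
      unfolding energy_def set_lebesgue_integral_def by (intro Bochner_Integration.integral_cong) auto
    then show "integrable M (\<lambda>w. \<integral>s. norm (case (w, s) of (w, s) \<Rightarrow> indicat_real {0..1} s * (norm (G w s))\<^sup>2) \<partial>lborel)"
      using assms(3) by simp
    show "AE w in M. integrable lborel (\<lambda>s. case (w, s) of (w, s) \<Rightarrow> indicat_real {0..1} s * (norm (G w s))\<^sup>2)"
      using assms(2) by eventually_elim (simp add: set_integrable_def)
  qed measurable
  then show ?thesis using assms(1) by (simp add: sqint_def)
qed

lemma elementary_sqint:
  assumes e: "elementary k t \<xi>"
  shows "sqint (elementary_integrand k t \<xi>)"
proof (rule sqintI)
  show "(\<lambda>(w, s). elementary_integrand k t \<xi> w s) \<in> borel_measurable (M \<Otimes>\<^sub>M lborel)"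
    by (rule elementary_integrand_measurable[OF e])
  show "integrable M (\<lambda>w. energy (elementary_integrand k t \<xi> w))"
    by (rule elementary_energy_integrable(1)[OF e])
  show "AE w in M. set_integrable lborel {0..1} (\<lambda>s. (norm (elementary_integrand k t \<xi> w s))\<^sup>2)"
  proof (rule AE_I2)
    fix w
    have "integrable lborel (\<lambda>s. \<Sum>i<k. indicat_real {t i<..t (Suc i)} s *\<^sub>R (norm (\<xi> i w))\<^sup>2)"
      by (intro Bochner_Integration.integrable_sum integral_Ioc_indicator elementary_step[OF e]) simp
    then have "integrable lborel (\<lambda>s. (norm (elementary_integrand k t \<xi> w s))\<^sup>2)"
      by (subst elementary_integrand_norm_sq) (simp_all add: elementary_step[OF e])
    then have "integrable lborel (\<lambda>s. indicat_real {0..1} s *\<^sub>R (norm (elementary_integrand k t \<xi> w s))\<^sup>2)"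
      by (rule integrable_mult_indicator[rotated]) simp
    then show "set_integrable lborel {0..1} (\<lambda>s. (norm (elementary_integrand k t \<xi> w s))\<^sup>2)"
      unfolding set_integrable_def .
  qed
qed

text \<open>On a common grid the difference is one elementary integral, so the second-moment bound
  makes integration Lipschitz between the L2 spaces. This is what turns convergence of integrands
  into Cauchy sequences of integrals.\<close>

lemma elementary_integral_diff_sq:
  assumes e1: "elementary k1 t1 \<xi>1" and e2: "elementary k2 t2 \<xi>2"
  shows "integrable M (\<lambda>w. (elementary_integral \<beta> k1 t1 \<xi>1 w - elementary_integral \<beta> k2 t2 \<xi>2 w)\<^sup>2)"
    "(\<integral> w. (elementary_integral \<beta> k1 t1 \<xi>1 w - elementary_integral \<beta> k2 t2 \<xi>2 w)\<^sup>2 \<partial>M)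
      \<le> real CARD('n) * sqnorm (\<lambda>w s. elementary_integrand k1 t1 \<xi>1 w s - elementary_integrand k2 t2 \<xi>2 w s)"
proof -
  obtain k t \<xi> where e: "elementary k t \<xi>"
    and d: "\<And>w s. elementary_integrand k t \<xi> w s = elementary_integrand k1 t1 \<xi>1 w s - elementary_integrand k2 t2 \<xi>2 w s"
    and I: "\<And>w. elementary_integral \<beta> k t \<xi> w = elementary_integral \<beta> k1 t1 \<xi>1 w - elementary_integral \<beta> k2 t2 \<xi>2 w"
    using elementary_diff[OF e1 e2] by blast
  have "elementary_integrand k t \<xi> = (\<lambda>w s. elementary_integrand k1 t1 \<xi>1 w s - elementary_integrand k2 t2 \<xi>2 w s)"
    using d by (simp add: fun_eq_iff)
  then have "(\<integral> w. energy (elementary_integrand k t \<xi> w) \<partial>M)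
    = sqnorm (\<lambda>w s. elementary_integrand k1 t1 \<xi>1 w s - elementary_integrand k2 t2 \<xi>2 w s)"
    using sqint_energy(2)[OF elementary_sqint[OF e]] by simp
  then show "integrable M (\<lambda>w. (elementary_integral \<beta> k1 t1 \<xi>1 w - elementary_integral \<beta> k2 t2 \<xi>2 w)\<^sup>2)"
    "(\<integral> w. (elementary_integral \<beta> k1 t1 \<xi>1 w - elementary_integral \<beta> k2 t2 \<xi>2 w)\<^sup>2 \<partial>M)
      \<le> real CARD('n) * sqnorm (\<lambda>w s. elementary_integrand k1 t1 \<xi>1 w s - elementary_integrand k2 t2 \<xi>2 w s)"
    using elementary_integral_sq_le[OF e] by (simp_all add: I)
qed

definition sq_adapted :: "('n path \<Rightarrow> real \<Rightarrow> real^'n) \<Rightarrow> bool" where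
  "sq_adapted d \<longleftrightarrow> sqint d \<and> (\<forall>t\<in>{0..1}. (\<lambda>w. d w t) \<in> borel_measurable (F t))"

text \<open>Lagged averages of an adapted process are adapted by
  \<open>time_integral_measurable\<close>. Pathwise L1 convergence together with the uniform bound
  yields convergence of the energy on each path, and dominated convergence then handles the
  expectation.\<close>

lemma elementary_approx_bounded:
  fixes d :: "'n path \<Rightarrow> real \<Rightarrow> real^'n"
  assumes d: "(\<lambda>(w, s). d w s) \<in> borel_measurable (M \<Otimes>\<^sub>M lborel)"
    and ad: "\<And>t. t \<in> {0..1} \<Longrightarrow> (\<lambda>w. d w t) \<in> borel_measurable (F t)"
    and B: "\<And>w s. norm (d w s) \<le> B" and \<epsilon>: "0 < \<epsilon>"
  shows "\<exists>k t \<xi>. elementary k t \<xi> \<and> sqnorm (\<lambda>w s. elementary_integrand k t \<xi> w s - d w s) < \<epsilon>"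
proof -
  have B0: "0 \<le> B" using B[of undefined 0] norm_ge_zero order_trans by blast
  note dm = path_measurable[OF d]
  define \<xi> where "\<xi> n i w = grid_avg n (d w) i" for n i w
  have e: "elementary n (gridpt n) (\<xi> n)" for n
    unfolding elementary_def
  proof (intro conjI allI impI)
    show "0 \<le> gridpt n 0" "gridpt n n \<le> 1" by (auto simp: gridpt_le_1)
    fix i assume i: "i < n"
    show "gridpt n i \<le> gridpt n (Suc i)" by simp
    have "norm (\<xi> n i w) \<le> B" if "w \<in> space M" for w
      unfolding \<xi>_def by (rule grid_avg_norm_le[OF dm[OF that] B])
    then show "bounded (\<xi> n i ` space M)" unfolding bounded_iff by blast
    show "\<xi> n i \<in> borel_measurable (F (gridpt n i))"
    proof (cases i)
      case 0 then show ?thesis by (simp add: \<xi>_def[abs_def] grid_avg_def)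
    next
      case (Suc j)
      have "(\<lambda>w. LINT s:{gridpt n j<..gridpt n (Suc j)}|lborel. d w s) \<in> borel_measurable (F (gridpt n (Suc j)))"
      proof (rule time_integral_measurable[OF d B])
        show sub: "{gridpt n j<..gridpt n (Suc j)} \<subseteq> {0..1}"
          using grid_interval_subset[of j n] i Suc by simp
        fix s assume s: "s \<in> {gridpt n j<..gridpt n (Suc j)}"
        then have "s \<in> {0..1}" using sub by blast
        then show "(\<lambda>w. d w s) \<in> borel_measurable (F (gridpt n (Suc j)))"
          using measurable_F_mono[OF ad[of s]] s by auto
      qed simp
      then show ?thesis by (simp add: \<xi>_def[abs_def] grid_avg_def Suc)
    qed
  qed
  have step: "elementary_integrand n (gridpt n) (\<xi> n) w = grid_step n (d w)" for n w
    by (simp add: elementary_integrand_def grid_step_def \<xi>_def fun_eq_iff)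
  let ?G = "\<lambda>n w s. elementary_integrand n (gridpt n) (\<xi> n) w s - d w s"
  have Gm: "(\<lambda>(w, s). ?G n w s) \<in> borel_measurable (M \<Otimes>\<^sub>M lborel)" for n
  proof -
    note [measurable] = d elementary_integrand_measurable[OF e[of n]]
    show ?thesis by measurable
  qed
  have bd: "AE s in lborel. s \<in> {0..1} \<longrightarrow> norm (?G n w s) \<le> 2 * B" if w: "w \<in> space M" for n w
    using AE_pos_unit
  proof (eventually_elim, intro impI)
    fix s :: real assume "s \<in> {0..1} \<longrightarrow> 0 < s" "s \<in> {0..1}"
    then have "norm (grid_step n (d w) s) \<le> B"
      by (intro grid_step_norm_le dm[OF w] B) auto
    then show "norm (?G n w s) \<le> 2 * B"
      unfolding step using norm_triangle_ineq4[of "grid_step n (d w) s" "d w s"] B[of w s] by simp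
  qed
  have si: "set_integrable lborel {0..1} (\<lambda>s. norm (?G n w s))" "set_integrable lborel {0..1} (\<lambda>s. (norm (?G n w s))\<^sup>2)"
    if w: "w \<in> space M" for n w
  proof -
    have [measurable]: "elementary_integrand n (gridpt n) (\<xi> n) w \<in> borel_measurable borel" "d w \<in> borel_measurable borel"
      by (rule path_measurable[OF elementary_integrand_measurable[OF e] w], rule dm[OF w])
    show "set_integrable lborel {0..1} (\<lambda>s. norm (?G n w s))"
      using bd[OF w, of n] by (intro set_integrable_unit_bounded[of _ "2 * B"]) auto
    show "set_integrable lborel {0..1} (\<lambda>s. (norm (?G n w s))\<^sup>2)"
    proof (rule set_integrable_unit_bounded[of _ "(2 * B)\<^sup>2"])
      show "AE s in lborel. s \<in> {0..1} \<longrightarrow> norm ((norm (?G n w s))\<^sup>2) \<le> (2 * B)\<^sup>2"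
        using bd[OF w, of n]
      proof eventually_elim
        case (elim s)
        then show ?case using power_mono[of "norm (?G n w s)" "2 * B" 2] by auto
      qed
    qed measurable
  qed
  \<comment> \<open>Both the step function and d are bounded by B off a null set of times, so the
    squared error is at most 2B times the error; this lifts L1 convergence to L2.\<close>
  have le: "energy (?G n w) \<le> 2 * B * (LINT s:{0..1}|lborel. norm (?G n w s))" if w: "w \<in> space M" for n w
  proof -
    have "energy (?G n w) \<le> (LINT s:{0..1}|lborel. 2 * B * norm (?G n w s))"
      unfolding energy_def
    proof (rule set_integral_mono_AE[OF si(2)[OF w] set_integrable_mult_right[OF si(1)[OF w]]])
      show "AE s\<in>{0..1} in lborel. (norm (?G n w s))\<^sup>2 \<le> 2 * B * norm (?G n w s)"
        using bd[OF w, of n] by eventually_elim (auto simp: power2_eq_square intro!: mult_right_mono)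
    qed
    then show ?thesis by simp
  qed
  have le2: "energy (?G n w) \<le> 2 * B * (2 * B)" if w: "w \<in> space M" for n w
  proof -
    have "(LINT s:{0..1}|lborel. norm (?G n w s)) \<le> (LINT s:{0..1::real}|lborel. 2 * B)"
    proof (rule set_integral_mono_AE[OF si(1)[OF w]])
      show "set_integrable lborel {0..1::real} (\<lambda>_. 2 * B)"
        by (rule set_integrable_unit_bounded[of _ "2 * B"]) (use B0 in auto)
    qed (use bd[OF w, of n] in auto)
    also have "\<dots> = 2 * B" by (simp add: set_lebesgue_integral_def)
    finally show ?thesis using le[OF w, of n] B0 by (meson mult_left_mono mult_nonneg_nonneg order_trans zero_le_numeral)
  qed
  have "(\<lambda>n. \<integral> w. energy (?G n w) \<partial>M) \<longlonglongrightarrow> (\<integral> w. 0 \<partial>M)"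
  proof (rule integral_dominated_convergence[where w = "\<lambda>_. 2 * B * (2 * B)"])
    show "AE w in M. (\<lambda>n. energy (?G n w)) \<longlonglongrightarrow> 0"
    proof (rule AE_I2)
      fix w assume w: "w \<in> space M"
      show "(\<lambda>n. energy (?G n w)) \<longlonglongrightarrow> 0"
      proof (rule tendsto_sandwich[OF _ _ tendsto_const])
        have "(\<lambda>n. 2 * B * (LINT s:{0..1}|lborel. norm (grid_step n (d w) s - d w s))) \<longlonglongrightarrow> 2 * B * 0"
          by (intro tendsto_mult tendsto_const grid_step_L1[OF dm[OF w] B])
        then show "(\<lambda>n. 2 * B * (LINT s:{0..1}|lborel. norm (?G n w s))) \<longlonglongrightarrow> 0"
          by (simp add: step)
      qed (use le[OF w] in \<open>auto simp: energy_nonneg\<close>)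
    qed
    show "AE w in M. norm (energy (?G n w)) \<le> 2 * B * (2 * B)" for n
      using le2 by (intro AE_I2) (simp add: energy_nonneg)
  qed (auto intro!: energy_measurable Gm)
  then have "(\<lambda>n. \<integral> w. energy (?G n w) \<partial>M) \<longlonglongrightarrow> 0" by simp
  then obtain n where n: "norm ((\<integral> w. energy (?G n w) \<partial>M) - 0) < \<epsilon>"
    using LIMSEQ_D[of _ 0 \<epsilon>] \<epsilon> by blast
  have "sqint (?G n)"
  proof (rule sqintI[OF Gm AE_I2[OF si(2)]])
    show "integrable M (\<lambda>w. energy (?G n w))"
      by (rule integrable_const_bound[of _ "2 * B * (2 * B)"])
         (use le2 in \<open>auto simp: energy_nonneg intro!: energy_measurable Gm\<close>)
  qed
  then have "sqnorm (?G n) < \<epsilon>" using n sqint_energy(2)[of "?G n"] by auto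
  then show ?thesis using e by blast
qed

text \<open>Cutting off large values reduces to the bounded case. The cutoff acts at each time
  separately, so it preserves adaptedness.\<close>

lemma elementary_approx:
  assumes d: "sq_adapted d" and \<epsilon>: "0 < \<epsilon>"
  shows "\<exists>k t \<xi>. elementary k t \<xi> \<and> sqnorm (\<lambda>w s. elementary_integrand k t \<xi> w s - d w s) < \<epsilon>"
proof -
  have di: "sqint d" and ad: "\<And>t. t \<in> {0..1} \<Longrightarrow> (\<lambda>w. d w t) \<in> borel_measurable (F t)"
    using d by (auto simp: sq_adapted_def)
  note [measurable] = sqint_measurable[OF di]
  define dN where "dN N w s = (if norm (d w s) \<le> real N then d w s else 0)" for N :: nat and w s
  have dNm [measurable]: "(\<lambda>(w, s). dN N w s) \<in> borel_measurable (M \<Otimes>\<^sub>M lborel)" for N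
    unfolding dN_def by measurable
  let ?e = "\<lambda>G (w, s). indicat_real {0..1} s * (norm (G w s))\<^sup>2"
  have iD: "integrable (M \<Otimes>\<^sub>M lborel) (?e d)" using di by (simp add: sqint_def)
  have dom: "norm (?e (\<lambda>w s. d w s - dN N w s) x) \<le> ?e d x" for N x
    by (auto simp: dN_def split: prod.split)
  have dom2: "norm (?e (dN N) x) \<le> ?e d x" for N x
    by (auto simp: dN_def split: prod.split)
  have dNi: "sqint (dN N)" for N
    unfolding sqint_def
  proof
    show "integrable (M \<Otimes>\<^sub>M lborel) (?e (dN N))"
      by (rule Bochner_Integration.integrable_bound[OF iD])
         (measurable, rule AE_I2, rule order_trans[OF dom2], simp)
  qed measurable
  have "(\<lambda>N. \<integral> x. ?e (\<lambda>w s. d w s - dN N w s) x \<partial>(M \<Otimes>\<^sub>M lborel)) \<longlonglongrightarrow> (\<integral> x. (0::real) \<partial>(M \<Otimes>\<^sub>M (lborel :: real measure)))"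
  proof (rule integral_dominated_convergence[where w = "?e d"])
    show "AE x in M \<Otimes>\<^sub>M lborel. (\<lambda>N. ?e (\<lambda>w s. d w s - dN N w s) x) \<longlonglongrightarrow> 0"
    proof (rule AE_I2)
      fix x :: "'n path \<times> real"
      obtain w s where x: "x = (w, s)" by (cases x)
      obtain N0 where N0: "norm (d w s) \<le> real N0" using real_arch_simple by blast
      have "eventually (\<lambda>N. ?e (\<lambda>w s. d w s - dN N w s) x = 0) sequentially"
        using eventually_ge_at_top[of N0] by eventually_elim (use N0 in \<open>auto simp: x dN_def\<close>)
      then show "(\<lambda>N. ?e (\<lambda>w s. d w s - dN N w s) x) \<longlonglongrightarrow> 0"
        by (rule tendsto_eventually)
    qed
  qed (use iD dom in \<open>auto simp del: real_norm_def\<close>)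
  then have "(\<lambda>N. sqnorm (\<lambda>w s. d w s - dN N w s)) \<longlonglongrightarrow> 0"
    by (simp add: sqnorm_def)
  \<comment> \<open>A quarter of \<epsilon> for each of two errors, because
    \<open>sqnorm_triangle\<close> doubles both.\<close>
  then obtain N where N: "norm (sqnorm (\<lambda>w s. d w s - dN N w s) - 0) < \<epsilon> / 4"
    using LIMSEQ_D[of _ 0 "\<epsilon> / 4"] \<epsilon> by fastforce
  have "\<exists>k t \<xi>. elementary k t \<xi> \<and> sqnorm (\<lambda>w s. elementary_integrand k t \<xi> w s - dN N w s) < \<epsilon> / 4"
  proof (rule elementary_approx_bounded[OF dNm])
    show "(\<lambda>w. dN N w t) \<in> borel_measurable (F t)" if "t \<in> {0..1}" for t
    proof -
      note [measurable] = ad[OF that]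
      show ?thesis unfolding dN_def by measurable
    qed
    show "norm (dN N w s) \<le> real N" for w s by (simp add: dN_def)
  qed (use \<epsilon> in simp)
  then obtain k t \<xi> where e: "elementary k t \<xi>"
    and lt: "sqnorm (\<lambda>w s. elementary_integrand k t \<xi> w s - dN N w s) < \<epsilon> / 4" by blast
  have "sqnorm (\<lambda>w s. elementary_integrand k t \<xi> w s - d w s) < \<epsilon>"
    using sqnorm_triangle[OF elementary_sqint[OF e] dNi[of N] di] lt N by auto
  then show ?thesis using e by blast
qed

end

section \<open>Stochastic integrals\<close>

lemma set_integrable_if_sq_integrable:
  fixes h :: "real \<Rightarrow> 'a::{banach, second_countable_topology}"
  assumes [measurable]: "h \<in> borel_measurable borel"
    and h: "set_integrable lborel {0..1} (\<lambda>s. (norm (h s))\<^sup>2)"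
  shows "set_integrable lborel {0..1} h"
proof -
  have 1: "set_integrable lborel {0..1} (\<lambda>s::real. 1::real)"
    by (rule set_integrable_unit_bounded[of _ 1]) auto
  have 2: "set_integrable lborel {0..1} (\<lambda>s. (norm (h s))\<^sup>2 + 1)"
    by (rule set_integral_add(1)[OF h 1])
  show ?thesis
    unfolding set_integrable_def
  proof (rule Bochner_Integration.integrable_bound[OF 2[unfolded set_integrable_def]])
    show "AE s in lborel. norm (indicat_real {0..1} s *\<^sub>R h s)
      \<le> norm (indicat_real {0..1} s *\<^sub>R ((norm (h s))\<^sup>2 + 1))"
    proof (rule AE_I2)
      fix s
      have "2 * norm (h s) \<le> (norm (h s))\<^sup>2 + 1" using sum_squares_bound[of "norm (h s)" 1] by simp
      then have "norm (h s) \<le> (norm (h s))\<^sup>2 + 1" using norm_ge_zero[of "h s"] by linarith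
      then show "norm (indicat_real {0..1} s *\<^sub>R h s) \<le> norm (indicat_real {0..1} s *\<^sub>R ((norm (h s))\<^sup>2 + 1))"
        by (auto simp: indicator_def)
    qed
  qed measurable
qed

text \<open>The inequality \<open>2 * a * \<eta> \<le> a^2 + \<eta>^2\<close> applied under the
  integral. The free parameter \<eta> makes the bound smaller than \<eta> as soon as the energy is
  below its square.\<close>

lemma norm_integral_le_energy:
  fixes h :: "real \<Rightarrow> 'a::{banach, second_countable_topology}"
  assumes m [measurable]: "h \<in> borel_measurable borel"
    and h: "set_integrable lborel {0..1} (\<lambda>s. (norm (h s))\<^sup>2)"
    and s: "s \<in> {0..1}" and \<eta>: "0 < \<eta>"
  shows "norm (LINT r:{0..s}|lborel. h r) \<le> (energy h / \<eta> + \<eta>) / 2"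
proof -
  have hi: "set_integrable lborel {0..1} h" by (rule set_integrable_if_sq_integrable[OF m h])
  have hs: "set_integrable lborel {0..s} h"
    by (rule set_integrable_subset[OF hi]) (use s in auto)
  have c: "set_integrable lborel {0..1} (\<lambda>_::real. \<eta>)"
    by (rule set_integrable_unit_bounded[of _ \<eta>]) (use \<eta> in auto)
  have h': "set_integrable lborel {0..1} (\<lambda>r. (norm (h r))\<^sup>2 / \<eta>)"
    using h by simp
  have r: "set_integrable lborel {0..1} (\<lambda>r. ((norm (h r))\<^sup>2 / \<eta> + \<eta>) / 2)"
    using set_integral_add(1)[OF h' c] by simp
  have "norm (LINT r:{0..s}|lborel. h r) \<le> (LINT r:{0..s}|lborel. norm (h r))"
    by (rule set_integral_norm_bound[OF hs])
  also have "\<dots> \<le> (LINT r:{0..1}|lborel. ((norm (h r))\<^sup>2 / \<eta> + \<eta>) / 2)"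
    unfolding set_lebesgue_integral_def
  proof (rule integral_mono)
    show "integrable lborel (\<lambda>r. indicat_real {0..s} r *\<^sub>R norm (h r))"
      using set_integrable_norm[OF hs] by (simp add: set_integrable_def)
    show "integrable lborel (\<lambda>r. indicat_real {0..1} r *\<^sub>R (((norm (h r))\<^sup>2 / \<eta> + \<eta>) / 2))"
      using r by (simp add: set_integrable_def)
    fix r
    have "2 * norm (h r) * \<eta> \<le> (norm (h r))\<^sup>2 + \<eta>\<^sup>2" by (rule sum_squares_bound)
    then have "norm (h r) \<le> ((norm (h r))\<^sup>2 / \<eta> + \<eta>) / 2"
      using \<eta> by (simp add: field_simps power2_eq_square)
    moreover have "0 \<le> ((norm (h r))\<^sup>2 / \<eta> + \<eta>) / 2" using \<eta> by simp
    ultimately show "indicat_real {0..s} r *\<^sub>R norm (h r) \<le> indicat_real {0..1} r *\<^sub>R (((norm (h r))\<^sup>2 / \<eta> + \<eta>) / 2)"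
      using s by (auto simp: indicator_def)
  qed
  also have "\<dots> = ((LINT r:{0..1}|lborel. (norm (h r))\<^sup>2 / \<eta>) + (LINT r:{0..1::real}|lborel. \<eta>)) / 2"
    by (subst set_integral_divide_zero, subst set_integral_add(2)[OF h' c]) simp
  also have "\<dots> = (energy h / \<eta> + \<eta>) / 2"
    by (simp add: energy_def) (simp add: set_lebesgue_integral_def)
  finally show ?thesis .
qed

lemma time_integral_tendsto:
  fixes g :: "real \<Rightarrow> 'a::euclidean_space"
  assumes m [measurable]: "\<And>m. gm m \<in> borel_measurable borel" "g \<in> borel_measurable borel"
    and i: "\<And>m. set_integrable lborel {0..1} (\<lambda>s. (norm (gm m s))\<^sup>2)"
      "set_integrable lborel {0..1} (\<lambda>s. (norm (g s))\<^sup>2)"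
    and di: "\<And>m. set_integrable lborel {0..1} (\<lambda>s. (norm (gm m s - g s))\<^sup>2)"
    and lim: "(\<lambda>m. energy (\<lambda>s. gm m s - g s)) \<longlonglongrightarrow> 0" and s: "s \<in> {0..1}"
  shows "(\<lambda>m. LINT r:{0..s}|lborel. gm m r) \<longlonglongrightarrow> (LINT r:{0..s}|lborel. g r)"
proof (rule LIMSEQ_I)
  fix \<eta> :: real assume \<eta>: "0 < \<eta>"
  obtain N where N: "\<And>m. m \<ge> N \<Longrightarrow> norm (energy (\<lambda>s. gm m s - g s) - 0) < \<eta>\<^sup>2"
    using LIMSEQ_D[OF lim, of "\<eta>\<^sup>2"] \<eta> by auto
  show "\<exists>no. \<forall>m\<ge>no. norm ((LINT r:{0..s}|lborel. gm m r) - (LINT r:{0..s}|lborel. g r)) < \<eta>"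
  proof (intro exI allI impI)
    fix m assume "N \<le> m"
    then have "energy (\<lambda>s. gm m s - g s) < \<eta>\<^sup>2" using N[of m] by simp
    then have "energy (\<lambda>s. gm m s - g s) / \<eta> < \<eta>"
      using \<eta> by (simp add: divide_less_eq power2_eq_square)
    moreover have "norm (LINT r:{0..s}|lborel. gm m r - g r) \<le> (energy (\<lambda>s. gm m s - g s) / \<eta> + \<eta>) / 2"
      by (rule norm_integral_le_energy[OF _ di s \<eta>]) measurable
    moreover have "(LINT r:{0..s}|lborel. gm m r - g r) = (LINT r:{0..s}|lborel. gm m r) - (LINT r:{0..s}|lborel. g r)"
      by (rule set_integral_diff(2); rule set_integrable_subset[of _ "{0..1}"])
         (use s i in \<open>auto intro: set_integrable_if_sq_integrable\<close>)
    ultimately show "norm ((LINT r:{0..s}|lborel. gm m r) - (LINT r:{0..s}|lborel. g r)) < \<eta>"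
      by simp
  qed
qed

lemma norm_sq_diff_le:
  fixes a b :: "'a::real_inner"
  assumes "0 < \<eta>"
  shows "\<bar>(norm a)\<^sup>2 - (norm b)\<^sup>2\<bar> \<le> (1 + 1 / \<eta>) * (norm (a - b))\<^sup>2 + \<eta> * (norm b)\<^sup>2"
proof -
  have "(norm a)\<^sup>2 - (norm b)\<^sup>2 = (norm (a - b))\<^sup>2 + 2 * ((a - b) \<bullet> b)"
    by (simp add: power2_norm_eq_inner inner_diff inner_commute algebra_simps)
  moreover have "2 * \<bar>(a - b) \<bullet> b\<bar> \<le> (norm (a - b))\<^sup>2 / \<eta> + \<eta> * (norm b)\<^sup>2"
  proof -
    have "2 * norm (a - b) * (\<eta> * norm b) \<le> (norm (a - b))\<^sup>2 + (\<eta> * norm b)\<^sup>2" by (rule sum_squares_bound)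
    then have "2 * (norm (a - b) * norm b) \<le> (norm (a - b))\<^sup>2 / \<eta> + \<eta> * (norm b)\<^sup>2"
      using assms by (simp add: field_simps power2_eq_square)
    then show ?thesis using Cauchy_Schwarz_ineq2[of "a - b" b] by linarith
  qed
  moreover have "(1 + 1 / \<eta>) * (norm (a - b))\<^sup>2 = (norm (a - b))\<^sup>2 + (norm (a - b))\<^sup>2 / \<eta>"
    by (simp add: distrib_right)
  moreover have "0 \<le> (norm (a - b))\<^sup>2" by simp
  ultimately show ?thesis by linarith
qed

lemma energy_tendsto:
  fixes g :: "real \<Rightarrow> 'a::euclidean_space"
  assumes i: "\<And>m. set_integrable lborel {0..1} (\<lambda>s. (norm (gm m s))\<^sup>2)"
      "set_integrable lborel {0..1} (\<lambda>s. (norm (g s))\<^sup>2)"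
    and di: "\<And>m. set_integrable lborel {0..1} (\<lambda>s. (norm (gm m s - g s))\<^sup>2)"
    and lim: "(\<lambda>m. energy (\<lambda>s. gm m s - g s)) \<longlonglongrightarrow> 0"
  shows "(\<lambda>m. energy (gm m)) \<longlonglongrightarrow> energy g"
proof (rule LIMSEQ_I)
  fix r :: real assume r: "0 < r"
  \<comment> \<open>Chosen so that the term proportional to the energy of g stays below r/2; the
    added 1 covers zero energy.\<close>
  define \<eta> where "\<eta> = r / (2 * (energy g + 1))"
  have e0: "0 \<le> energy g" by (rule energy_nonneg)
  have \<eta>: "0 < \<eta>" using r e0 by (simp add: \<eta>_def)
  have \<eta>g: "\<eta> * energy g \<le> r / 2"
    using e0 r by (simp add: \<eta>_def field_simps)
  have le: "\<bar>energy (gm m) - energy g\<bar> \<le> (1 + 1 / \<eta>) * energy (\<lambda>s. gm m s - g s) + \<eta> * energy g" for m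
  proof -
    have "energy (gm m) - energy g = (LINT s:{0..1}|lborel. (norm (gm m s))\<^sup>2 - (norm (g s))\<^sup>2)"
      unfolding energy_def by (rule set_integral_diff(2)[symmetric, OF i])
    then have "\<bar>energy (gm m) - energy g\<bar> \<le> (LINT s:{0..1}|lborel. \<bar>(norm (gm m s))\<^sup>2 - (norm (g s))\<^sup>2\<bar>)"
      using set_integral_norm_bound[OF set_integral_diff(1)[OF i(1)[of m] i(2)]] by simp
    also have "\<dots> \<le> (LINT s:{0..1}|lborel. (1 + 1 / \<eta>) * (norm (gm m s - g s))\<^sup>2 + \<eta> * (norm (g s))\<^sup>2)"
    proof (rule set_integral_mono)
      show "set_integrable lborel {0..1} (\<lambda>s. \<bar>(norm (gm m s))\<^sup>2 - (norm (g s))\<^sup>2\<bar>)"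
        by (rule set_integrable_abs[OF set_integral_diff(1)[OF i]])
      show "set_integrable lborel {0..1} (\<lambda>s. (1 + 1 / \<eta>) * (norm (gm m s - g s))\<^sup>2 + \<eta> * (norm (g s))\<^sup>2)"
        by (intro set_integral_add(1) set_integrable_mult_right di i)
    qed (rule norm_sq_diff_le[OF \<eta>])
    also have "\<dots> = (1 + 1 / \<eta>) * energy (\<lambda>s. gm m s - g s) + \<eta> * energy g"
      unfolding energy_def
      by (subst set_integral_add(2)) (auto intro!: set_integrable_mult_right di i simp del: set_integrable_mult_right_iff)
    finally show ?thesis .
  qed
  have "(\<lambda>m. (1 + 1 / \<eta>) * energy (\<lambda>s. gm m s - g s)) \<longlonglongrightarrow> (1 + 1 / \<eta>) * 0"
    by (intro tendsto_mult tendsto_const lim)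
  then obtain N where N: "\<And>m. m \<ge> N \<Longrightarrow> norm ((1 + 1 / \<eta>) * energy (\<lambda>s. gm m s - g s) - 0) < r / 2"
    using LIMSEQ_D[of "\<lambda>m. (1 + 1 / \<eta>) * energy (\<lambda>s. gm m s - g s)" 0 "r / 2"] r by auto
  show "\<exists>no. \<forall>m\<ge>no. norm (energy (gm m) - energy g) < r"
  proof (intro exI allI impI)
    fix m assume "N \<le> m"
    then have "(1 + 1 / \<eta>) * energy (\<lambda>s. gm m s - g s) < r / 2" using N[of m] by auto
    then show "norm (energy (gm m) - energy g) < r"
      using le[of m] \<eta>g unfolding real_norm_def by linarith
  qed
qed

section \<open>The stochastic integral: existence, mean, locality, Girsanov inequality\<close>

context brownian_filtration
begin

lemma expectation_sq_le:
  fixes Y :: "'n path \<Rightarrow> real"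
  assumes Y: "Y \<in> borel_measurable M" and i: "integrable M (\<lambda>w. (Y w)\<^sup>2)"
  shows "(\<integral> w. Y w \<partial>M)\<^sup>2 \<le> (\<integral> w. (Y w)\<^sup>2 \<partial>M)"
  using variance_eq[OF integrable_if_sq_integrable[OF Y i] i] variance_positive[of Y] by linarith

text \<open>\<open>ito_prob\<close> is \<^const>\<open>is_ito_integral\<close> with a jointly measurable integrand \<open>d\<close> in place of the
  pathwise chosen \<^const>\<open>cm_deriv\<close>, which need not be jointly measurable.\<close>

definition ito_L2 :: "('n path \<Rightarrow> real \<Rightarrow> real^'n) \<Rightarrow> ('n path \<Rightarrow> real) \<Rightarrow> bool" where
  "ito_L2 d X \<longleftrightarrow> X \<in> borel_measurable M \<and> (\<exists>k t \<xi>. (\<forall>m. elementary (k m) (t m) (\<xi> m)) \<and>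
     (\<lambda>m. sqnorm (\<lambda>w s. elementary_integrand (k m) (t m) (\<xi> m) w s - d w s)) \<longlonglongrightarrow> 0 \<and>
     (\<forall>m. integrable M (\<lambda>w. (elementary_integral \<beta> (k m) (t m) (\<xi> m) w - X w)\<^sup>2)) \<and>
     (\<lambda>m. \<integral> w. (elementary_integral \<beta> (k m) (t m) (\<xi> m) w - X w)\<^sup>2 \<partial>M) \<longlonglongrightarrow> 0)"

definition ito_prob :: "('n path \<Rightarrow> real \<Rightarrow> real^'n) \<Rightarrow> ('n path \<Rightarrow> real) \<Rightarrow> bool" where
  "ito_prob d X \<longleftrightarrow> X \<in> borel_measurable M \<and> (\<exists>k t \<xi>. (\<forall>m. elementary (k m) (t m) (\<xi> m)) \<and>
     tendsto_in_prob M (\<lambda>m w. energy (\<lambda>s. elementary_integrand (k m) (t m) (\<xi> m) w s - d w s)) (\<lambda>w. 0) \<and>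
     tendsto_in_prob M (\<lambda>m. elementary_integral \<beta> (k m) (t m) (\<xi> m)) X)"

text \<open>Integrals of approximating elementary integrands are Cauchy in L2, hence in L1, so a
  subsequence converges almost surely. Its limit is X, and Fatou upgrades the convergence to
  L2.\<close>

lemma ito_L2_exists:
  assumes d: "sq_adapted d"
  obtains X where "ito_L2 d X"
proof -
  have di: "sqint d" using d by (simp add: sq_adapted_def)
  \<comment> \<open>Bundling the three components into one tuple allows a single use of
    choice.\<close>
  have "\<forall>m. \<exists>z. elementary (fst z) (fst (snd z)) (snd (snd z)) \<and>
    sqnorm (\<lambda>w s. elementary_integrand (fst z) (fst (snd z)) (snd (snd z)) w s - d w s) < 1 / real (Suc m)"
  proof
    fix m
    obtain k t \<xi> where "elementary k t \<xi>" "sqnorm (\<lambda>w s. elementary_integrand k t \<xi> w s - d w s) < 1 / real (Suc m)"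
      using elementary_approx[OF d, of "1 / real (Suc m)"] by auto
    then show "\<exists>z. elementary (fst z) (fst (snd z)) (snd (snd z)) \<and>
      sqnorm (\<lambda>w s. elementary_integrand (fst z) (fst (snd z)) (snd (snd z)) w s - d w s) < 1 / real (Suc m)"
      by (intro exI[of _ "(k, t, \<xi>)"]) simp
  qed
  from choice[OF this] obtain z where "\<forall>m. elementary (fst (z m)) (fst (snd (z m))) (snd (snd (z m))) \<and>
    sqnorm (\<lambda>w s. elementary_integrand (fst (z m)) (fst (snd (z m))) (snd (snd (z m))) w s - d w s) < 1 / real (Suc m)" ..
  then have z: "\<And>m. elementary (fst (z m)) (fst (snd (z m))) (snd (snd (z m)))"
    "\<And>m. sqnorm (\<lambda>w s. elementary_integrand (fst (z m)) (fst (snd (z m))) (snd (snd (z m))) w s - d w s) < 1 / real (Suc m)"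
    by blast+
  define I where "I m = elementary_integral \<beta> (fst (z m)) (fst (snd (z m))) (snd (snd (z m)))" for m
  define G where "G m = elementary_integrand (fst (z m)) (fst (snd (z m))) (snd (snd (z m)))" for m
  define a where "a m = sqnorm (\<lambda>w s. G m w s - d w s)" for m
  define C where "C = real CARD('n)"
  have C0: "0 \<le> C" by (simp add: C_def)
  have a1: "a m < 1 / real (Suc m)" for m using z(2)[of m] by (simp add: a_def G_def)
  have Gi: "sqint (G m)" for m unfolding G_def by (rule elementary_sqint[OF z(1)])
  have Im [measurable]: "I m \<in> borel_measurable M" for m
    unfolding I_def by (rule elementary_integral_measurable_M[OF z(1)])
  have Ii: "integrable M (I m)" for m unfolding I_def by (rule elementary_integral_integrable[OF z(1)])
  have Di: "integrable M (\<lambda>w. (I m w - I l w)\<^sup>2)" for m l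
    unfolding I_def by (rule elementary_integral_diff_sq(1)[OF z(1) z(1)])
  have D: "(\<integral> w. (I m w - I l w)\<^sup>2 \<partial>M) \<le> C * (2 * a m + 2 * a l)" for m l
  proof -
    have "(\<integral> w. (I m w - I l w)\<^sup>2 \<partial>M) \<le> C * sqnorm (\<lambda>w s. G m w s - G l w s)"
      unfolding I_def G_def C_def by (rule elementary_integral_diff_sq(2)[OF z(1) z(1)])
    also have "\<dots> \<le> C * (2 * a m + 2 * a l)"
      unfolding a_def by (intro mult_left_mono C0 sqnorm_triangle Gi di)
    finally show ?thesis .
  qed
  have small: "1 / real (Suc m) \<le> 1 / real (Suc n)" if "n \<le> m" for m n
    using that by (intro divide_left_mono) auto
  \<comment> \<open>Two errors of size at most 1/(n+1), each doubled by
    \<open>sqnorm_triangle\<close>, give the constant 4.\<close>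
  have D': "(\<integral> w. (I m w - I l w)\<^sup>2 \<partial>M) \<le> C * (4 / real (Suc n))" if "n \<le> m" "n \<le> l" for m l n
    using a1[of m] a1[of l] small[OF that(1)] small[OF that(2)]
    by (intro order_trans[OF D] mult_left_mono C0) simp
  obtain r where r: "strict_mono r" "AE w in M. Cauchy (\<lambda>i. I (r i) w)"
  proof (rule cauchy_L1_AE_cauchy_subseq[where s = I and M = M])
    fix e :: real assume e: "0 < e"
    obtain N where N: "C * 4 / e\<^sup>2 < real N" using reals_Archimedean2 by blast
    show "\<exists>N. \<forall>i\<ge>N. \<forall>j\<ge>N. (\<integral> w. norm (I i w - I j w) \<partial>M) < e"
    proof (intro exI allI impI)
      fix i j assume ij: "N \<le> i" "N \<le> j"
      have "(\<integral> w. norm (I i w - I j w) \<partial>M)\<^sup>2 \<le> (\<integral> w. (norm (I i w - I j w))\<^sup>2 \<partial>M)"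
        using Di[of i j] by (intro expectation_sq_le) auto
      also have "\<dots> \<le> C * (4 / real (Suc N))" using D'[OF ij] by simp
      also have "\<dots> < e\<^sup>2"
      proof -
        have "C * 4 < real N * e\<^sup>2" using N e by (simp add: field_simps)
        moreover have "real N * e\<^sup>2 \<le> real (Suc N) * e\<^sup>2" by (intro mult_right_mono) auto
        ultimately have "C * 4 < real (Suc N) * e\<^sup>2" by linarith
        then show ?thesis by (simp add: divide_less_eq mult.commute del: of_nat_Suc)
      qed
      finally show "(\<integral> w. norm (I i w - I j w) \<partial>M) < e"
        by (rule power_less_imp_less_base) (use e in simp)
    qed
  qed (use Ii in auto)
  define X where "X w = lim (\<lambda>i. I (r i) w)" for w
  have Xm [measurable]: "X \<in> borel_measurable M" unfolding X_def by measurable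
  have lim: "AE w in M. (\<lambda>i. I (r i) w) \<longlonglongrightarrow> X w"
    using r(2) unfolding X_def by eventually_elim (simp add: Cauchy_convergent_iff convergent_LIMSEQ_iff)
  have rn: "n \<le> r n" for n using seq_suble[OF r(1)] .
  \<comment> \<open>Fatou in the index l: the squared distance to the limit X is at most the limit
    inferior of the squared distances to later members of the sequence.\<close>
  have le: "(\<integral>\<^sup>+ w. ennreal ((I (r m) w - X w)\<^sup>2) \<partial>M) \<le> ennreal (C * (4 / real (Suc m)))" for m
  proof -
    have "(\<integral>\<^sup>+ w. ennreal ((I (r m) w - X w)\<^sup>2) \<partial>M) = (\<integral>\<^sup>+ w. liminf (\<lambda>l. ennreal ((I (r m) w - I (r l) w)\<^sup>2)) \<partial>M)"
    proof (rule nn_integral_cong_AE)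
      show "AE w in M. ennreal ((I (r m) w - X w)\<^sup>2) = liminf (\<lambda>l. ennreal ((I (r m) w - I (r l) w)\<^sup>2))"
        using lim
      proof eventually_elim
        case (elim w)
        have "(\<lambda>l. ennreal ((I (r m) w - I (r l) w)\<^sup>2)) \<longlonglongrightarrow> ennreal ((I (r m) w - X w)\<^sup>2)"
          by (intro tendsto_ennrealI tendsto_power tendsto_diff tendsto_const elim)
        then show ?case by (rule lim_imp_Liminf[OF sequentially_bot, symmetric])
      qed
    qed
    also have "\<dots> \<le> liminf (\<lambda>l. \<integral>\<^sup>+ w. ennreal ((I (r m) w - I (r l) w)\<^sup>2) \<partial>M)"
      by (rule nn_integral_liminf) measurable
    also have "\<dots> \<le> limsup (\<lambda>l. \<integral>\<^sup>+ w. ennreal ((I (r m) w - I (r l) w)\<^sup>2) \<partial>M)"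
      by (rule Liminf_le_Limsup) simp
    also have "\<dots> \<le> ennreal (C * (4 / real (Suc m)))"
    proof (rule Limsup_bounded)
      show "\<forall>\<^sub>F l in sequentially. (\<integral>\<^sup>+ w. ennreal ((I (r m) w - I (r l) w)\<^sup>2) \<partial>M) \<le> ennreal (C * (4 / real (Suc m)))"
        using eventually_ge_at_top[of m]
      proof eventually_elim
        case (elim l)
        have "(\<integral>\<^sup>+ w. ennreal ((I (r m) w - I (r l) w)\<^sup>2) \<partial>M) = ennreal (\<integral> w. (I (r m) w - I (r l) w)\<^sup>2 \<partial>M)"
          by (rule nn_integral_eq_integral[OF Di]) simp
        also have "\<dots> \<le> ennreal (C * (4 / real (Suc m)))"
          using D'[of m "r m" "r l"] rn[of m] rn[of l] elim by (intro ennreal_leI) auto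
        finally show ?case .
      qed
    qed
    finally show ?thesis .
  qed
  have XI: "integrable M (\<lambda>w. (I (r m) w - X w)\<^sup>2)" for m
    using order_le_less_trans[OF le[of m] ennreal_less_top]
    by (intro integrableI_bounded) auto
  have le': "(\<integral> w. (I (r m) w - X w)\<^sup>2 \<partial>M) \<le> C * (4 / real (Suc m))" for m
  proof -
    have "(\<integral>\<^sup>+ w. ennreal ((I (r m) w - X w)\<^sup>2) \<partial>M) = ennreal (\<integral> w. (I (r m) w - X w)\<^sup>2 \<partial>M)"
      by (rule nn_integral_eq_integral[OF XI]) simp
    then have "ennreal (\<integral> w. (I (r m) w - X w)\<^sup>2 \<partial>M) \<le> ennreal (C * (4 / real (Suc m)))"
      using le[of m] by (simp del: of_nat_Suc)
    then show ?thesis by (subst (asm) ennreal_le_iff) (auto simp: C0)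
  qed
  have "ito_L2 d X"
    unfolding ito_L2_def
  proof (intro conjI exI allI)
    show "elementary (fst (z (r m))) (fst (snd (z (r m)))) (snd (snd (z (r m))))" for m by (rule z(1))
    show "integrable M (\<lambda>w. (elementary_integral \<beta> (fst (z (r m))) (fst (snd (z (r m)))) (snd (snd (z (r m)))) w - X w)\<^sup>2)" for m
      using XI[of m] by (simp add: I_def)
    have "(\<lambda>m. C * 4 * inverse (real (Suc m))) \<longlonglongrightarrow> C * 4 * 0"
      by (intro tendsto_mult tendsto_const LIMSEQ_inverse_real_of_nat)
    then have l0: "(\<lambda>m. C * (4 / real (Suc m))) \<longlonglongrightarrow> 0" by (simp add: divide_inverse mult.assoc)
    have "(\<lambda>m. \<integral> w. (I (r m) w - X w)\<^sup>2 \<partial>M) \<longlonglongrightarrow> 0"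
      by (rule tendsto_sandwich[OF _ _ tendsto_const l0]) (use le' in \<open>auto simp del: of_nat_Suc\<close>)
    then show "(\<lambda>m. \<integral> w. (elementary_integral \<beta> (fst (z (r m))) (fst (snd (z (r m)))) (snd (snd (z (r m)))) w - X w)\<^sup>2 \<partial>M) \<longlonglongrightarrow> 0"
      by (simp add: I_def)
    have "(\<lambda>m. a m) \<longlonglongrightarrow> 0"
    proof (rule tendsto_sandwich[OF _ _ tendsto_const LIMSEQ_inverse_real_of_nat])
      show "\<forall>\<^sub>F m in sequentially. 0 \<le> a m" by (simp add: a_def sqnorm_nonneg)
      show "\<forall>\<^sub>F m in sequentially. a m \<le> inverse (real (Suc m))"
        using a1 by (intro always_eventually allI) (simp add: inverse_eq_divide less_imp_le)
    qed
    then have "(\<lambda>m. a (r m)) \<longlonglongrightarrow> 0" using LIMSEQ_subseq_LIMSEQ[OF _ r(1), of a 0] by (simp add: o_def)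
    then show "(\<lambda>m. sqnorm (\<lambda>w s. elementary_integrand (fst (z (r m))) (fst (snd (z (r m)))) (snd (snd (z (r m)))) w s - d w s)) \<longlonglongrightarrow> 0"
      by (simp add: a_def G_def)
  qed fact
  then show ?thesis by (rule that)
qed

text \<open>Elementary integrals have mean zero, and by Jensen the squared mean of the difference to
  X is at most its second moment, which tends to 0.\<close>

lemma ito_L2_expectation:
  assumes "ito_L2 d X"
  shows "integrable M X" "(\<integral> w. X w \<partial>M) = 0"
proof -
  obtain k t \<xi> where Xm [measurable]: "X \<in> borel_measurable M" and e: "\<And>m. elementary (k m) (t m) (\<xi> m)"
    and i: "\<And>m. integrable M (\<lambda>w. (elementary_integral \<beta> (k m) (t m) (\<xi> m) w - X w)\<^sup>2)"
    and l: "(\<lambda>m. \<integral> w. (elementary_integral \<beta> (k m) (t m) (\<xi> m) w - X w)\<^sup>2 \<partial>M) \<longlonglongrightarrow> 0"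
    using assms unfolding ito_L2_def by blast
  let ?I = "\<lambda>m. elementary_integral \<beta> (k m) (t m) (\<xi> m)"
  have Im [measurable]: "?I m \<in> borel_measurable M" for m by (rule elementary_integral_measurable_M[OF e])
  have Ii: "integrable M (?I m)" for m by (rule elementary_integral_integrable[OF e])
  have Di: "integrable M (\<lambda>w. ?I m w - X w)" for m
    by (rule integrable_if_sq_integrable[OF _ i]) measurable
  show Xi: "integrable M X"
    using Bochner_Integration.integrable_diff[OF Ii[of 0] Di[of 0]] by simp
  have "(\<integral> w. X w \<partial>M)\<^sup>2 \<le> (\<integral> w. (?I m w - X w)\<^sup>2 \<partial>M)" for m
  proof -
    have "(\<integral> w. ?I m w - X w \<partial>M) = - (\<integral> w. X w \<partial>M)"
      using Ii Xi elementary_integral_expectation[OF e] by (subst Bochner_Integration.integral_diff) auto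
    then show ?thesis
      using expectation_sq_le[OF _ i[of m]] by (simp add: power2_eq_square)
  qed
  then have "(\<integral> w. X w \<partial>M)\<^sup>2 \<le> 0"
    using l by (intro LIMSEQ_le_const[OF l]) auto
  then show "(\<integral> w. X w \<partial>M) = 0" by simp
qed

lemma tendsto_in_prob_L1:
  fixes Z :: "nat \<Rightarrow> 'n path \<Rightarrow> real"
  assumes Z: "\<And>m. integrable M (Z m)" "\<And>m w. 0 \<le> Z m w" and lim: "(\<lambda>m. \<integral> w. Z m w \<partial>M) \<longlonglongrightarrow> 0"
    and \<epsilon>: "0 < \<epsilon>"
  shows "(\<lambda>m. prob {w\<in>space M. \<epsilon> < Z m w}) \<longlonglongrightarrow> 0"
proof (rule tendsto_sandwich[OF _ _ tendsto_const])
  show "(\<lambda>m. (\<integral> w. Z m w \<partial>M) / \<epsilon>) \<longlonglongrightarrow> 0"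
    using tendsto_divide[OF lim tendsto_const[of \<epsilon>]] \<epsilon> by simp
  show "\<forall>\<^sub>F m in sequentially. prob {w\<in>space M. \<epsilon> < Z m w} \<le> (\<integral> w. Z m w \<partial>M) / \<epsilon>"
  proof (intro always_eventually allI)
    fix m
    note [measurable] = borel_measurable_integrable[OF Z(1)[of m]]
    have "prob {w\<in>space M. \<epsilon> < Z m w} \<le> prob {w\<in>space M. \<epsilon> \<le> Z m w}"
      by (intro finite_measure_mono) auto
    also have "\<dots> \<le> (\<integral> w. Z m w \<partial>M) / \<epsilon>"
      using Z \<epsilon> by (intro integral_Markov_inequality_measure[where A="{}"]) auto
    finally show "prob {w\<in>space M. \<epsilon> < Z m w} \<le> (\<integral> w. Z m w \<partial>M) / \<epsilon>" .
  qed
qed auto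

text \<open>Convergence in L2 gives moments, but \<open>is_ito_integral\<close> and the locality
  argument speak of convergence in probability; Markov's inequality links the two.\<close>

lemma ito_L2_imp_prob:
  assumes X: "ito_L2 d X" and di: "sqint d"
  shows "ito_prob d X"
proof -
  obtain k t \<xi> where Xm [measurable]: "X \<in> borel_measurable M" and e: "\<And>m. elementary (k m) (t m) (\<xi> m)"
    and s: "(\<lambda>m. sqnorm (\<lambda>w s. elementary_integrand (k m) (t m) (\<xi> m) w s - d w s)) \<longlonglongrightarrow> 0"
    and i: "\<And>m. integrable M (\<lambda>w. (elementary_integral \<beta> (k m) (t m) (\<xi> m) w - X w)\<^sup>2)"
    and l: "(\<lambda>m. \<integral> w. (elementary_integral \<beta> (k m) (t m) (\<xi> m) w - X w)\<^sup>2 \<partial>M) \<longlonglongrightarrow> 0"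
    using X unfolding ito_L2_def by blast
  have sd: "sqint (\<lambda>w s. elementary_integrand (k m) (t m) (\<xi> m) w s - d w s)" for m
    by (rule sqint_diff(1)[OF elementary_sqint[OF e] di])
  show ?thesis
    unfolding ito_prob_def tendsto_in_prob_def
  proof (intro conjI exI allI impI)
    fix \<epsilon> :: real assume \<epsilon>: "0 < \<epsilon>"
    have "(\<lambda>m. prob {w\<in>space M. \<epsilon> < energy (\<lambda>s. elementary_integrand (k m) (t m) (\<xi> m) w s - d w s)}) \<longlonglongrightarrow> 0"
      using s by (intro tendsto_in_prob_L1 sqint_energy(1)[OF sd] energy_nonneg \<epsilon>) (simp add: sqint_energy(2)[OF sd])
    then show "(\<lambda>m. prob {w\<in>space M. \<epsilon> < \<bar>energy (\<lambda>s. elementary_integrand (k m) (t m) (\<xi> m) w s - d w s) - 0\<bar>}) \<longlonglongrightarrow> 0"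
      by (simp add: energy_nonneg)
    have "(\<lambda>m. prob {w\<in>space M. \<epsilon>\<^sup>2 < (elementary_integral \<beta> (k m) (t m) (\<xi> m) w - X w)\<^sup>2}) \<longlonglongrightarrow> 0"
      using \<epsilon> by (intro tendsto_in_prob_L1 i l) auto
    moreover have "\<epsilon>\<^sup>2 < x\<^sup>2 \<longleftrightarrow> \<epsilon> < \<bar>x\<bar>" for x :: real
      using abs_le_square_iff[of x \<epsilon>] \<epsilon> by (auto simp: not_le[symmetric])
    ultimately show "(\<lambda>m. prob {w\<in>space M. \<epsilon> < \<bar>elementary_integral \<beta> (k m) (t m) (\<xi> m) w - X w\<bar>}) \<longlonglongrightarrow> 0"
      by simp
  qed (use e in auto)
qed

lemma time_integral_measurable_M:
  fixes G :: "'n path \<Rightarrow> real \<Rightarrow> real^'n"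
  assumes [measurable]: "(\<lambda>(w, s). G w s) \<in> borel_measurable (M \<Otimes>\<^sub>M lborel)"
  shows "(\<lambda>w. LINT r:{0..s}|lborel. G w r) \<in> borel_measurable M"
  unfolding set_lebesgue_integral_def
  by (rule lborel.borel_measurable_lebesgue_integral) measurable

lemma energy_diff_le:
  fixes a b :: "real \<Rightarrow> real^'n"
  assumes a: "set_integrable lborel {0..1} (\<lambda>s. (norm (a s))\<^sup>2)"
    and b: "set_integrable lborel {0..1} (\<lambda>s. (norm (b s))\<^sup>2)"
    and c: "set_integrable lborel {0..1} (\<lambda>s. (norm (c s))\<^sup>2)"
    and eq: "AE s in lborel. s \<in> {0..1} \<longrightarrow> c s = a s - b s"
  shows "energy c \<le> 2 * energy a + 2 * energy b"
proof -
  have i: "set_integrable lborel {0..1} (\<lambda>s. 2 * (norm (a s))\<^sup>2 + 2 * (norm (b s))\<^sup>2)"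
    by (intro set_integral_add(1) set_integrable_mult_right a b)
  have "energy c \<le> (LINT s:{0..1}|lborel. 2 * (norm (a s))\<^sup>2 + 2 * (norm (b s))\<^sup>2)"
    unfolding energy_def
  proof (rule set_integral_mono_AE[OF c i])
    show "AE s\<in>{0..1} in lborel. (norm (c s))\<^sup>2 \<le> 2 * (norm (a s))\<^sup>2 + 2 * (norm (b s))\<^sup>2"
      using eq by eventually_elim (auto intro: norm_diff_sq_le)
  qed
  also have "\<dots> = 2 * energy a + 2 * energy b"
    unfolding energy_def
    by (subst set_integral_add(2)) (auto intro!: set_integrable_mult_right a b simp del: set_integrable_mult_right_iff)
  finally show ?thesis .
qed

text \<open>Differences of approximants are elementary, and on A their energy is at most twice the
  sum of the two approximation errors, since d and d' agree there. The Lenglart bound turns small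
  energy on A into a small integral on A. Taking A to be the whole space gives uniqueness of the
  integral.\<close>

lemma ito_prob_local:
  assumes X: "ito_prob d X" and X': "ito_prob d' X'" and d: "sqint d" and d': "sqint d'"
    and A: "A \<in> sets M"
    and eq: "AE w in M. w \<in> A \<longrightarrow> (AE s in lborel. s \<in> {0..1} \<longrightarrow> d w s = d' w s)"
  shows "AE w in M. w \<in> A \<longrightarrow> X w = X' w"
proof -
  obtain k t \<xi> where Xm: "X \<in> borel_measurable M" and e: "\<And>m. elementary (k m) (t m) (\<xi> m)"
    and E: "tendsto_in_prob M (\<lambda>m w. energy (\<lambda>s. elementary_integrand (k m) (t m) (\<xi> m) w s - d w s)) (\<lambda>w. 0)"
    and I: "tendsto_in_prob M (\<lambda>m. elementary_integral \<beta> (k m) (t m) (\<xi> m)) X"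
    using X unfolding ito_prob_def by blast
  obtain k' t' \<xi>' where Xm': "X' \<in> borel_measurable M" and e': "\<And>m. elementary (k' m) (t' m) (\<xi>' m)"
    and E': "tendsto_in_prob M (\<lambda>m w. energy (\<lambda>s. elementary_integrand (k' m) (t' m) (\<xi>' m) w s - d' w s)) (\<lambda>w. 0)"
    and I': "tendsto_in_prob M (\<lambda>m. elementary_integral \<beta> (k' m) (t' m) (\<xi>' m)) X'"
    using X' unfolding ito_prob_def by blast
  note [measurable] = Xm Xm' A
  let ?I = "\<lambda>m. elementary_integral \<beta> (k m) (t m) (\<xi> m)"
  let ?I' = "\<lambda>m. elementary_integral \<beta> (k' m) (t' m) (\<xi>' m)"
  let ?D = "\<lambda>m w s. elementary_integrand (k m) (t m) (\<xi> m) w s - d w s"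
  let ?D' = "\<lambda>m w s. elementary_integrand (k' m) (t' m) (\<xi>' m) w s - d' w s"
  have [measurable]: "?I m \<in> borel_measurable M" "?I' m \<in> borel_measurable M" for m
    by (rule elementary_integral_measurable_M[OF e], rule elementary_integral_measurable_M[OF e'])
  have D: "sqint (?D m)" and D': "sqint (?D' m)" for m
    by (rule sqint_diff(1)[OF elementary_sqint[OF e] d], rule sqint_diff(1)[OF elementary_sqint[OF e'] d'])
  have [measurable]: "(\<lambda>w. energy (?D m w)) \<in> borel_measurable M" "(\<lambda>w. energy (?D' m w)) \<in> borel_measurable M" for m
    by (rule energy_measurable[OF sqint_measurable[OF D]], rule energy_measurable[OF sqint_measurable[OF D']])
  \<comment> \<open>If twice the sum of the two errors exceeds c, one of the errors exceeds
    c/4.\<close>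
  have diff: "prob {w\<in>A. \<epsilon> < \<bar>?I m w - ?I' m w\<bar>}
      \<le> prob {w\<in>space M. c / 4 < \<bar>energy (?D m w) - 0\<bar>} + prob {w\<in>space M. c / 4 < \<bar>energy (?D' m w) - 0\<bar>}
        + real CARD('n) * c / \<epsilon>\<^sup>2" if \<epsilon>: "0 < \<epsilon>" and c: "0 < c" for \<epsilon> c m
  proof -
    obtain k2 t2 \<xi>2 where e2: "elementary k2 t2 \<xi>2"
      and G2: "\<And>w s. elementary_integrand k2 t2 \<xi>2 w s
        = elementary_integrand (k m) (t m) (\<xi> m) w s - elementary_integrand (k' m) (t' m) (\<xi>' m) w s"
      and I2: "\<And>w. elementary_integral \<beta> k2 t2 \<xi>2 w = ?I m w - ?I' m w"
      using elementary_diff[OF e[of m] e'[of m]] by blast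
    have le: "AE w in M. w \<in> A \<longrightarrow> energy (elementary_integrand k2 t2 \<xi>2 w) \<le> 2 * energy (?D m w) + 2 * energy (?D' m w)"
      using eq sqint_energy(3)[OF D[of m]] sqint_energy(3)[OF D'[of m]] sqint_energy(3)[OF elementary_sqint[OF e2]]
    proof (eventually_elim, intro impI)
      fix w
      assume "w \<in> A \<longrightarrow> (AE s in lborel. s \<in> {0..1} \<longrightarrow> d w s = d' w s)" "w \<in> A"
      then have "AE s in lborel. s \<in> {0..1} \<longrightarrow> d w s = d' w s" by simp
      then have "AE s in lborel. s \<in> {0..1} \<longrightarrow> elementary_integrand k2 t2 \<xi>2 w s = ?D m w s - ?D' m w s"
        by eventually_elim (simp add: G2)
      then show "set_integrable lborel {0..1} (\<lambda>s. (norm (?D m w s))\<^sup>2) \<Longrightarrow>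
        set_integrable lborel {0..1} (\<lambda>s. (norm (?D' m w s))\<^sup>2) \<Longrightarrow>
        set_integrable lborel {0..1} (\<lambda>s. (norm (elementary_integrand k2 t2 \<xi>2 w s))\<^sup>2) \<Longrightarrow>
        energy (elementary_integrand k2 t2 \<xi>2 w) \<le> 2 * energy (?D m w) + 2 * energy (?D' m w)"
        by (intro energy_diff_le)
    qed
    note [measurable] = elementary_energy_measurable[OF e2]
    have "prob {w\<in>A. c < energy (elementary_integrand k2 t2 \<xi>2 w)}
      \<le> prob ({w\<in>space M. c / 4 < \<bar>energy (?D m w) - 0\<bar>} \<union> {w\<in>space M. c / 4 < \<bar>energy (?D' m w) - 0\<bar>})"
    proof (rule finite_measure_mono_AE)
      show "AE w in M. w \<in> {w\<in>A. c < energy (elementary_integrand k2 t2 \<xi>2 w)} \<longrightarrow>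
        w \<in> {w\<in>space M. c / 4 < \<bar>energy (?D m w) - 0\<bar>} \<union> {w\<in>space M. c / 4 < \<bar>energy (?D' m w) - 0\<bar>}"
        using le
      proof (eventually_elim, intro impI)
        fix w assume "w \<in> A \<longrightarrow> energy (elementary_integrand k2 t2 \<xi>2 w) \<le> 2 * energy (?D m w) + 2 * energy (?D' m w)"
          and w: "w \<in> {w\<in>A. c < energy (elementary_integrand k2 t2 \<xi>2 w)}"
        then have "c / 4 < energy (?D m w) \<or> c / 4 < energy (?D' m w)" by auto
        then show "w \<in> {w\<in>space M. c / 4 < \<bar>energy (?D m w) - 0\<bar>} \<union> {w\<in>space M. c / 4 < \<bar>energy (?D' m w) - 0\<bar>}"
          using w sets.sets_into_space[OF A] by (auto simp: energy_nonneg)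
      qed
    qed measurable
    also have "\<dots> \<le> prob {w\<in>space M. c / 4 < \<bar>energy (?D m w) - 0\<bar>} + prob {w\<in>space M. c / 4 < \<bar>energy (?D' m w) - 0\<bar>}"
      by (rule measure_Un_le) measurable
    finally show ?thesis
      using elementary_lenglart[OF e2 less_imp_le[OF c] \<epsilon> A] by (simp add: I2)
  qed
  have zero: "prob {w\<in>A. 3 * \<epsilon> < \<bar>X w - X' w\<bar>} = 0" if \<epsilon>: "0 < \<epsilon>" for \<epsilon>
  proof -
    \<comment> \<open>First m tends to infinity for fixed c, and afterwards c tends to 0; the factor
      3 in the event pays for the two approximation errors and the difference of the
      approximants.\<close>
    have le: "prob {w\<in>A. 3 * \<epsilon> < \<bar>X w - X' w\<bar>} \<le> real CARD('n) * c / \<epsilon>\<^sup>2" if c: "0 < c" for c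
    proof -
      let ?a = "\<lambda>m. prob {w\<in>space M. \<epsilon> < \<bar>?I m w - X w\<bar>} + prob {w\<in>space M. \<epsilon> < \<bar>?I' m w - X' w\<bar>} +
        (prob {w\<in>space M. c / 4 < \<bar>energy (?D m w) - 0\<bar>} + prob {w\<in>space M. c / 4 < \<bar>energy (?D' m w) - 0\<bar>}
          + real CARD('n) * c / \<epsilon>\<^sup>2)"
      have "?a \<longlonglongrightarrow> 0 + 0 + (0 + 0 + real CARD('n) * c / \<epsilon>\<^sup>2)"
      proof (intro tendsto_add tendsto_const)
        show "(\<lambda>m. prob {w\<in>space M. \<epsilon> < \<bar>?I m w - X w\<bar>}) \<longlonglongrightarrow> 0"
          using I \<epsilon> unfolding tendsto_in_prob_def by blast
        show "(\<lambda>m. prob {w\<in>space M. \<epsilon> < \<bar>?I' m w - X' w\<bar>}) \<longlonglongrightarrow> 0"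
          using I' \<epsilon> unfolding tendsto_in_prob_def by blast
        have c4: "0 < c / 4" using c by simp
        show "(\<lambda>m. prob {w\<in>space M. c / 4 < \<bar>energy (?D m w) - 0\<bar>}) \<longlonglongrightarrow> 0"
          using E c4 unfolding tendsto_in_prob_def by blast
        show "(\<lambda>m. prob {w\<in>space M. c / 4 < \<bar>energy (?D' m w) - 0\<bar>}) \<longlonglongrightarrow> 0"
          using E' c4 unfolding tendsto_in_prob_def by blast
      qed
      then have lim: "?a \<longlonglongrightarrow> real CARD('n) * c / \<epsilon>\<^sup>2" by simp
      have "prob {w\<in>A. 3 * \<epsilon> < \<bar>X w - X' w\<bar>} \<le> ?a m" for m
      proof -
        have "prob {w\<in>A. 3 * \<epsilon> < \<bar>X w - X' w\<bar>}
          \<le> prob ({w\<in>space M. \<epsilon> < \<bar>?I m w - X w\<bar>} \<union> {w\<in>space M. \<epsilon> < \<bar>?I' m w - X' w\<bar>} \<union> {w\<in>A. \<epsilon> < \<bar>?I m w - ?I' m w\<bar>})"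
        proof (intro finite_measure_mono subsetI)
          fix w assume "w \<in> {w\<in>A. 3 * \<epsilon> < \<bar>X w - X' w\<bar>}"
          moreover from this have "w \<in> space M" using sets.sets_into_space[OF A] by auto
          ultimately show "w \<in> {w\<in>space M. \<epsilon> < \<bar>?I m w - X w\<bar>} \<union> {w\<in>space M. \<epsilon> < \<bar>?I' m w - X' w\<bar>} \<union> {w\<in>A. \<epsilon> < \<bar>?I m w - ?I' m w\<bar>}"
            by (simp, linarith)
        qed measurable
        also have "\<dots> \<le> prob ({w\<in>space M. \<epsilon> < \<bar>?I m w - X w\<bar>} \<union> {w\<in>space M. \<epsilon> < \<bar>?I' m w - X' w\<bar>}) + prob {w\<in>A. \<epsilon> < \<bar>?I m w - ?I' m w\<bar>}"
          by (rule measure_Un_le) measurable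
        also have "\<dots> \<le> prob {w\<in>space M. \<epsilon> < \<bar>?I m w - X w\<bar>} + prob {w\<in>space M. \<epsilon> < \<bar>?I' m w - X' w\<bar>} + prob {w\<in>A. \<epsilon> < \<bar>?I m w - ?I' m w\<bar>}"
          by (intro add_right_mono measure_Un_le) measurable
        also have "\<dots> \<le> ?a m" by (intro add_left_mono diff \<epsilon> c)
        finally show ?thesis .
      qed
      then show ?thesis by (intro LIMSEQ_le_const[OF lim]) auto
    qed
    have "(\<lambda>n. real CARD('n) * inverse (real (Suc n)) / \<epsilon>\<^sup>2) \<longlonglongrightarrow> real CARD('n) * 0 / \<epsilon>\<^sup>2"
      using \<epsilon> by (intro tendsto_divide tendsto_mult tendsto_const LIMSEQ_inverse_real_of_nat) auto
    then have "prob {w\<in>A. 3 * \<epsilon> < \<bar>X w - X' w\<bar>} \<le> real CARD('n) * 0 / \<epsilon>\<^sup>2"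
      by (rule LIMSEQ_le_const) (intro exI[of _ 0] allI impI le, simp)
    then show ?thesis by (simp add: measure_le_0_iff)
  qed
  have "AE w in M. \<forall>n. w \<in> A \<longrightarrow> \<bar>X w - X' w\<bar> \<le> 3 * inverse (real (Suc n))"
    unfolding AE_all_countable
  proof
    fix n
    have "{w\<in>A. 3 * inverse (real (Suc n)) < \<bar>X w - X' w\<bar>} \<in> null_sets M"
      using zero[of "inverse (real (Suc n))"] by (intro null_setsI) (auto simp: emeasure_eq_measure)
    then have "AE w in M. w \<notin> {w\<in>A. 3 * inverse (real (Suc n)) < \<bar>X w - X' w\<bar>}" by (rule AE_not_in)
    then show "AE w in M. w \<in> A \<longrightarrow> \<bar>X w - X' w\<bar> \<le> 3 * inverse (real (Suc n))"
      by eventually_elim auto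
  qed
  then show ?thesis
  proof (eventually_elim, intro impI)
    fix w assume *: "\<forall>n. w \<in> A \<longrightarrow> \<bar>X w - X' w\<bar> \<le> 3 * inverse (real (Suc n))" and "w \<in> A"
    have "(\<lambda>n. 3 * inverse (real (Suc n))) \<longlonglongrightarrow> 3 * 0"
      by (intro tendsto_mult tendsto_const LIMSEQ_inverse_real_of_nat)
    then have "\<bar>X w - X' w\<bar> \<le> 3 * 0"
      by (rule LIMSEQ_le_const) (use * \<open>w \<in> A\<close> in blast)
    then show "X w = X' w" by simp
  qed
qed

text \<open>Fatou applied to the elementary formula yields only an inequality, as no uniform
  integrability of the exponentials is known. Continuity of g carries almost sure convergence of the
  shifted paths through the product.\<close>

lemma ito_L2_girsanov_le:
  fixes g :: "real \<Rightarrow> real^'n \<Rightarrow> real"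
  assumes X: "ito_L2 d X" and d: "sqint d" and J: "finite J" "J \<subseteq> {0..1}"
    and g: "\<And>s. continuous_on UNIV (g s)" and g0: "\<And>s x. 0 \<le> g s x"
  shows "(\<integral>\<^sup>+ w. ennreal (exp (X w - 1 / 2 * energy (d w)))
        * (\<Prod>s\<in>J. ennreal (g s (\<beta> w s - (LINT r:{0..s}|lborel. d w r)))) \<partial>M)
    \<le> (\<integral>\<^sup>+ w. (\<Prod>s\<in>J. ennreal (g s (\<beta> w s))) \<partial>M)"
proof -
  obtain k t \<xi> where Xm [measurable]: "X \<in> borel_measurable M" and e: "\<And>m. elementary (k m) (t m) (\<xi> m)"
    and s: "(\<lambda>m. sqnorm (\<lambda>w s. elementary_integrand (k m) (t m) (\<xi> m) w s - d w s)) \<longlonglongrightarrow> 0"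
    and i: "\<And>m. integrable M (\<lambda>w. (elementary_integral \<beta> (k m) (t m) (\<xi> m) w - X w)\<^sup>2)"
    and l: "(\<lambda>m. \<integral> w. (elementary_integral \<beta> (k m) (t m) (\<xi> m) w - X w)\<^sup>2 \<partial>M) \<longlonglongrightarrow> 0"
    using X unfolding ito_L2_def by blast
  let ?I = "\<lambda>m. elementary_integral \<beta> (k m) (t m) (\<xi> m)"
  let ?G = "\<lambda>m. elementary_integrand (k m) (t m) (\<xi> m)"
  let ?D = "\<lambda>m w s. ?G m w s - d w s"
  have D: "sqint (?D m)" for m by (rule sqint_diff(1)[OF elementary_sqint[OF e] d])
  have gm [measurable]: "g s \<in> borel_measurable borel" for s
    by (rule borel_measurable_continuous_onI[OF g])
  have [measurable]: "?I m \<in> borel_measurable M" for m by (rule elementary_integral_measurable_M[OF e])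
  have [measurable]: "(\<lambda>w. energy (?G m w)) \<in> borel_measurable M" for m by (rule elementary_energy_measurable[OF e])
  have [measurable]: "(\<lambda>w. LINT r:{0..s}|lborel. ?G m w r) \<in> borel_measurable M" for m s
    by (rule time_integral_measurable_M[OF elementary_integrand_measurable[OF e]])
  have \<beta>m: "(\<lambda>w. \<beta> w s) \<in> borel_measurable M" if "s \<in> J" for s
    using \<beta>_measurable[of s] that J(2) by blast
  \<comment> \<open>Adding the two errors lets a single subsequence give almost sure convergence of
    both the energy and the integral.\<close>
  let ?Z = "\<lambda>m w. energy (?D m w) + (?I m w - X w)\<^sup>2"
  have Zi: "integrable M (?Z m)" for m by (intro Bochner_Integration.integrable_add i sqint_energy(1)[OF D])
  have "(\<lambda>m. (\<integral> w. norm (?Z m w) \<partial>M)) \<longlonglongrightarrow> 0 + 0"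
  proof -
    have "(\<integral> w. norm (?Z m w) \<partial>M) = sqnorm (?D m) + (\<integral> w. (?I m w - X w)\<^sup>2 \<partial>M)" for m
      using i sqint_energy(1)[OF D] by (simp add: energy_nonneg sqint_energy(2)[OF D])
    then show ?thesis using tendsto_add[OF s l] by simp
  qed
  then obtain r where r: "strict_mono r" "AE w in M. (\<lambda>n. ?Z (r n) w) \<longlonglongrightarrow> 0"
    using tendsto_L1_AE_subseq[of M ?Z, OF Zi] by auto
  let ?u = "\<lambda>m w. ennreal (exp (?I m w - 1 / 2 * energy (?G m w)))
        * (\<Prod>s\<in>J. ennreal (g s (\<beta> w s - (LINT r:{0..s}|lborel. ?G m w r))))"
  have um: "?u m \<in> borel_measurable M" for m
  proof -
    have "(\<lambda>w. ennreal (g s (\<beta> w s - (LINT r:{0..s}|lborel. ?G m w r)))) \<in> borel_measurable M" if "s \<in> J" for s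
    proof -
      note [measurable] = \<beta>m[OF that]
      show ?thesis by measurable
    qed
    then have [measurable]: "(\<lambda>w. \<Prod>s\<in>J. ennreal (g s (\<beta> w s - (LINT r:{0..s}|lborel. ?G m w r)))) \<in> borel_measurable M"
      by (intro borel_measurable_prod_ennreal)
    show ?thesis by measurable
  qed
  have "AE w in M. \<forall>m. set_integrable lborel {0..1} (\<lambda>s. (norm (?D m w s))\<^sup>2)"
    unfolding AE_all_countable by (intro allI sqint_energy(3)[OF D])
  moreover have "AE w in M. \<forall>m. set_integrable lborel {0..1} (\<lambda>s. (norm (?G m w s))\<^sup>2)"
    unfolding AE_all_countable by (intro allI sqint_energy(3)[OF elementary_sqint[OF e]])
  ultimately have "AE w in M. ennreal (exp (X w - 1 / 2 * energy (d w)))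
        * (\<Prod>s\<in>J. ennreal (g s (\<beta> w s - (LINT r:{0..s}|lborel. d w r))))
      = liminf (\<lambda>n. ?u (r n) w)"
    using r(2) sqint_energy(3)[OF d] AE_space
  proof eventually_elim
    case (elim w)
    have E0: "(\<lambda>n. energy (?D (r n) w)) \<longlonglongrightarrow> 0"
      by (rule tendsto_sandwich[OF _ _ tendsto_const elim(3)]) (auto simp: energy_nonneg)
    have "(\<lambda>n. (?I (r n) w - X w)\<^sup>2) \<longlonglongrightarrow> 0"
      by (rule tendsto_sandwich[OF _ _ tendsto_const elim(3)]) (auto simp: energy_nonneg)
    then have "(\<lambda>n. sqrt ((?I (r n) w - X w)\<^sup>2)) \<longlonglongrightarrow> sqrt 0" by (rule tendsto_real_sqrt)
    then have I0: "(\<lambda>n. ?I (r n) w) \<longlonglongrightarrow> X w"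
      by (simp add: tendsto_rabs_zero_iff LIM_zero_iff)
    have wG [measurable]: "?G m w \<in> borel_measurable borel" for m
      by (rule path_measurable[OF elementary_integrand_measurable[OF e] elim(5)])
    have wd [measurable]: "d w \<in> borel_measurable borel"
      by (rule path_measurable[OF sqint_measurable[OF d] elim(5)])
    have E1: "(\<lambda>n. energy (?G (r n) w)) \<longlonglongrightarrow> energy (d w)"
      using elim E0 by (intro energy_tendsto) auto
    have L1: "(\<lambda>n. LINT q:{0..s}|lborel. ?G (r n) w q) \<longlonglongrightarrow> (LINT q:{0..s}|lborel. d w q)" if "s \<in> J" for s
      using elim E0 that J(2) wG wd by (intro time_integral_tendsto) auto
    have L2: "(\<lambda>n. g s (\<beta> w s - (LINT q:{0..s}|lborel. ?G (r n) w q)))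
        \<longlonglongrightarrow> g s (\<beta> w s - (LINT q:{0..s}|lborel. d w q))" if "s \<in> J" for s
      using g[of s] L1[OF that]
      by (intro isCont_tendsto_compose[of _ "g s"] tendsto_diff tendsto_const)
         (auto simp: continuous_on_eq_continuous_at)
    have "(\<lambda>n. exp (?I (r n) w - 1 / 2 * energy (?G (r n) w))
          * (\<Prod>s\<in>J. g s (\<beta> w s - (LINT q:{0..s}|lborel. ?G (r n) w q))))
        \<longlonglongrightarrow> exp (X w - 1 / 2 * energy (d w)) * (\<Prod>s\<in>J. g s (\<beta> w s - (LINT q:{0..s}|lborel. d w q)))"
      by (intro tendsto_mult tendsto_exp tendsto_diff tendsto_const I0 E1 tendsto_prod L2)
    then have "(\<lambda>n. ?u (r n) w) \<longlonglongrightarrow> ennreal (exp (X w - 1 / 2 * energy (d w)))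
        * (\<Prod>s\<in>J. ennreal (g s (\<beta> w s - (LINT r:{0..s}|lborel. d w r))))"
      using g0 by (simp add: prod_ennreal ennreal_mult'[symmetric])
    then show ?case by (rule lim_imp_Liminf[OF sequentially_bot, symmetric])
  qed
  then have "(\<integral>\<^sup>+ w. ennreal (exp (X w - 1 / 2 * energy (d w)))
        * (\<Prod>s\<in>J. ennreal (g s (\<beta> w s - (LINT r:{0..s}|lborel. d w r)))) \<partial>M)
    = (\<integral>\<^sup>+ w. liminf (\<lambda>n. ?u (r n) w) \<partial>M)"
    by (rule nn_integral_cong_AE)
  also have "\<dots> \<le> liminf (\<lambda>n. \<integral>\<^sup>+ w. ?u (r n) w \<partial>M)"
    by (rule nn_integral_liminf) (rule um)
  also have "\<dots> = (\<integral>\<^sup>+ w. (\<Prod>s\<in>J. ennreal (g s (\<beta> w s))) \<partial>M)"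
  proof -
    have "(\<integral>\<^sup>+ w. ?u m w \<partial>M) = (\<integral>\<^sup>+ w. (\<Prod>s\<in>J. ennreal (g s (\<beta> w s))) \<partial>M)" for m
      by (rule elementary_girsanov[OF e J, where g = "\<lambda>s x. ennreal (g s x)"]) measurable
    then show ?thesis by (simp add: Liminf_const)
  qed
  finally show ?thesis .
qed

end

section \<open>Drifts starting after a stopping time\<close>

text \<open>Here \<beta> generates F up to null sets, so measures on \<open>F 1\<close> can be
  compared through the coordinates of \<beta>. The filtration is constant after time 1, which admits
  stopping times with values above 1.\<close>

locale stopped_brownian = brownian_filtration M F \<beta>
  for M :: "'n::finite path measure" and F \<beta> +
  fixes \<tau> :: "'n path \<Rightarrow> real"
  assumes generated: "sets (F 1) \<subseteq> sigma_sets (space M)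
      ({(\<lambda>w. \<beta> w s) -` B \<inter> space M | s B. s \<in> {0..1} \<and> B \<in> sets borel} \<union> null_sets M)"
    and F_final: "\<And>t. 1 \<le> t \<Longrightarrow> sets (F t) \<subseteq> sets (F 1)"
    and stopping: "stopping_time F \<tau>"
begin

section \<open>Events before the stopping time and the localised Girsanov inequality\<close>

sublocale filtration "space M" F
  by unfold_locales (auto intro: F_mono[THEN subsetD])

text \<open>As \<tau> is real valued, A is the countable union of its parts where \<tau> is at most
  n, and each of these lies in \<open>F 1\<close> by \<open>F_final\<close>.\<close>

lemma pre_sigma_subset_F1: "sets (pre_sigma \<tau>) \<subseteq> sets (F 1)"
proof
  fix A assume A: "A \<in> sets (pre_sigma \<tau>)"
  have eq: "A = (\<Union>n::nat. {w\<in>A. \<tau> w \<le> real n})"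
    using real_arch_simple by auto
  have *: "{w\<in>A. \<tau> w \<le> real n} \<in> sets (F 1)" for n
  proof -
    have "{w\<in>A. \<tau> w \<le> real n} \<in> sets (F (real n))"
      by (rule sets_pre_sigmaD[OF stopping A])
    also have "\<dots> \<subseteq> sets (F (max 1 (real n)))" by (rule F_mono) simp
    also have "\<dots> \<subseteq> sets (F 1)" by (rule F_final) simp
    finally show ?thesis .
  qed
  have "(\<Union>n::nat. {w\<in>A. \<tau> w \<le> real n}) \<in> sets (F 1)"
    using * by (intro sets.countable_nat_UN) blast
  with eq show "A \<in> sets (F 1)" by simp
qed

lemma pre_sigma_subset_M: "A \<in> sets (pre_sigma \<tau>) \<Longrightarrow> A \<in> sets M"
  using pre_sigma_subset_F1 sets_F_subset by blast

lemma subalgebra_pre_sigma: "subalgebra M (pre_sigma \<tau>)"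
  using pre_sigma_subset_M by (auto simp: subalgebra_def space_pre_sigma)

text \<open>A need not be known at time t, but its part where \<tau> has already occurred is, and
  before that the drift is 0. So the indicator of A can be replaced by that of an event in
  \<open>F t\<close>.\<close>

lemma sq_adapted_event:
  assumes d: "sq_adapted d" and z: "\<And>w s. s \<le> \<tau> w \<Longrightarrow> d w s = 0" and A: "A \<in> sets (pre_sigma \<tau>)"
  shows "sq_adapted (\<lambda>w s. indicat_real A w *\<^sub>R d w s)"
proof -
  have di: "sqint d" and ad: "\<And>t. t \<in> {0..1} \<Longrightarrow> (\<lambda>w. d w t) \<in> borel_measurable (F t)"
    using d by (auto simp: sq_adapted_def)
  note [measurable] = sqint_measurable[OF di] pre_sigma_subset_M[OF A]
  have "integrable (M \<Otimes>\<^sub>M lborel) (\<lambda>(w, s). indicat_real {0..1} s * (norm (indicat_real A w *\<^sub>R d w s))\<^sup>2)"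
  proof (rule Bochner_Integration.integrable_bound)
    show "integrable (M \<Otimes>\<^sub>M lborel) (\<lambda>(w, s). indicat_real {0..1} s * (norm (d w s))\<^sup>2)"
      using di by (simp add: sqint_def)
    show "AE x in M \<Otimes>\<^sub>M lborel. norm (case x of (w, s) \<Rightarrow> indicat_real {0..1} s * (norm (indicat_real A w *\<^sub>R d w s))\<^sup>2)
      \<le> norm (case x of (w, s) \<Rightarrow> indicat_real {0..1} s * (norm (d w s))\<^sup>2)"
      by (rule AE_I2) (auto simp: indicator_def split: prod.split)
  qed measurable
  moreover have "(\<lambda>w. indicat_real A w *\<^sub>R d w t) \<in> borel_measurable (F t)" if t: "t \<in> {0..1}" for t
  proof -
    note [measurable] = ad[OF t] sets_pre_sigmaD[OF stopping A, of t]
    have "(\<lambda>w. indicat_real {w\<in>A. \<tau> w \<le> t} w *\<^sub>R d w t) \<in> borel_measurable (F t)"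
      by measurable
    moreover have "indicat_real {w\<in>A. \<tau> w \<le> t} w *\<^sub>R d w t = indicat_real A w *\<^sub>R d w t" for w
      using z[of t w] linear[of t "\<tau> w"] by (auto simp: indicator_def)
    ultimately show ?thesis by simp
  qed
  ultimately show ?thesis by (simp add: sq_adapted_def sqint_def)
qed

lemma ito_prob_zero: "ito_prob (\<lambda>_ _. 0) (\<lambda>_. 0)"
  unfolding ito_prob_def
proof (intro conjI exI allI)
  show "elementary 0 (\<lambda>_. 0) (\<lambda>_ _. 0)" by (simp add: elementary_def)
qed (simp_all add: tendsto_in_prob_def elementary_integrand_def elementary_integral_def energy_def)

lemma sqint_zero: "sqint (\<lambda>_ _. 0)"
  by (simp add: sqint_def case_prod_unfold)

text \<open>The restricted integrand agrees with d on A and with 0 off A, so locality identifies its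
  integral on both pieces.\<close>

lemma ito_L2_event:
  assumes d: "sq_adapted d" and z: "\<And>w s. s \<le> \<tau> w \<Longrightarrow> d w s = 0" and A: "A \<in> sets (pre_sigma \<tau>)"
    and X: "ito_L2 d X"
  obtains XA where "ito_L2 (\<lambda>w s. indicat_real A w *\<^sub>R d w s) XA"
    "AE w in M. XA w = indicat_real A w * X w"
proof -
  have dA: "sq_adapted (\<lambda>w s. indicat_real A w *\<^sub>R d w s)" by (rule sq_adapted_event[OF d z A])
  obtain XA where XA: "ito_L2 (\<lambda>w s. indicat_real A w *\<^sub>R d w s) XA"
    using ito_L2_exists[OF dA] by blast
  have i: "sqint d" "sqint (\<lambda>w s. indicat_real A w *\<^sub>R d w s)"
    using d dA by (auto simp: sq_adapted_def)
  note AM = pre_sigma_subset_M[OF A]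
  have "AE w in M. w \<in> A \<longrightarrow> XA w = X w"
    by (rule ito_prob_local[OF ito_L2_imp_prob[OF XA i(2)] ito_L2_imp_prob[OF X i(1)] i(2,1) AM]) auto
  moreover have "AE w in M. w \<in> space M - A \<longrightarrow> XA w = 0"
    by (rule ito_prob_local[OF ito_L2_imp_prob[OF XA i(2)] ito_prob_zero i(2) sqint_zero]) (use AM in auto)
  ultimately have "AE w in M. XA w = indicat_real A w * X w"
    using AE_space by eventually_elim (auto simp: indicator_def)
  with XA show ?thesis by (rule that)
qed

text \<open>The product is the stochastic integral of the restricted drift, hence centred. Over all
  A this says that the conditional mean of X given the past of \<tau> is 0.\<close>

lemma ito_L2_event_expectation:
  assumes d: "sq_adapted d" and z: "\<And>w s. s \<le> \<tau> w \<Longrightarrow> d w s = 0" and A: "A \<in> sets (pre_sigma \<tau>)"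
    and X: "ito_L2 d X"
  shows "(\<integral> w. indicat_real A w * X w \<partial>M) = 0"
proof -
  obtain XA where XA: "ito_L2 (\<lambda>w s. indicat_real A w *\<^sub>R d w s) XA"
    and eq: "AE w in M. XA w = indicat_real A w * X w"
    using ito_L2_event[OF d z A X] by blast
  have [measurable]: "XA \<in> borel_measurable M" "X \<in> borel_measurable M" "A \<in> sets M"
    using XA X pre_sigma_subset_M[OF A] by (auto simp: ito_L2_def)
  have "(\<integral> w. indicat_real A w * X w \<partial>M) = (\<integral> w. XA w \<partial>M)"
    by (rule integral_cong_AE) (use eq in \<open>auto elim: eventually_mono\<close>)
  then show ?thesis using ito_L2_expectation(2)[OF XA] by simp
qed

text \<open>For the drift restricted to A, the weight off A is 1 and the path there is not shifted.
  Both sides of the Girsanov inequality then contain the same contribution off A, which is finite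
  since g is at most 1 and can be cancelled.\<close>

lemma girsanov_event_le:
  fixes g :: "real \<Rightarrow> real^'n \<Rightarrow> real"
  assumes d: "sq_adapted d" and z: "\<And>w s. s \<le> \<tau> w \<Longrightarrow> d w s = 0" and A: "A \<in> sets (pre_sigma \<tau>)"
    and X: "ito_L2 d X" and J: "finite J" "J \<subseteq> {0..1}"
    and g: "\<And>s. continuous_on UNIV (g s)" and g0: "\<And>s x. 0 \<le> g s x" and g1: "\<And>s x. g s x \<le> 1"
  shows "(\<integral>\<^sup>+ w. indicator A w * (ennreal (exp (X w - 1 / 2 * energy (d w)))
        * (\<Prod>s\<in>J. ennreal (g s (\<beta> w s - (LINT r:{0..s}|lborel. d w r))))) \<partial>M)
    \<le> (\<integral>\<^sup>+ w. indicator A w * (\<Prod>s\<in>J. ennreal (g s (\<beta> w s))) \<partial>M)"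
proof -
  obtain XA where XA: "ito_L2 (\<lambda>w s. indicat_real A w *\<^sub>R d w s) XA"
    and eq: "AE w in M. XA w = indicat_real A w * X w"
    using ito_L2_event[OF d z A X] by blast
  have di: "sqint d" and dA: "sqint (\<lambda>w s. indicat_real A w *\<^sub>R d w s)"
    using d sq_adapted_event[OF d z A] by (auto simp: sq_adapted_def)
  have AM [measurable]: "A \<in> sets M" by (rule pre_sigma_subset_M[OF A])
  have Xm [measurable]: "X \<in> borel_measurable M" using X by (simp add: ito_L2_def)
  have gm [measurable]: "g s \<in> borel_measurable borel" for s
    by (rule borel_measurable_continuous_onI[OF g])
  have [measurable]: "(\<lambda>w. energy (d w)) \<in> borel_measurable M"
    by (rule energy_measurable[OF sqint_measurable[OF di]])
  have \<beta>m: "(\<lambda>w. \<beta> w s) \<in> borel_measurable M" if "s \<in> J" for s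
    using \<beta>_measurable[of s] that J(2) by blast
  have Im [measurable]: "(\<lambda>w. LINT r:{0..s}|lborel. d w r) \<in> borel_measurable M" for s
    by (rule time_integral_measurable_M[OF sqint_measurable[OF di]])
  let ?P = "\<lambda>w. \<Prod>s\<in>J. ennreal (g s (\<beta> w s))"
  let ?Q = "\<lambda>w. ennreal (exp (X w - 1 / 2 * energy (d w)))
        * (\<Prod>s\<in>J. ennreal (g s (\<beta> w s - (LINT r:{0..s}|lborel. d w r))))"
  have Pm [measurable]: "?P \<in> borel_measurable M"
  proof (rule borel_measurable_prod_ennreal)
    fix s assume "s \<in> J"
    note [measurable] = \<beta>m[OF this]
    show "(\<lambda>w. ennreal (g s (\<beta> w s))) \<in> borel_measurable M" by measurable
  qed
  have Qm [measurable]: "?Q \<in> borel_measurable M"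
  proof (intro borel_measurable_times_ennreal borel_measurable_prod_ennreal)
    fix s assume "s \<in> J"
    note [measurable] = \<beta>m[OF this]
    show "(\<lambda>w. ennreal (g s (\<beta> w s - (LINT r:{0..s}|lborel. d w r)))) \<in> borel_measurable M" by measurable
  qed measurable
  have fin: "(\<integral>\<^sup>+ w. indicator (space M - A) w * ?P w \<partial>M) \<noteq> \<infinity>"
  proof -
    have "(\<integral>\<^sup>+ w. indicator (space M - A) w * ?P w \<partial>M) \<le> (\<integral>\<^sup>+ w. 1 \<partial>M)"
    proof (rule nn_integral_mono)
      fix w
      have "?P w \<le> 1"
        using g0 g1 by (simp add: prod_ennreal ennreal_le_1 prod_le_1)
      then show "indicator (space M - A) w * ?P w \<le> 1" by (auto simp: indicator_def)
    qed
    also have "\<dots> = 1" by (simp add: emeasure_space_1)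
    finally show ?thesis by (auto simp: top_unique)
  qed
  have eA: "energy (\<lambda>s. indicat_real A w *\<^sub>R d w s) = energy (d w)" if "w \<in> A" for w
    using that by simp
  have "(\<integral>\<^sup>+ w. indicator A w * ?Q w \<partial>M) + (\<integral>\<^sup>+ w. indicator (space M - A) w * ?P w \<partial>M)
    = (\<integral>\<^sup>+ w. indicator A w * ?Q w + indicator (space M - A) w * ?P w \<partial>M)"
    by (rule nn_integral_add[symmetric]) measurable
  also have "\<dots> = (\<integral>\<^sup>+ w. ennreal (exp (XA w - 1 / 2 * energy (\<lambda>s. indicat_real A w *\<^sub>R d w s)))
        * (\<Prod>s\<in>J. ennreal (g s (\<beta> w s - (LINT r:{0..s}|lborel. indicat_real A w *\<^sub>R d w r)))) \<partial>M)"
  proof (rule nn_integral_cong_AE)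
    show "AE w in M. indicator A w * ?Q w + indicator (space M - A) w * ?P w
      = ennreal (exp (XA w - 1 / 2 * energy (\<lambda>s. indicat_real A w *\<^sub>R d w s)))
        * (\<Prod>s\<in>J. ennreal (g s (\<beta> w s - (LINT r:{0..s}|lborel. indicat_real A w *\<^sub>R d w r))))"
      using eq AE_space
    proof eventually_elim
      case (elim w)
      show ?case
      proof (cases "w \<in> A")
        case True then show ?thesis using elim by simp
      next
        case False
        then show ?thesis using elim by (simp add: energy_def)
      qed
    qed
  qed
  also have "\<dots> \<le> (\<integral>\<^sup>+ w. ?P w \<partial>M)"
    by (rule ito_L2_girsanov_le[OF XA dA J g g0])
  also have "\<dots> = (\<integral>\<^sup>+ w. indicator A w * ?P w + indicator (space M - A) w * ?P w \<partial>M)"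
    by (intro nn_integral_cong) (auto simp: indicator_def)
  also have "\<dots> = (\<integral>\<^sup>+ w. indicator A w * ?P w \<partial>M) + (\<integral>\<^sup>+ w. indicator (space M - A) w * ?P w \<partial>M)"
    by (rule nn_integral_add) measurable
  finally have "(\<integral>\<^sup>+ w. indicator (space M - A) w * ?P w \<partial>M) + (\<integral>\<^sup>+ w. indicator A w * ?Q w \<partial>M)
      \<le> (\<integral>\<^sup>+ w. indicator (space M - A) w * ?P w \<partial>M) + (\<integral>\<^sup>+ w. indicator A w * ?P w \<partial>M)"
    by (simp only: add.commute)
  then show ?thesis
    using fin by (simp only: ennreal_add_left_cancel_le) auto
qed

text \<open>A Dynkin argument: closed cylinders of \<beta> together with null sets generate
  \<open>F 1\<close>, and absolute continuity lets both measures ignore null sets.\<close>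

lemma cylinder_eqI:
  assumes sets: "sets m1 = sets M" "sets m2 = sets M"
    and fin: "finite_measure m1" "finite_measure m2"
    and ac: "absolutely_continuous M m1" "absolutely_continuous M m2"
    and cyl: "\<And>J C. finite J \<Longrightarrow> J \<subseteq> {0..1} \<Longrightarrow> (\<And>s. closed (C s)) \<Longrightarrow>
       emeasure m1 {w\<in>space M. \<forall>s\<in>J. \<beta> w s \<in> C s} = emeasure m2 {w\<in>space M. \<forall>s\<in>J. \<beta> w s \<in> C s}"
    and D: "D \<in> sets (F 1)"
  shows "emeasure m1 D = emeasure m2 D"
proof -
  \<comment> \<open>Membership up to almost sure equality makes the null sets part of the generator
    while keeping it stable under intersections.\<close>
  define E where "E = {D \<in> sets M. \<exists>J C. finite J \<and> J \<subseteq> {0..1} \<and> (\<forall>s. closed (C s)) \<and>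
     (AE w in M. w \<in> D \<longleftrightarrow> (\<forall>s\<in>J. \<beta> w s \<in> (C s :: (real^'n) set)))}"
  have cylm: "{w\<in>space M. \<forall>s\<in>J. \<beta> w s \<in> C s} \<in> sets M"
    if "finite J" "J \<subseteq> {0..1}" "\<And>s. closed (C s)" for J and C :: "real \<Rightarrow> (real^'n) set"
  proof -
    have "{w\<in>space M. \<beta> w s \<in> C s} \<in> sets M" if "s \<in> J" for s
    proof -
      have "(\<lambda>w. \<beta> w s) \<in> borel_measurable M" using \<beta>_measurable[of s] that \<open>J \<subseteq> {0..1}\<close> by blast
      then have "(\<lambda>w. \<beta> w s) -` C s \<inter> space M \<in> sets M"
        by (rule measurable_sets) (use \<open>\<And>s. closed (C s)\<close> in auto)
      also have "(\<lambda>w. \<beta> w s) -` C s \<inter> space M = {w\<in>space M. \<beta> w s \<in> C s}" by auto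
      finally show ?thesis .
    qed
    then show ?thesis using that(1) by (intro sets.sets_Collect_finite_All) auto
  qed
  have null: "N \<in> null_sets m1" "N \<in> null_sets m2" if "N \<in> null_sets M" for N
    using ac that by (auto simp: absolutely_continuous_def)
  have Eeq: "emeasure m1 D = emeasure m2 D" if D: "D \<in> E" for D
  proof -
    obtain J C where J: "finite J" "J \<subseteq> {0..1}" "\<And>s. closed (C s)"
      and ae: "AE w in M. w \<in> D \<longleftrightarrow> (\<forall>s\<in>J. \<beta> w s \<in> (C s :: (real^'n) set))"
      using D unfolding E_def by blast
    have DM: "D \<in> sets M" using D by (simp add: E_def)
    have "AE w in M. w \<in> D \<longleftrightarrow> w \<in> {w\<in>space M. \<forall>s\<in>J. \<beta> w s \<in> C s}"
      using ae AE_space by eventually_elim auto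
    then have "AE w in m1. w \<in> D \<longleftrightarrow> w \<in> {w\<in>space M. \<forall>s\<in>J. \<beta> w s \<in> C s}"
      "AE w in m2. w \<in> D \<longleftrightarrow> w \<in> {w\<in>space M. \<forall>s\<in>J. \<beta> w s \<in> C s}"
      using absolutely_continuous_AE[OF sets(1)] absolutely_continuous_AE[OF sets(2)] ac by auto
    then have "emeasure m1 D = emeasure m1 {w\<in>space M. \<forall>s\<in>J. \<beta> w s \<in> C s}"
      "emeasure m2 D = emeasure m2 {w\<in>space M. \<forall>s\<in>J. \<beta> w s \<in> C s}"
      using DM cylm[OF J] sets by (auto intro!: emeasure_eq_AE)
    then show ?thesis using cyl[OF J] by simp
  qed
  have EM: "E \<subseteq> sets M" by (auto simp: E_def)
  have Int: "Int_stable E"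
  proof (rule Int_stableI)
    fix D1 D2 assume "D1 \<in> E" "D2 \<in> E"
    then obtain J1 C1 J2 C2 where 1: "finite J1" "J1 \<subseteq> {0..1}" "\<And>s. closed (C1 s)" "D1 \<in> sets M"
        "AE w in M. w \<in> D1 \<longleftrightarrow> (\<forall>s\<in>J1. \<beta> w s \<in> (C1 s :: (real^'n) set))"
      and 2: "finite J2" "J2 \<subseteq> {0..1}" "\<And>s. closed (C2 s)" "D2 \<in> sets M"
        "AE w in M. w \<in> D2 \<longleftrightarrow> (\<forall>s\<in>J2. \<beta> w s \<in> (C2 s :: (real^'n) set))"
      unfolding E_def by blast
    \<comment> \<open>A time observed by only one of the two cylinders is left unconstrained by the
      other.\<close>
    let ?C = "\<lambda>s. (if s \<in> J1 then C1 s else UNIV) \<inter> (if s \<in> J2 then C2 s else UNIV)"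
    have "AE w in M. w \<in> D1 \<inter> D2 \<longleftrightarrow> (\<forall>s\<in>J1 \<union> J2. \<beta> w s \<in> ?C s)"
      using 1(5) 2(5) by eventually_elim auto
    moreover have "\<forall>s. closed (?C s)" using 1(3) 2(3) by auto
    ultimately show "D1 \<inter> D2 \<in> E"
      unfolding E_def using 1(1,2,4) 2(1,2,4)
      by (intro CollectI conjI exI[of _ "J1 \<union> J2"] exI[of _ ?C]) auto
  qed
  have sub: "sets (F 1) \<subseteq> sigma_sets (space M) E"
  proof (rule order_trans[OF generated sigma_sets_mono], rule Un_least)
    show "null_sets M \<subseteq> sigma_sets (space M) E"
    proof
      fix N assume N: "N \<in> null_sets M"
      \<comment> \<open>A null set is almost surely equal to the cylinder over the empty closed
        set.\<close>
      have "N \<in> E"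
        unfolding E_def
        by (intro CollectI conjI exI[of _ "{0}"] exI[of _ "\<lambda>_. {}"]) (use N AE_not_in[OF N] in auto)
      then show "N \<in> sigma_sets (space M) E" ..
    qed
    show "{(\<lambda>w. \<beta> w s) -` B \<inter> space M | s B. s \<in> {0..1} \<and> B \<in> sets borel} \<subseteq> sigma_sets (space M) E"
    proof clarify
      fix s :: real and B :: "(real^'n) set" assume s: "s \<in> {0..1}" and B: "B \<in> sets borel"
      have "(\<lambda>w. \<beta> w s) \<in> measurable (sigma (space M) E) (sigma UNIV (Collect closed))"
      proof (rule measurable_sigma_sets[where A = "Collect closed"])
        show "sets (sigma UNIV (Collect closed)) = sigma_sets UNIV (Collect closed :: (real^'n) set set)"
          by (simp add: sets_measure_of)
        fix C :: "(real^'n) set" assume C: "C \<in> Collect closed"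
        have "(\<lambda>w. \<beta> w s) -` C \<inter> space M \<in> E"
          unfolding E_def
        proof (intro CollectI conjI exI[of _ "{s}"] exI[of _ "\<lambda>_. C"])
          show "(\<lambda>w. \<beta> w s) -` C \<inter> space M \<in> sets M"
            using measurable_sets[OF \<beta>_measurable[OF s], of C] C by auto
          show "AE w in M. (w \<in> (\<lambda>w. \<beta> w s) -` C \<inter> space M) = (\<forall>s\<in>{s}. \<beta> w s \<in> C)"
            using AE_space by eventually_elim auto
        qed (use s C in auto)
        then show "(\<lambda>w. \<beta> w s) -` C \<inter> space (sigma (space M) E) \<in> sets (sigma (space M) E)"
          using EM sets.space_closed[of M] by (auto simp: space_measure_of_conv sets_measure_of_conv)
      qed auto
      then have "(\<lambda>w. \<beta> w s) -` B \<inter> space (sigma (space M) E) \<in> sets (sigma (space M) E)"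
        by (rule measurable_sets) (use B in \<open>simp add: borel_eq_closed sets_measure_of\<close>)
      moreover have "E \<subseteq> Pow (space M)" using EM sets.space_closed[of M] by auto
      ultimately show "(\<lambda>w. \<beta> w s) -` B \<inter> space M \<in> sigma_sets (space M) E"
        by (simp add: sets_measure_of space_measure_of)
    qed
  qed
  interpret m1: finite_measure m1 by fact
  interpret m2: finite_measure m2 by fact
  have sp: "space m1 = space M" "space m2 = space M" using sets_eq_imp_space_eq[OF sets(1)] sets_eq_imp_space_eq[OF sets(2)] by auto
  have space_E: "space M \<in> E"
    unfolding E_def by (intro CollectI conjI exI[of _ "{}"] exI[of _ "\<lambda>_. {}"]) auto
  have EP: "E \<subseteq> Pow (space M)" using EM sets.space_closed[of M] by auto
  have "D \<in> sigma_sets (space M) E" using D sub by auto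
  from Int EP this show "emeasure m1 D = emeasure m2 D"
  proof (induction rule: sigma_sets_induct_disjoint)
    case (basic A) then show ?case by (rule Eeq)
  next
    case empty show ?case by simp
  next
    case (compl A)
    have sM: "sigma_sets (space M) E \<subseteq> sets M" using EM by (rule sets.sigma_sets_subset)
    then have "A \<in> sets m1" "A \<in> sets m2" using compl sets by auto
    then have "emeasure m1 (space M - A) = emeasure m1 (space M) - emeasure m1 A"
      "emeasure m2 (space M - A) = emeasure m2 (space M) - emeasure m2 A"
      using emeasure_compl[of A m1] emeasure_compl[of A m2] sp by auto
    then show ?case using compl Eeq[OF space_E] by simp
  next
    case (union A)
    have sM: "sigma_sets (space M) E \<subseteq> sets M" using EM by (rule sets.sigma_sets_subset)
    then have r: "range A \<subseteq> sets m1" "range A \<subseteq> sets m2" using union sets by auto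
    have "emeasure m1 (\<Union>i. A i) = (\<Sum>i. emeasure m1 (A i))"
      by (rule suminf_emeasure[symmetric, OF r(1) union(1)])
    also have "\<dots> = (\<Sum>i. emeasure m2 (A i))" using union(3) by simp
    also have "\<dots> = emeasure m2 (\<Union>i. A i)"
      by (rule suminf_emeasure[OF r(2) union(1)])
    finally show ?case .
  qed
qed

end

text \<open>Continuous approximation of the indicator of a closed set from above; it is needed
  because the Girsanov inequality is available for continuous functions only.\<close>

definition closed_cutoff :: "nat \<Rightarrow> 'a::metric_space set \<Rightarrow> 'a \<Rightarrow> real" where
  "closed_cutoff n C x = max 0 (1 - real n * infdist x C)"

lemma closed_cutoff_bounds: "0 \<le> closed_cutoff n C x" "closed_cutoff n C x \<le> 1"
  by (auto simp: closed_cutoff_def infdist_nonneg)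

lemma closed_cutoff_continuous: "continuous_on UNIV (closed_cutoff n C)"
  unfolding closed_cutoff_def by (intro continuous_intros)

text \<open>A point outside a closed set has positive distance to it, so the cutoff is eventually 0
  there. For the empty set \<open>infdist\<close> is 0 by convention and the cutoff would be
  constantly 1.\<close>

lemma closed_cutoff_tendsto:
  assumes "closed C" "C \<noteq> {}"
  shows "(\<lambda>n. closed_cutoff n C x) \<longlonglongrightarrow> indicat_real C x"
proof (cases "x \<in> C")
  case True
  then show ?thesis by (simp add: closed_cutoff_def)
next
  case False
  then have pos: "0 < infdist x C"
    using assms in_closed_iff_infdist_zero[of C x] infdist_nonneg[of x C] by fastforce
  obtain N where N: "1 / infdist x C < real N" using reals_Archimedean2 by blast
  have "eventually (\<lambda>n. closed_cutoff n C x = indicat_real C x) sequentially"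
    using eventually_ge_at_top[of N]
  proof eventually_elim
    case (elim n)
    then have "1 / infdist x C < real n" using N by simp
    then show ?case using pos False by (simp add: closed_cutoff_def field_simps)
  qed
  then show ?thesis by (rule tendsto_eventually)
qed

section \<open>Invariance of events before the stopping time\<close>

context stopped_brownian
begin

lemma compl_pre_sigma: "A \<in> sets (pre_sigma \<tau>) \<Longrightarrow> space M - A \<in> sets (pre_sigma \<tau>)"
  using sets.compl_sets[of A "pre_sigma \<tau>"] by (simp add: space_pre_sigma)

text \<open>The inequality holds for A and for its complement, and the sums of the two sides agree
  by the assumed law of Y under the exponential density. All terms are finite, so neither inequality
  can be strict.\<close>

lemma girsanov_event_eq:
  fixes g :: "real \<Rightarrow> real^'n \<Rightarrow> real"
  assumes d: "sq_adapted d" and z: "\<And>w s. s \<le> \<tau> w \<Longrightarrow> d w s = 0"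
    and X: "ito_L2 d X" and Y [measurable]: "Y \<in> M \<rightarrow>\<^sub>M M"
    and \<beta>Y: "AE w in M. \<forall>s\<in>{0..1}. \<beta> (Y w) s = \<beta> w s - (LINT r:{0..s}|lborel. d w r)"
    and law: "\<And>h. h \<in> borel_measurable M \<Longrightarrow>
       (\<integral>\<^sup>+ w. ennreal (exp (X w - 1 / 2 * energy (d w))) * h (Y w) \<partial>M) = (\<integral>\<^sup>+ w. h w \<partial>M)"
    and A: "A \<in> sets (pre_sigma \<tau>)" and J: "finite J" "J \<subseteq> {0..1}"
    and g: "\<And>s. continuous_on UNIV (g s)" and g0: "\<And>s x. 0 \<le> g s x" and g1: "\<And>s x. g s x \<le> 1"
  shows "(\<integral>\<^sup>+ w. indicator A w * (ennreal (exp (X w - 1 / 2 * energy (d w))) * (\<Prod>s\<in>J. ennreal (g s (\<beta> (Y w) s)))) \<partial>M)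
    = (\<integral>\<^sup>+ w. indicator A w * (\<Prod>s\<in>J. ennreal (g s (\<beta> w s))) \<partial>M)"
proof -
  let ?P = "\<lambda>w. \<Prod>s\<in>J. ennreal (g s (\<beta> w s))"
  let ?R = "\<lambda>w. ennreal (exp (X w - 1 / 2 * energy (d w)))"
  have di: "sqint d" using d by (simp add: sq_adapted_def)
  have gm [measurable]: "g s \<in> borel_measurable borel" for s
    by (rule borel_measurable_continuous_onI[OF g])
  have Pm [measurable]: "?P \<in> borel_measurable M"
  proof (rule borel_measurable_prod_ennreal)
    fix s assume "s \<in> J"
    then have [measurable]: "(\<lambda>w. \<beta> w s) \<in> borel_measurable M" using \<beta>_measurable[of s] J(2) by blast
    show "(\<lambda>w. ennreal (g s (\<beta> w s))) \<in> borel_measurable M" by measurable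
  qed
  have PY [measurable]: "(\<lambda>w. ?P (Y w)) \<in> borel_measurable M"
    by (rule measurable_compose[OF Y Pm])
  have [measurable]: "X \<in> borel_measurable M" using X by (simp add: ito_L2_def)
  have [measurable]: "(\<lambda>w. energy (d w)) \<in> borel_measurable M"
    by (rule energy_measurable[OF sqint_measurable[OF di]])
  have le: "(\<integral>\<^sup>+ w. indicator B w * (?R w * ?P (Y w)) \<partial>M) \<le> (\<integral>\<^sup>+ w. indicator B w * ?P w \<partial>M)"
    if B: "B \<in> sets (pre_sigma \<tau>)" for B
  proof -
    have "(\<integral>\<^sup>+ w. indicator B w * (?R w * ?P (Y w)) \<partial>M)
      = (\<integral>\<^sup>+ w. indicator B w * (?R w * (\<Prod>s\<in>J. ennreal (g s (\<beta> w s - (LINT r:{0..s}|lborel. d w r))))) \<partial>M)"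
    proof (rule nn_integral_cong_AE)
      show "AE w in M. indicator B w * (?R w * ?P (Y w))
        = indicator B w * (?R w * (\<Prod>s\<in>J. ennreal (g s (\<beta> w s - (LINT r:{0..s}|lborel. d w r)))))"
        using \<beta>Y
      proof eventually_elim
        case (elim w)
        then have "?P (Y w) = (\<Prod>s\<in>J. ennreal (g s (\<beta> w s - (LINT r:{0..s}|lborel. d w r))))"
          using J(2) by (intro prod.cong) (auto dest: bspec subsetD)
        then show ?case by simp
      qed
    qed
    also have "\<dots> \<le> (\<integral>\<^sup>+ w. indicator B w * ?P w \<partial>M)"
      by (rule girsanov_event_le[OF d z B X J g g0 g1])
    finally show ?thesis .
  qed
  have AM [measurable]: "A \<in> sets M" by (rule pre_sigma_subset_M[OF A])
  define a where "a = (\<integral>\<^sup>+ w. indicator A w * (?R w * ?P (Y w)) \<partial>M)"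
  define a' where "a' = (\<integral>\<^sup>+ w. indicator (space M - A) w * (?R w * ?P (Y w)) \<partial>M)"
  define b where "b = (\<integral>\<^sup>+ w. indicator A w * ?P w \<partial>M)"
  define b' where "b' = (\<integral>\<^sup>+ w. indicator (space M - A) w * ?P w \<partial>M)"
  have ab: "a \<le> b" "a' \<le> b'"
    unfolding a_def b_def a'_def b'_def by (rule le[OF A], rule le[OF compl_pre_sigma[OF A]])
  have "a + a' = (\<integral>\<^sup>+ w. indicator A w * (?R w * ?P (Y w)) + indicator (space M - A) w * (?R w * ?P (Y w)) \<partial>M)"
    unfolding a_def a'_def by (rule nn_integral_add[symmetric]) measurable
  also have "\<dots> = (\<integral>\<^sup>+ w. ?R w * ?P (Y w) \<partial>M)"
    by (intro nn_integral_cong) (auto simp: indicator_def)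
  also have "\<dots> = (\<integral>\<^sup>+ w. ?P w \<partial>M)" by (rule law[OF Pm])
  also have "\<dots> = (\<integral>\<^sup>+ w. indicator A w * ?P w + indicator (space M - A) w * ?P w \<partial>M)"
    by (intro nn_integral_cong) (auto simp: indicator_def)
  also have "\<dots> = b + b'"
    unfolding b_def b'_def by (rule nn_integral_add) measurable
  finally have sum: "a + a' = b + b'" .
  have "b' \<le> (\<integral>\<^sup>+ w. 1 \<partial>M)"
    unfolding b'_def
  proof (rule nn_integral_mono)
    fix w
    have "?P w \<le> 1" using g0 g1 by (simp add: prod_ennreal ennreal_le_1 prod_le_1)
    then show "indicator (space M - A) w * ?P w \<le> 1" by (auto simp: indicator_def)
  qed
  then have fin: "a' \<noteq> \<top>" using ab(2) by (auto simp: emeasure_space_1 top_unique)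
  have "a' + b \<le> a' + a" using sum ab(2) by (metis add.commute add_left_mono)
  then have "b \<le> a" using fin by (simp add: ennreal_add_left_cancel_le)
  then show ?thesis using ab(1) unfolding a_def b_def by (rule antisym[rotated])
qed

text \<open>Both sides are finite measures in D and absolutely continuous with respect to M. Cutoffs
  reduce closed cylinders to products of continuous functions of \<beta>, and
  \<open>cylinder_eqI\<close> extends the identity to \<open>F 1\<close>.\<close>

lemma stopped_event_eq:
  assumes d: "sq_adapted d" and z: "\<And>w s. s \<le> \<tau> w \<Longrightarrow> d w s = 0"
    and X: "ito_L2 d X" and Y [measurable]: "Y \<in> M \<rightarrow>\<^sub>M M"
    and \<beta>Y: "AE w in M. \<forall>s\<in>{0..1}. \<beta> (Y w) s = \<beta> w s - (LINT r:{0..s}|lborel. d w r)"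
    and law: "\<And>h. h \<in> borel_measurable M \<Longrightarrow>
       (\<integral>\<^sup>+ w. ennreal (exp (X w - 1 / 2 * energy (d w))) * h (Y w) \<partial>M) = (\<integral>\<^sup>+ w. h w \<partial>M)"
    and A: "A \<in> sets (pre_sigma \<tau>)" and D: "D \<in> sets (F 1)"
  shows "(\<integral>\<^sup>+ w. indicator A w * (ennreal (exp (X w - 1 / 2 * energy (d w))) * indicator D (Y w)) \<partial>M)
    = (\<integral>\<^sup>+ w. indicator A w * indicator D w \<partial>M)"
proof -
  let ?R = "\<lambda>w. ennreal (exp (X w - 1 / 2 * energy (d w)))"
  have di: "sqint d" using d by (simp add: sq_adapted_def)
  have [measurable]: "X \<in> borel_measurable M" using X by (simp add: ito_L2_def)
  have [measurable]: "(\<lambda>w. energy (d w)) \<in> borel_measurable M"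
    by (rule energy_measurable[OF sqint_measurable[OF di]])
  have AM [measurable]: "A \<in> sets M" by (rule pre_sigma_subset_M[OF A])
  have Rm [measurable]: "?R \<in> borel_measurable M" by measurable
  have R1: "(\<integral>\<^sup>+ w. ?R w \<partial>M) = 1" using law[of "\<lambda>_. 1"] by (simp add: emeasure_space_1)
  define m1 where "m1 = distr (density M (\<lambda>w. indicator A w * ?R w)) M Y"
  define m2 where "m2 = density M (indicator A)"
  have em1: "emeasure m1 D = (\<integral>\<^sup>+ w. indicator A w * (?R w * indicator D (Y w)) \<partial>M)" if [measurable]: "D \<in> sets M" for D
  proof -
    have "emeasure m1 D = emeasure (density M (\<lambda>w. indicator A w * ?R w)) (Y -` D \<inter> space M)"
      unfolding m1_def by (subst emeasure_distr) auto
    also have "\<dots> = (\<integral>\<^sup>+ w. indicator A w * ?R w * indicator (Y -` D \<inter> space M) w \<partial>M)"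
      by (rule emeasure_density) auto
    also have "\<dots> = (\<integral>\<^sup>+ w. indicator A w * (?R w * indicator D (Y w)) \<partial>M)"
      by (intro nn_integral_cong) (auto simp: indicator_def)
    finally show ?thesis .
  qed
  have em2: "emeasure m2 D = (\<integral>\<^sup>+ w. indicator A w * indicator D w \<partial>M)" if "D \<in> sets M" for D
    unfolding m2_def using that by (subst emeasure_density) auto
  have "emeasure m1 D = emeasure m2 D"
  proof (rule cylinder_eqI[OF _ _ _ _ _ _ _ D])
    show "sets m1 = sets M" "sets m2 = sets M" by (auto simp: m1_def m2_def)
    have s: "space m1 = space M" "space m2 = space M" by (auto simp: m1_def m2_def)
    show "finite_measure m1"
    proof
      have "emeasure m1 (space M) \<le> (\<integral>\<^sup>+ w. ?R w \<partial>M)"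
        unfolding em1[OF sets.top] by (rule nn_integral_mono) (auto simp: indicator_def)
      then show "emeasure m1 (space m1) \<noteq> \<infinity>" using R1 by (auto simp: s top_unique)
    qed
    show "finite_measure m2"
    proof
      have "emeasure m2 (space M) \<le> (\<integral>\<^sup>+ w. 1 \<partial>M)"
        unfolding em2[OF sets.top] by (rule nn_integral_mono) (auto simp: indicator_def)
      then show "emeasure m2 (space m2) \<noteq> \<infinity>" by (auto simp: s top_unique emeasure_space_1)
    qed
    show "absolutely_continuous M m1"
      unfolding absolutely_continuous_def
    proof
      fix N assume N: "N \<in> null_sets M"
      then have [measurable]: "N \<in> sets M" by auto
      have "emeasure m1 N \<le> (\<integral>\<^sup>+ w. ?R w * indicator N (Y w) \<partial>M)"
        unfolding em1[OF \<open>N \<in> sets M\<close>] by (rule nn_integral_mono) (auto simp: indicator_def)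
      also have "\<dots> = (\<integral>\<^sup>+ w. indicator N w \<partial>M)" by (rule law) simp
      also have "\<dots> = 0" using N by auto
      finally show "N \<in> null_sets m1" by (auto simp: null_sets_def m1_def)
    qed
    show "absolutely_continuous M m2"
      unfolding absolutely_continuous_def
    proof
      fix N assume N: "N \<in> null_sets M"
      then have [measurable]: "N \<in> sets M" by auto
      have "emeasure m2 N \<le> (\<integral>\<^sup>+ w. indicator N w \<partial>M)"
        unfolding em2[OF \<open>N \<in> sets M\<close>] by (rule nn_integral_mono) (auto simp: indicator_def)
      also have "\<dots> = 0" using N by auto
      finally show "N \<in> null_sets m2" by (auto simp: null_sets_def m2_def)
    qed
    fix J :: "real set" and C :: "real \<Rightarrow> (real^'n) set"
    assume J: "finite J" "J \<subseteq> {0..1}" and C: "\<And>s. closed (C s)"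
    let ?K = "{w\<in>space M. \<forall>s\<in>J. \<beta> w s \<in> C s}"
    show "emeasure m1 ?K = emeasure m2 ?K"
    \<comment> \<open>The cutoff does not converge to the indicator of an empty set, so a cylinder
      with an empty constraint is treated separately.\<close>
    proof (cases "\<exists>s\<in>J. C s = {}")
      case True
      then have "?K = {}" by auto
      then show ?thesis by (simp only: emeasure_empty)
    next
      case False
      let ?g = "\<lambda>n s. closed_cutoff n (C s)"
      let ?P = "\<lambda>n w. \<Prod>s\<in>J. ennreal (?g n s (\<beta> w s))"
      have gm [measurable]: "?g n s \<in> borel_measurable borel" for n s
        by (rule borel_measurable_continuous_onI[OF closed_cutoff_continuous])
      have P1: "?P n w \<le> 1" for n w
        by (simp add: prod_ennreal ennreal_le_1 prod_le_1 closed_cutoff_bounds)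
      have Pm [measurable]: "?P n \<in> borel_measurable M" for n
      proof (rule borel_measurable_prod_ennreal)
        fix s assume "s \<in> J"
        then have [measurable]: "(\<lambda>w. \<beta> w s) \<in> borel_measurable M" using \<beta>_measurable[of s] J(2) by blast
        show "(\<lambda>w. ennreal (?g n s (\<beta> w s))) \<in> borel_measurable M" by measurable
      qed
      have PYm [measurable]: "(\<lambda>w. ?P n (Y w)) \<in> borel_measurable M" for n
        by (rule measurable_compose[OF Y Pm])
      have Km [measurable]: "?K \<in> sets M"
      proof -
        have "{w\<in>space M. \<beta> w s \<in> C s} \<in> sets M" if "s \<in> J" for s
        proof -
          have [measurable]: "(\<lambda>w. \<beta> w s) \<in> borel_measurable M" using \<beta>_measurable[of s] that J(2) by blast
          have [measurable]: "C s \<in> sets borel" using C by auto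
          show ?thesis by measurable
        qed
        then show ?thesis using J(1) by (intro sets.sets_Collect_finite_All) auto
      qed
      have lim: "(\<lambda>n. ?P n w) \<longlonglongrightarrow> indicator ?K w" if "w \<in> space M" for w
      proof -
        have "(\<lambda>n. \<Prod>s\<in>J. ?g n s (\<beta> w s)) \<longlonglongrightarrow> (\<Prod>s\<in>J. indicat_real (C s) (\<beta> w s))"
          using False C by (intro tendsto_prod closed_cutoff_tendsto) auto
        moreover have "(\<Prod>s\<in>J. indicat_real (C s) (\<beta> w s)) = indicat_real ?K w"
          using J(1) that by (auto simp: indicator_def prod_zero_iff)
        ultimately have "(\<lambda>n. ennreal (\<Prod>s\<in>J. ?g n s (\<beta> w s))) \<longlonglongrightarrow> ennreal (indicat_real ?K w)"
          by (intro tendsto_ennrealI) simp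
        then show ?thesis
          by (simp add: prod_ennreal ennreal_indicator closed_cutoff_bounds)
      qed
      have "(\<lambda>n. \<integral>\<^sup>+ w. indicator A w * (?R w * ?P n (Y w)) \<partial>M) \<longlonglongrightarrow> (\<integral>\<^sup>+ w. indicator A w * (?R w * indicator ?K (Y w)) \<partial>M)"
      proof (rule nn_integral_dominated_convergence[where w = ?R])
        show "AE w in M. indicator A w * (?R w * ?P n (Y w)) \<le> ?R w" for n
        proof (rule AE_I2)
          fix w
          show "indicator A w * (?R w * ?P n (Y w)) \<le> ?R w"
            using mult_left_mono[OF P1[of n "Y w"], of "?R w"] by (auto simp: indicator_def)
        qed
        show "(\<integral>\<^sup>+ w. ?R w \<partial>M) < \<infinity>" using R1 by simp
        show "AE w in M. (\<lambda>n. indicator A w * (?R w * ?P n (Y w))) \<longlonglongrightarrow> indicator A w * (?R w * indicator ?K (Y w))"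
        proof (rule AE_I2)
          fix w assume "w \<in> space M"
          then have "Y w \<in> space M" using measurable_space[OF Y] by blast
          then have "(\<lambda>n. ?P n (Y w)) \<longlonglongrightarrow> indicator ?K (Y w)" by (rule lim)
          then show "(\<lambda>n. indicator A w * (?R w * ?P n (Y w))) \<longlonglongrightarrow> indicator A w * (?R w * indicator ?K (Y w))"
            by (intro ennreal_tendsto_cmult) (auto simp: indicator_def)
        qed
      qed measurable
      moreover have "(\<lambda>n. \<integral>\<^sup>+ w. indicator A w * ?P n w \<partial>M) \<longlonglongrightarrow> (\<integral>\<^sup>+ w. indicator A w * indicator ?K w \<partial>M)"
      proof (rule nn_integral_dominated_convergence[where w = "\<lambda>_. 1"])
        show "AE w in M. indicator A w * ?P n w \<le> 1" for n
          using P1[of n] by (intro AE_I2) (auto simp: indicator_def)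
        show "(\<integral>\<^sup>+ w. 1 \<partial>M) < \<infinity>" by (simp add: emeasure_space_1)
        show "AE w in M. (\<lambda>n. indicator A w * ?P n w) \<longlonglongrightarrow> indicator A w * indicator ?K w"
          by (intro AE_I2 ennreal_tendsto_cmult lim) (auto simp: indicator_def)
      qed measurable
      moreover have "(\<integral>\<^sup>+ w. indicator A w * (?R w * ?P n (Y w)) \<partial>M) = (\<integral>\<^sup>+ w. indicator A w * ?P n w \<partial>M)" for n
        by (rule girsanov_event_eq[OF d z X Y \<beta>Y law A J]) (auto intro: closed_cutoff_continuous closed_cutoff_bounds)
      ultimately have "(\<integral>\<^sup>+ w. indicator A w * (?R w * indicator ?K (Y w)) \<partial>M) = (\<integral>\<^sup>+ w. indicator A w * indicator ?K w \<partial>M)"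
        using LIMSEQ_unique by fastforce
      then show ?thesis using em1[OF Km] em2[OF Km] by simp
    qed
  qed
  moreover have "D \<in> sets M" using D sets_F_subset by blast
  ultimately show ?thesis using em1[of D] em2[of D] by simp
qed

text \<open>For a general completed filtration this would be false: it uses that the filtration is
  generated by the Brownian motion \<open>\<beta>\<close>, which \<open>Y\<close> shifts only after \<open>\<tau>\<close>.\<close>

lemma stopped_invariant:
  assumes d: "sq_adapted d" and z: "\<And>w s. s \<le> \<tau> w \<Longrightarrow> d w s = 0"
    and X: "ito_L2 d X" and Y [measurable]: "Y \<in> M \<rightarrow>\<^sub>M M"
    and \<beta>Y: "AE w in M. \<forall>s\<in>{0..1}. \<beta> (Y w) s = \<beta> w s - (LINT r:{0..s}|lborel. d w r)"
    and law: "\<And>h. h \<in> borel_measurable M \<Longrightarrow>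
       (\<integral>\<^sup>+ w. ennreal (exp (X w - 1 / 2 * energy (d w))) * h (Y w) \<partial>M) = (\<integral>\<^sup>+ w. h w \<partial>M)"
    and A: "A \<in> sets (pre_sigma \<tau>)"
  shows "AE w in M. Y w \<in> A \<longleftrightarrow> w \<in> A"
proof -
  let ?R = "\<lambda>w. ennreal (exp (X w - 1 / 2 * energy (d w)))"
  have di: "sqint d" using d by (simp add: sq_adapted_def)
  have [measurable]: "X \<in> borel_measurable M" using X by (simp add: ito_L2_def)
  have [measurable]: "(\<lambda>w. energy (d w)) \<in> borel_measurable M"
    by (rule energy_measurable[OF sqint_measurable[OF di]])
  have imp: "AE w in M. w \<in> B \<longrightarrow> Y w \<in> B" if B: "B \<in> sets (pre_sigma \<tau>)" for B
  proof -
    have BM [measurable]: "B \<in> sets M" by (rule pre_sigma_subset_M[OF B])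
    \<comment> \<open>With the complement of B as second event the right side vanishes; since the
      density is strictly positive, Y almost surely maps points of B into B.\<close>
    have "space M - B \<in> sets (F 1)" using pre_sigma_subset_F1 compl_pre_sigma[OF B] by blast
    from stopped_event_eq[OF d z X Y \<beta>Y law B this]
    have "(\<integral>\<^sup>+ w. indicator B w * (?R w * indicator (space M - B) (Y w)) \<partial>M)
      = (\<integral>\<^sup>+ w. indicator B w * indicator (space M - B) w \<partial>M)" .
    also have "\<dots> = (\<integral>\<^sup>+ w. 0 \<partial>M)"
      by (intro nn_integral_cong) (auto simp: indicator_def)
    also have "\<dots> = 0" by simp
    finally have "(\<integral>\<^sup>+ w. indicator B w * (?R w * indicator (space M - B) (Y w)) \<partial>M) = 0" .
    moreover have "(\<lambda>w. indicator B w * (?R w * indicator (space M - B) (Y w))) \<in> borel_measurable M" by measurable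
    ultimately have "AE w in M. indicator B w * (?R w * indicator (space M - B) (Y w)) = 0"
      using nn_integral_0_iff_AE by blast
    with AE_space show ?thesis
    proof eventually_elim
      case (elim w)
      then show ?case using measurable_space[OF Y elim(1)] by (auto simp: indicator_def split: if_splits)
    qed
  qed
  have "AE w in M. w \<in> space M - A \<longrightarrow> Y w \<in> space M - A" by (rule imp[OF compl_pre_sigma[OF A]])
  with imp[OF A] AE_space show ?thesis by eventually_elim auto
qed

text \<open>Two different reals are separated by a rational, so invariance of the countably many
  rational level sets suffices.\<close>

lemma stopped_invariant_fun:
  fixes L :: "'n path \<Rightarrow> real"
  assumes inv: "\<And>A. A \<in> sets (pre_sigma \<tau>) \<Longrightarrow> AE w in M. Y w \<in> A \<longleftrightarrow> w \<in> A"
    and L: "L \<in> borel_measurable (pre_sigma \<tau>)" and Y: "Y \<in> M \<rightarrow>\<^sub>M M"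
  shows "AE w in M. L (Y w) = L w"
proof -
  have "AE w in M. Y w \<in> {w\<in>space M. of_rat q < L w} \<longleftrightarrow> w \<in> {w\<in>space M. of_rat q < L w}" for q
  proof (rule inv)
    have "{w\<in>space (pre_sigma \<tau>). of_rat q < L w} \<in> sets (pre_sigma \<tau>)" using L by measurable
    then show "{w\<in>space M. of_rat q < L w} \<in> sets (pre_sigma \<tau>)" by (simp add: space_pre_sigma)
  qed
  then have "AE w in M. \<forall>q::rat. Y w \<in> {w\<in>space M. of_rat q < L w} \<longleftrightarrow> w \<in> {w\<in>space M. of_rat q < L w}"
    unfolding AE_all_countable by blast
  with AE_space show ?thesis
  proof eventually_elim
    case (elim w)
    have "Y w \<in> space M" using measurable_space[OF Y elim(1)] .
    then have iff: "\<And>q::rat. of_rat q < L (Y w) \<longleftrightarrow> of_rat q < L w" using elim by auto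
    show ?case
    proof (rule ccontr)
      assume "L (Y w) \<noteq> L w"
      then consider "L (Y w) < L w" | "L w < L (Y w)" by linarith
      then show False
      proof cases
        case 1
        then obtain q where "L (Y w) < of_rat q" "of_rat q < L w" using of_rat_dense by blast
        then show ?thesis using iff[of q] by simp
      next
        case 2
        then obtain q where "L w < of_rat q" "of_rat q < L (Y w)" using of_rat_dense by blast
        then show ?thesis using iff[of q] by simp
      qed
    qed
  qed
qed

end

section \<open>The conditional variational inequality\<close>

text \<open>Here a and b stand for the conditional means of the positive and negative part of the
  cost, l for ln L, and x for the common conditional mean of the two parts of X. Finite x cancels; a
  may be infinite.\<close>

lemma ennreal_diff_pos_neg_le:
  assumes le: "b + ((1 + x) + ennreal (- l)) \<le> a + ((1 + x) + ennreal l)" and b: "b \<noteq> \<top>" and x: "x \<noteq> \<top>"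
  shows "ereal (- l) \<le> enn2ereal a - enn2ereal b"
proof -
  have "(1 + x) + (b + ennreal (- l)) \<le> (1 + x) + (a + ennreal l)"
    using le by (simp only: add.left_commute)
  moreover have "1 + x \<noteq> \<top>" using x by simp
  ultimately have *: "b + ennreal (- l) \<le> a + ennreal l"
    by (simp only: ennreal_add_left_cancel_le) auto
  obtain b' where b': "b = ennreal b'" "0 \<le> b'" using b by (cases b) auto
  show ?thesis
  proof (cases a)
    case top then show ?thesis using b' by simp
  next
    case (real a')
    have "ennreal (b' + max 0 (- l)) \<le> ennreal (a' + max 0 l)"
    proof -
      have "ennreal (b' + max 0 (- l)) = b + ennreal (- l)" "ennreal (a' + max 0 l) = a + ennreal l"
        using b' real by simp_all
      then show ?thesis using * by simp
    qed
    then have "b' + max 0 (- l) \<le> a' + max 0 l"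
      using real by (subst (asm) ennreal_le_iff) auto
    then show ?thesis using real b' by (simp add: max_def split: if_splits)
  qed
qed

text \<open>In the case of equality the finiteness of a follows from that of b.\<close>

lemma ennreal_diff_pos_neg_eq:
  assumes eq: "a + (x + ennreal l) = b + (x + ennreal (- l))" and b: "b \<noteq> \<top>" and x: "x \<noteq> \<top>"
  shows "enn2ereal a - enn2ereal b = ereal (- l)"
proof -
  have "x + (a + ennreal l) = x + (b + ennreal (- l))"
    using eq by (simp only: add.left_commute)
  then have *: "a + ennreal l = b + ennreal (- l)"
    using x by (simp only: ennreal_add_left_cancel) auto
  obtain b' where b': "b = ennreal b'" "0 \<le> b'" using b by (cases b) auto
  have "a \<noteq> \<top>"
  proof
    assume "a = \<top>"
    then have "b + ennreal (- l) = \<top>" using * by simp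
    then show False using b by simp
  qed
  then obtain a' where a': "a = ennreal a'" "0 \<le> a'" by (cases a) auto
  have "ennreal (a' + max 0 l) = a + ennreal l" "ennreal (b' + max 0 (- l)) = b + ennreal (- l)"
    using a' b' by simp_all
  then have "ennreal (a' + max 0 l) = ennreal (b' + max 0 (- l))"
    using * by simp
  then have "a' + max 0 l = b' + max 0 (- l)"
    using a' b' by (subst (asm) ennreal_inj) auto
  then show ?thesis using a' b' by (simp add: max_def split: if_splits)
qed

lemma enn2real_injD: "enn2real a = enn2real b \<Longrightarrow> a \<noteq> \<infinity> \<Longrightarrow> b \<noteq> \<infinity> \<Longrightarrow> a = b"
  by (cases a; cases b) auto

text \<open>\<open>ennreal\<close> sends negative reals to 0, so \<open>ennreal x\<close> and
  \<open>ennreal (- x)\<close> are the positive and negative part of x; every subtraction is moved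
  to the other side.\<close>

lemma ennreal_pos_neg_le:
  assumes "1 + (x - t - l) \<le> r"
  shows "ennreal (- t) + ((1 + ennreal x) + ennreal (- l)) \<le> ennreal t + ((ennreal r + ennreal (- x)) + ennreal l)"
proof -
  have "max 0 (- t) + ((1 + max 0 x) + max 0 (- l)) \<le> max 0 t + ((max 0 r + max 0 (- x)) + max 0 l)"
    using assms by (simp add: max_def)
  then have "ennreal (max 0 (- t) + ((1 + max 0 x) + max 0 (- l))) \<le> ennreal (max 0 t + ((max 0 r + max 0 (- x)) + max 0 l))"
    by (rule ennreal_leI)
  then show ?thesis by simp
qed

lemma ennreal_pos_neg_eq:
  assumes "x - t - l = 0"
  shows "ennreal t + (ennreal (- x) + ennreal l) = ennreal (- t) + (ennreal x + ennreal (- l))"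
proof -
  have "max 0 t + (max 0 (- x) + max 0 l) = max 0 (- t) + (max 0 x + max 0 (- l))"
    using assms by (simp add: max_def)
  then have "ennreal (max 0 t + (max 0 (- x) + max 0 l)) = ennreal (max 0 (- t) + (max 0 x + max 0 (- l)))"
    by simp
  then show ?thesis by simp
qed

section \<open>Conditioning on the past of the stopping time\<close>

context stopped_brownian
begin

lemma finite_measure_subalgebra_pre_sigma: "finite_measure_subalgebra M (pre_sigma \<tau>)"
  by unfold_locales (rule subalgebra_pre_sigma)

lemma nn_cond_exp_finite:
  assumes [measurable]: "h \<in> borel_measurable M" and fin: "(\<integral>\<^sup>+ w. h w \<partial>M) < \<infinity>"
  shows "AE w in M. nn_cond_exp M (pre_sigma \<tau>) h w \<noteq> \<top>"
proof -
  interpret C: finite_measure_subalgebra M "pre_sigma \<tau>" by (rule finite_measure_subalgebra_pre_sigma)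
  have "(\<integral>\<^sup>+ w. nn_cond_exp M (pre_sigma \<tau>) h w \<partial>M) = (\<integral>\<^sup>+ w. h w \<partial>M)"
    using C.nn_cond_exp_intg[of "\<lambda>_. 1" h] by simp
  then show ?thesis using fin by (intro nn_integral_noteq_infinite[unfolded infinity_ennreal_def]) auto
qed

text \<open>T is tied to the cost only almost surely because the cost is later expressed through
  \<open>cm_norm\<close>, whereas the argument uses the energy of the version d. Only
  \<open>nn_cond_exp\<close> is applied to it, so a positive part with infinite conditional mean is
  allowed.\<close>

lemma cond_exp_stopped_drift:
  fixes f :: "'n path \<Rightarrow> real"
  assumes d: "sq_adapted d" and z: "\<And>w s. s \<le> \<tau> w \<Longrightarrow> d w s = 0"
    and X: "ito_L2 d X" and Y [measurable]: "Y \<in> M \<rightarrow>\<^sub>M M"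
    and \<beta>Y: "AE w in M. \<forall>s\<in>{0..1}. \<beta> (Y w) s = \<beta> w s - (LINT r:{0..s}|lborel. d w r)"
    and law: "\<And>h. h \<in> borel_measurable M \<Longrightarrow>
       (\<integral>\<^sup>+ w. ennreal (exp (X w - 1 / 2 * energy (d w))) * h (Y w) \<partial>M) = (\<integral>\<^sup>+ w. h w \<partial>M)"
    and f [measurable]: "f \<in> borel_measurable M" and fi: "integrable M (\<lambda>w. exp (- f w))"
    and T [measurable]: "T \<in> borel_measurable M" and TY: "AE w in M. T w = f (Y w) + 1 / 2 * energy (d w)"
  defines "L \<equiv> real_cond_exp M (pre_sigma \<tau>) (\<lambda>w. exp (- f w))"
  shows "AE w in M. ereal (- ln (L w)) \<le> ext_cond_exp M (pre_sigma \<tau>) T w"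
    and "(AE w in M. exp (X w - 1 / 2 * energy (d w)) * (exp (- f (Y w)) / L (Y w)) = 1) \<Longrightarrow>
       AE w in M. ext_cond_exp M (pre_sigma \<tau>) T w = ereal (- ln (L w))"
proof -
  interpret C: finite_measure_subalgebra M "pre_sigma \<tau>" by (rule finite_measure_subalgebra_pre_sigma)
  let ?E = "nn_cond_exp M (pre_sigma \<tau>)"
  let ?\<rho> = "\<lambda>w. exp (X w - 1 / 2 * energy (d w))"
  have di: "sqint d" using d by (simp add: sq_adapted_def)
  have Xm [measurable]: "X \<in> borel_measurable M" using X by (simp add: ito_L2_def)
  have [measurable]: "(\<lambda>w. energy (d w)) \<in> borel_measurable M"
    by (rule energy_measurable[OF sqint_measurable[OF di]])
  have LF [measurable]: "L \<in> borel_measurable (pre_sigma \<tau>)" unfolding L_def by simp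
  have Lm [measurable]: "L \<in> borel_measurable M" unfolding L_def by simp
  have fY [measurable]: "(\<lambda>w. f (Y w)) \<in> borel_measurable M" by (rule measurable_compose[OF Y f])
  have LYm [measurable]: "(\<lambda>w. L (Y w)) \<in> borel_measurable M" by (rule measurable_compose[OF Y Lm])
  have Xi: "integrable M X" by (rule ito_L2_expectation(1)[OF X])
  have Lpos: "AE w in M. 0 < L w"
    unfolding L_def by (rule C.real_cond_exp_gr_c[OF fi]) auto
  have LY: "AE w in M. L (Y w) = L w"
    by (rule stopped_invariant_fun[OF stopped_invariant[OF d z X Y \<beta>Y law] LF Y]) auto
  \<comment> \<open>\<open>real_cond_exp\<close> passes through \<open>enn2real\<close>, which
    forgets infinite values; integrability of exp(-f) excludes them.\<close>
  have EL: "AE w in M. ?E (\<lambda>w. ennreal (exp (- f w))) w = ennreal (L w)"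
  proof -
    have "(\<integral>\<^sup>+ w. ennreal (exp (- f w)) \<partial>M) < \<infinity>"
      using fi by (simp add: integrable_iff_bounded)
    from nn_cond_exp_finite[OF _ this] have "AE w in M. ?E (\<lambda>w. ennreal (exp (- f w))) w \<noteq> \<top>" by simp
    moreover have "AE w in M. 0 = ?E (\<lambda>w. ennreal (- exp (- f w))) w"
      using C.nn_cond_exp_F_meas[of "\<lambda>_. 0"] by (simp add: ennreal_neg)
    ultimately show ?thesis
    proof eventually_elim
      case (elim w)
      have "L w = enn2real (?E (\<lambda>w. ennreal (exp (- f w))) w)"
        using elim(2) by (simp add: L_def real_cond_exp_def)
      then show ?case using elim(1) by (simp add: less_top)
    qed
  qed
  define q where "q w = exp (- f w) / L w" for w
  have qm [measurable]: "q \<in> borel_measurable M" unfolding q_def by measurable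
  have qYm [measurable]: "(\<lambda>w. q (Y w)) \<in> borel_measurable M" by (rule measurable_compose[OF Y qm])

  \<comment> \<open>Tested on A: invariance moves the indicator of A inside the composition with Y,
    the law of Y removes the density, and L cancels against the conditional mean of exp(-f).\<close>
  have E1: "AE w in M. 1 = ?E (\<lambda>w. ennreal (?\<rho> w) * ennreal (q (Y w))) w"
  proof (rule C.nn_cond_exp_charact)
    fix A assume A: "A \<in> sets (pre_sigma \<tau>)"
    have AM [measurable]: "A \<in> sets M" by (rule pre_sigma_subset_M[OF A])
    have inv: "AE w in M. Y w \<in> A \<longleftrightarrow> w \<in> A" by (rule stopped_invariant[OF d z X Y \<beta>Y law A])
    have "(\<integral>\<^sup>+ w\<in>A. (ennreal (?\<rho> w) * ennreal (q (Y w))) \<partial>M)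
      = (\<integral>\<^sup>+ w. ennreal (?\<rho> w) * (ennreal (q (Y w)) * indicator A (Y w)) \<partial>M)"
      by (rule nn_integral_cong_AE) (use inv in \<open>auto simp: mult.assoc indicator_def elim!: eventually_mono\<close>)
    also have "\<dots> = (\<integral>\<^sup>+ w. ennreal (q w) * indicator A w \<partial>M)"
      by (rule law[of "\<lambda>w. ennreal (q w) * indicator A w"]) measurable
    also have "\<dots> = (\<integral>\<^sup>+ w. (ennreal (1 / L w) * indicator A w) * ennreal (exp (- f w)) \<partial>M)"
    proof (rule nn_integral_cong_AE)
      show "AE w in M. ennreal (q w) * indicator A w = (ennreal (1 / L w) * indicator A w) * ennreal (exp (- f w))"
        using Lpos
      proof eventually_elim
        case (elim w)
        then have "ennreal (q w) = ennreal (1 / L w) * ennreal (exp (- f w))"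
          by (simp add: q_def ennreal_mult[symmetric])
        then show ?case by (simp add: mult_ac)
      qed
    qed
    also have "\<dots> = (\<integral>\<^sup>+ w. (ennreal (1 / L w) * indicator A w) * ?E (\<lambda>w. ennreal (exp (- f w))) w \<partial>M)"
    proof -
      note [measurable] = A
      show ?thesis by (rule C.nn_cond_exp_intg[symmetric]) measurable
    qed
    also have "\<dots> = (\<integral>\<^sup>+ w. 1 * indicator A w \<partial>M)"
    proof (rule nn_integral_cong_AE)
      show "AE w in M. (ennreal (1 / L w) * indicator A w) * ?E (\<lambda>w. ennreal (exp (- f w))) w = 1 * indicator A w"
        using Lpos EL
      proof eventually_elim
        case (elim w)
        then have "ennreal (1 / L w) * ennreal (L w) = 1"
          by (simp add: ennreal_mult[symmetric])
        then show ?case using elim by (metis mult.assoc mult.commute)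
      qed
    qed
    finally show "(\<integral>\<^sup>+ w\<in>A. (ennreal (?\<rho> w) * ennreal (q (Y w))) \<partial>M) = (\<integral>\<^sup>+ w\<in>A. 1 \<partial>M)" .
  qed measurable
  have Xfin: "(\<integral>\<^sup>+ w. ennreal (X w) \<partial>M) < \<infinity>" "(\<integral>\<^sup>+ w. ennreal (- X w) \<partial>M) < \<infinity>"
    using Xi real_integrable_def[of M X] by (auto simp: less_top)
  have E2: "AE w in M. ?E (\<lambda>w. ennreal (X w)) w = ?E (\<lambda>w. ennreal (- X w)) w"
  proof -
    have "AE w in M. ?E (\<lambda>w. ennreal (- X w)) w = ?E (\<lambda>w. ennreal (X w)) w"
    proof (rule C.nn_cond_exp_charact)
      fix A assume A: "A \<in> sets (pre_sigma \<tau>)"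
      have AM [measurable]: "A \<in> sets M" by (rule pre_sigma_subset_M[OF A])
      have iA: "integrable M (\<lambda>w. indicat_real A w * X w)"
        using integrable_mult_indicator[OF AM Xi] by simp
      have fin: "(\<integral>\<^sup>+ w. ennreal (indicat_real A w * X w) \<partial>M) \<noteq> \<infinity>" "(\<integral>\<^sup>+ w. ennreal (- (indicat_real A w * X w)) \<partial>M) \<noteq> \<infinity>"
        using iA real_integrable_def[of M "\<lambda>w. indicat_real A w * X w"] by auto
      have "enn2real (\<integral>\<^sup>+ w. ennreal (indicat_real A w * X w) \<partial>M) = enn2real (\<integral>\<^sup>+ w. ennreal (- (indicat_real A w * X w)) \<partial>M)"
        using ito_L2_event_expectation[OF d z A X] real_lebesgue_integral_def[OF iA] by simp
      then have "(\<integral>\<^sup>+ w. ennreal (indicat_real A w * X w) \<partial>M) = (\<integral>\<^sup>+ w. ennreal (- (indicat_real A w * X w)) \<partial>M)"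
        using fin by (rule enn2real_injD)
      moreover have "(\<integral>\<^sup>+ w\<in>A. ennreal (X w) \<partial>M) = (\<integral>\<^sup>+ w. ennreal (indicat_real A w * X w) \<partial>M)"
        "(\<integral>\<^sup>+ w\<in>A. ennreal (- X w) \<partial>M) = (\<integral>\<^sup>+ w. ennreal (- (indicat_real A w * X w)) \<partial>M)"
        by (auto intro!: nn_integral_cong simp: indicator_def)
      ultimately have "(\<integral>\<^sup>+ w\<in>A. ennreal (X w) \<partial>M) = (\<integral>\<^sup>+ w\<in>A. ennreal (- X w) \<partial>M)" by simp
      also have "\<dots> = (\<integral>\<^sup>+ w\<in>A. ?E (\<lambda>w. ennreal (- X w)) w \<partial>M)"
      proof -
        note [measurable] = A
        show ?thesis
          using C.nn_cond_exp_intg[of "indicator A" "\<lambda>w. ennreal (- X w)"] by (simp add: mult.commute)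
      qed
      finally show "(\<integral>\<^sup>+ w\<in>A. ennreal (X w) \<partial>M) = (\<integral>\<^sup>+ w\<in>A. ?E (\<lambda>w. ennreal (- X w)) w \<partial>M)" .
    qed measurable
    then show ?thesis by eventually_elim simp
  qed
  have E2fin: "AE w in M. ?E (\<lambda>w. ennreal (- X w)) w \<noteq> \<top>"
    by (rule nn_cond_exp_finite[OF _ Xfin(2)]) measurable
  \<comment> \<open>The density times exp(-f) composed with Y equals exp(X - T), which is at least 1
    + X - T. So the negative part of T is dominated by this term plus |X|, and the law of Y shows
    that the bound is integrable.\<close>
  have E3: "AE w in M. ?E (\<lambda>w. ennreal (- T w)) w \<noteq> \<top>"
  proof (rule nn_cond_exp_finite)
    have "(\<integral>\<^sup>+ w. ennreal (- T w) \<partial>M) \<le> (\<integral>\<^sup>+ w. ennreal (?\<rho> w) * ennreal (exp (- f (Y w))) + ennreal \<bar>X w\<bar> \<partial>M)"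
    proof (rule nn_integral_mono_AE)
      show "AE w in M. ennreal (- T w) \<le> ennreal (?\<rho> w) * ennreal (exp (- f (Y w))) + ennreal \<bar>X w\<bar>"
        using TY
      proof eventually_elim
        case (elim w)
        have "?\<rho> w * exp (- f (Y w)) = exp (X w - T w)"
          unfolding exp_add[symmetric] elim by (simp add: algebra_simps)
        moreover have "1 + (X w - T w) \<le> exp (X w - T w)" by (rule exp_ge_add_one_self)
        ultimately have "- T w \<le> ?\<rho> w * exp (- f (Y w)) + \<bar>X w\<bar>" by linarith
        then show ?case by (simp add: ennreal_mult[symmetric] ennreal_plus[symmetric] ennreal_leI del: ennreal_plus)
      qed
    qed
    also have "\<dots> = (\<integral>\<^sup>+ w. ennreal (exp (- f w)) \<partial>M) + (\<integral>\<^sup>+ w. ennreal \<bar>X w\<bar> \<partial>M)"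
      by (subst nn_integral_add, measurable, subst law[of "\<lambda>w. ennreal (exp (- f w))"], measurable)
    also have "\<dots> < \<infinity>"
      using fi Xi by (simp add: integrable_iff_bounded)
    finally show "(\<integral>\<^sup>+ w. ennreal (- T w) \<partial>M) < \<infinity>" .
  qed measurable

  have sum3: "AE w in M. ?E (\<lambda>w. a w + (b w + c w)) w = ?E a w + (?E b w + ?E c w)"
    if [measurable]: "a \<in> borel_measurable M" "b \<in> borel_measurable M" "c \<in> borel_measurable M" for a b c
  proof -
    have "AE w in M. ?E a w + ?E (\<lambda>w. b w + c w) w = ?E (\<lambda>w. a w + (b w + c w)) w"
      by (rule C.nn_cond_exp_sum) measurable
    moreover have "AE w in M. ?E b w + ?E c w = ?E (\<lambda>w. b w + c w) w"
      by (rule C.nn_cond_exp_sum) measurable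
    ultimately show ?thesis by eventually_elim simp
  qed
  have lF: "AE w in M. ?E (\<lambda>w. ennreal (ln (L w))) w = ennreal (ln (L w))"
    "AE w in M. ?E (\<lambda>w. ennreal (- ln (L w))) w = ennreal (- ln (L w))"
    using C.nn_cond_exp_F_meas[of "\<lambda>w. ennreal (ln (L w))"] C.nn_cond_exp_F_meas[of "\<lambda>w. ennreal (- ln (L w))"]
    by (auto elim: eventually_mono)
  \<comment> \<open>Invariance of L is used here: L at the shifted path is replaced by L itself,
    which makes ln L a quantity of the past of \<tau>.\<close>
  have ln_q: "AE w in M. ?\<rho> w * q (Y w) = exp (X w - T w - ln (L w))"
    using TY LY Lpos
  proof eventually_elim
    case (elim w)
    then have "q (Y w) = exp (- f (Y w)) / exp (ln (L w))" by (simp add: q_def)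
    then show ?case unfolding elim(1) by (simp add: exp_diff[symmetric] exp_add[symmetric] algebra_simps)
  qed

  show "AE w in M. ereal (- ln (L w)) \<le> ext_cond_exp M (pre_sigma \<tau>) T w"
  proof -
    \<comment> \<open>Splitting T, X and ln L into positive and negative parts turns the
      tangent-line inequality for exp into a comparison of sums of nonnegative functions, on which
      conditioning is additive.\<close>
    let ?l = "\<lambda>w. ennreal (T w) + ((ennreal (?\<rho> w) * ennreal (q (Y w)) + ennreal (- X w)) + ennreal (ln (L w)))"
    let ?r = "\<lambda>w. ennreal (- T w) + ((1 + ennreal (X w)) + ennreal (- ln (L w)))"
    have "AE w in M. ?r w \<le> ?l w"
      using ln_q Lpos LY
    proof eventually_elim
      case (elim w)
      have q0: "0 \<le> q (Y w)" using elim by (simp add: q_def)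
      have "1 + (X w - T w - ln (L w)) \<le> ?\<rho> w * q (Y w)"
        unfolding elim(1) by (rule exp_ge_add_one_self)
      then show ?case using ennreal_pos_neg_le[of "X w" "T w" "ln (L w)" "?\<rho> w * q (Y w)"] q0
        by (simp add: ennreal_mult)
    qed
    then have "AE w in M. ?E ?r w \<le> ?E ?l w"
      by (rule C.nn_cond_exp_mono) measurable
    moreover have "AE w in M. ?E ?r w = ?E (\<lambda>w. ennreal (- T w)) w + (?E (\<lambda>w. 1 + ennreal (X w)) w + ?E (\<lambda>w. ennreal (- ln (L w))) w)"
      by (rule sum3) measurable
    moreover have "AE w in M. ?E ?l w = ?E (\<lambda>w. ennreal (T w)) w + (?E (\<lambda>w. ennreal (?\<rho> w) * ennreal (q (Y w)) + ennreal (- X w)) w + ?E (\<lambda>w. ennreal (ln (L w))) w)"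
      by (rule sum3) measurable
    moreover have "AE w in M. ?E (\<lambda>_. 1) w + ?E (\<lambda>w. ennreal (X w)) w = ?E (\<lambda>w. 1 + ennreal (X w)) w"
      by (rule C.nn_cond_exp_sum) measurable
    moreover have "AE w in M. 1 = ?E (\<lambda>_. 1) w"
      by (rule C.nn_cond_exp_F_meas) measurable
    moreover have "AE w in M. ?E (\<lambda>w. ennreal (?\<rho> w) * ennreal (q (Y w))) w + ?E (\<lambda>w. ennreal (- X w)) w
        = ?E (\<lambda>w. ennreal (?\<rho> w) * ennreal (q (Y w)) + ennreal (- X w)) w"
      by (rule C.nn_cond_exp_sum) measurable
    ultimately show ?thesis using E1 E2 E2fin E3 lF
    proof eventually_elim
      case (elim w)
      have "ereal (- ln (L w)) \<le> enn2ereal (?E (\<lambda>w. ennreal (T w)) w) - enn2ereal (?E (\<lambda>w. ennreal (- T w)) w)"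
        by (rule ennreal_diff_pos_neg_le[where x = "?E (\<lambda>w. ennreal (- X w)) w"]) (use elim in simp_all)
      then show ?case by (simp add: ext_cond_exp_def)
    qed
  qed

  show "AE w in M. ext_cond_exp M (pre_sigma \<tau>) T w = ereal (- ln (L w))"
    if one: "AE w in M. exp (X w - 1 / 2 * energy (d w)) * (exp (- f (Y w)) / L (Y w)) = 1"
  proof -
    let ?l = "\<lambda>w. ennreal (T w) + (ennreal (- X w) + ennreal (ln (L w)))"
    let ?r = "\<lambda>w. ennreal (- T w) + (ennreal (X w) + ennreal (- ln (L w)))"
    have "AE w in M. ?l w = ?r w"
      using ln_q one
    proof eventually_elim
      case (elim w)
      then have "exp (X w - T w - ln (L w)) = 1" by (simp add: q_def)
      then have "X w - T w - ln (L w) = 0" by simp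
      then show ?case by (rule ennreal_pos_neg_eq)
    qed
    then have "AE w in M. ?E ?l w = ?E ?r w"
      by (rule C.nn_cond_exp_cong) measurable
    moreover have "AE w in M. ?E ?r w = ?E (\<lambda>w. ennreal (- T w)) w + (?E (\<lambda>w. ennreal (X w)) w + ?E (\<lambda>w. ennreal (- ln (L w))) w)"
      by (rule sum3) measurable
    moreover have "AE w in M. ?E ?l w = ?E (\<lambda>w. ennreal (T w)) w + (?E (\<lambda>w. ennreal (- X w)) w + ?E (\<lambda>w. ennreal (ln (L w))) w)"
      by (rule sum3) measurable
    ultimately show ?thesis using E2 E2fin E3 lF
    proof eventually_elim
      case (elim w)
      have "enn2ereal (?E (\<lambda>w. ennreal (T w)) w) - enn2ereal (?E (\<lambda>w. ennreal (- T w)) w) = ereal (- ln (L w))"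
        by (rule ennreal_diff_pos_neg_eq[where x = "?E (\<lambda>w. ennreal (- X w)) w"]) (use elim in simp_all)
      then show ?case by (simp add: ext_cond_exp_def)
    qed
  qed
qed

end

section \<open>Cameron--Martin derivatives\<close>

text \<open>The positive and negative parts of g, as densities on [0,1], have the same finite mass
  on every half-line and therefore define the same measure.\<close>

lemma AE_eq_0_if_initial_integrals_eq_0:
  fixes g :: "real \<Rightarrow> real"
  assumes [measurable]: "g \<in> borel_measurable borel" and i: "set_integrable lborel {0..1} g"
    and z: "\<And>t. t \<in> {0..1} \<Longrightarrow> (LINT s:{0..t}|lborel. g s) = 0"
  shows "AE s in lborel. s \<in> {0..1} \<longrightarrow> g s = 0"
proof -
  let ?p = "\<lambda>s. ennreal (indicat_real {0..1} s * g s)" and ?n = "\<lambda>s. ennreal (- (indicat_real {0..1} s * g s))"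
  have i1: "integrable lborel (\<lambda>s. indicat_real S s * (indicat_real {0..1} s * g s))" if "S \<in> sets borel" for S
    using integrable_mult_indicator[OF _ i[unfolded set_integrable_def], of S] that by simp
  have zero: "(LINT s|lborel. indicat_real {x<..} s * (indicat_real {0..1} s * g s)) = 0" for x
  proof -
    have full: "(LINT s|lborel. indicat_real {0..1} s * g s) = 0"
      using z[of 1] by (simp add: set_lebesgue_integral_def)
    consider "x < 0" | "x \<in> {0..1}" | "1 < x" by force
    then show ?thesis
    proof cases
      case 1
      then have "indicat_real {x<..} s * (indicat_real {0..1} s * g s) = indicat_real {0..1} s * g s" for s
        by (auto simp: indicator_def)
      then show ?thesis using full by (simp only:)
    next
      case 2
      then have "indicat_real {x<..} s * (indicat_real {0..1} s * g s)
        = indicat_real {0..1} s * g s - indicat_real {0..x} s * g s" for s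
        by (auto simp: indicator_def)
      moreover have "integrable lborel (\<lambda>s. indicat_real {0..x} s * g s)"
        using set_integrable_subset_unit[OF i, of "{0..x}"] 2 by (simp add: set_integrable_def)
      moreover have "integrable lborel (\<lambda>s. indicat_real {0..1} s * g s)"
        using i by (simp add: set_integrable_def)
      ultimately show ?thesis using full z[OF 2]
        by (simp only: set_lebesgue_integral_def real_scaleR_def Bochner_Integration.integral_diff)
    next
      case 3
      then have "indicat_real {x<..} s * (indicat_real {0..1} s * g s) = 0" for s
        by (auto simp: indicator_def)
      then show ?thesis by (simp only: integral_zero)
    qed
  qed
  have parts: "(\<integral>\<^sup>+ s. ?p s * indicator {x<..} s \<partial>lborel) = (\<integral>\<^sup>+ s. ?n s * indicator {x<..} s \<partial>lborel)"
    "(\<integral>\<^sup>+ s. ?p s * indicator {x<..} s \<partial>lborel) < \<infinity>" for x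
  proof -
    let ?h = "\<lambda>s. indicat_real {x<..} s * (indicat_real {0..1} s * g s)"
    have int: "integrable lborel ?h" by (rule i1) simp
    then have fin: "(\<integral>\<^sup>+ s. ennreal (?h s) \<partial>lborel) \<noteq> \<infinity>" "(\<integral>\<^sup>+ s. ennreal (- ?h s) \<partial>lborel) \<noteq> \<infinity>"
      unfolding real_integrable_def by auto
    have "enn2real (\<integral>\<^sup>+ s. ennreal (?h s) \<partial>lborel) = enn2real (\<integral>\<^sup>+ s. ennreal (- ?h s) \<partial>lborel)"
      using zero[of x] real_lebesgue_integral_def[OF int] by simp
    then have "(\<integral>\<^sup>+ s. ennreal (?h s) \<partial>lborel) = (\<integral>\<^sup>+ s. ennreal (- ?h s) \<partial>lborel)"
      using fin by (rule enn2real_injD)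
    moreover have "(\<integral>\<^sup>+ s. ?p s * indicator {x<..} s \<partial>lborel) = (\<integral>\<^sup>+ s. ennreal (?h s) \<partial>lborel)"
      "(\<integral>\<^sup>+ s. ?n s * indicator {x<..} s \<partial>lborel) = (\<integral>\<^sup>+ s. ennreal (- ?h s) \<partial>lborel)"
      by (auto intro!: nn_integral_cong simp: indicator_def)
    ultimately show "(\<integral>\<^sup>+ s. ?p s * indicator {x<..} s \<partial>lborel) = (\<integral>\<^sup>+ s. ?n s * indicator {x<..} s \<partial>lborel)"
      "(\<integral>\<^sup>+ s. ?p s * indicator {x<..} s \<partial>lborel) < \<infinity>"
      using fin by (auto simp: less_top)
  qed
  have "density lborel ?p = density lborel ?n"
  proof (rule measure_eqI_lessThan)
    fix x :: real
    show "emeasure (density lborel ?p) {x<..} < \<infinity>" "emeasure (density lborel ?p) {x<..} = emeasure (density lborel ?n) {x<..}"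
      using parts[of x] by (simp_all add: emeasure_density)
  qed auto
  then have "AE s in lborel. ?p s = ?n s"
    by (subst sigma_finite_measure.density_unique_iff[OF sigma_finite_lborel, symmetric]) auto
  then show ?thesis
  proof (eventually_elim, intro impI)
    fix s :: real assume "?p s = ?n s" "s \<in> {0..1}"
    then have "ennreal (g s) = ennreal (- g s)" by simp
    then show "g s = 0" by (cases "0 \<le> g s") (auto simp: ennreal_neg ennreal_eq_0_iff dest: sym)
  qed
qed

text \<open>Coordinatewise, the difference of two derivatives has vanishing initial integrals. This
  makes the \<open>SOME\<close> in \<open>cm_deriv\<close> harmless.\<close>

lemma is_cm_deriv_unique:
  fixes h :: "'n::finite path"
  assumes d1: "is_cm_deriv h d1" and d2: "is_cm_deriv h d2"
  shows "AE s in lborel. s \<in> {0..1} \<longrightarrow> d1 s = d2 s"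
proof -
  have m [measurable]: "d1 \<in> borel_measurable borel" "d2 \<in> borel_measurable borel"
    using d1 d2 by (auto simp: is_cm_deriv_def)
  have i: "set_integrable lborel {0..1} d1" "set_integrable lborel {0..1} d2"
    using d1 d2 by (auto simp: is_cm_deriv_def intro: set_integrable_if_sq_integrable)
  have "AE s in lborel. s \<in> {0..1} \<longrightarrow> (d1 s - d2 s) \<bullet> b = 0" if "b \<in> Basis" for b
  proof (rule AE_eq_0_if_initial_integrals_eq_0)
    have id: "set_integrable lborel {0..1} (\<lambda>s. d1 s - d2 s)" by (rule set_integral_diff(1)[OF i])
    have "integrable lborel (\<lambda>s. (indicat_real {0..1} s *\<^sub>R (d1 s - d2 s)) \<bullet> b)"
      using id unfolding set_integrable_def by (intro integrable_inner_left) auto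
    then show "set_integrable lborel {0..1} (\<lambda>s. (d1 s - d2 s) \<bullet> b)"
      by (simp add: set_integrable_def)
    fix t :: real assume t: "t \<in> {0..1}"
    have it: "set_integrable lborel {0..t} d1" "set_integrable lborel {0..t} d2"
      by (rule set_integrable_subset_unit[OF i(1)], use t in auto, rule set_integrable_subset_unit[OF i(2)], use t in auto)
    have "(LINT s:{0..t}|lborel. (d1 s - d2 s) \<bullet> b) = (LINT s|lborel. (indicat_real {0..t} s *\<^sub>R (d1 s - d2 s)) \<bullet> b)"
      by (simp add: set_lebesgue_integral_def)
    also have "\<dots> = (LINT s:{0..t}|lborel. d1 s - d2 s) \<bullet> b"
      unfolding set_lebesgue_integral_def
      by (rule integral_inner_left) (use set_integral_diff(1)[OF it] in \<open>simp add: set_integrable_def\<close>)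
    also have "(LINT s:{0..t}|lborel. d1 s - d2 s) = h t - h t"
      using d1 d2 t by (subst set_integral_diff(2)[OF it]) (simp add: is_cm_deriv_def)
    finally show "(LINT s:{0..t}|lborel. (d1 s - d2 s) \<bullet> b) = 0" by simp
  qed measurable
  then have "AE s in lborel. \<forall>b\<in>Basis. s \<in> {0..1} \<longrightarrow> (d1 s - d2 s) \<bullet> b = 0"
    by (subst AE_finite_all) auto
  then show ?thesis
    by eventually_elim (metis euclidean_all_zero_iff right_minus_eq inner_commute)
qed

lemma energy_cong_AE:
  fixes a b :: "real \<Rightarrow> 'a::euclidean_space"
  assumes [measurable]: "a \<in> borel_measurable borel" "b \<in> borel_measurable borel"
    and "AE s in lborel. s \<in> {0..1} \<longrightarrow> a s = b s"
  shows "energy a = energy b"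
  unfolding energy_def
  by (rule set_lebesgue_integral_cong_AE) (use assms(3) in auto)

lemma is_cm_deriv_cm_deriv: "is_cm_deriv h d \<Longrightarrow> is_cm_deriv h (cm_deriv h)"
  unfolding cm_deriv_def by (rule someI[of "is_cm_deriv h" d])

lemma is_cm_deriv_measurable: "is_cm_deriv h d \<Longrightarrow> d \<in> borel_measurable borel"
  by (simp add: is_cm_deriv_def)

lemma cm_deriv_AE: "is_cm_deriv h d \<Longrightarrow> AE s in lborel. s \<in> {0..1} \<longrightarrow> cm_deriv h s = d s"
  by (rule is_cm_deriv_unique[OF is_cm_deriv_cm_deriv])

lemma cm_norm_sq:
  assumes d: "is_cm_deriv h d" shows "(cm_norm h)\<^sup>2 = energy d"
proof -
  have "energy (cm_deriv h) = energy d"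
    using d by (intro energy_cong_AE cm_deriv_AE is_cm_deriv_measurable[OF is_cm_deriv_cm_deriv] is_cm_deriv_measurable)
  then show ?thesis by (simp add: cm_norm_def energy_def[symmetric] energy_nonneg)
qed

lemma is_cm_deriv_uminus:
  assumes "is_cm_deriv h d" shows "is_cm_deriv (path_uminus h) (\<lambda>s. - d s)"
  using assms by (auto simp: is_cm_deriv_def path_uminus_def set_lebesgue_integral_def)

lemma is_cm_deriv_cong_AE:
  assumes d: "is_cm_deriv h d" and m [measurable]: "d' \<in> borel_measurable borel"
    and ae: "AE s in lborel. s \<in> {0..1} \<longrightarrow> d s = d' s"
  shows "is_cm_deriv h d'"
proof -
  note [measurable] = is_cm_deriv_measurable[OF d]
  have "set_integrable lborel {0..1} (\<lambda>s. (norm (d s))\<^sup>2) \<longleftrightarrow> set_integrable lborel {0..1} (\<lambda>s. (norm (d' s))\<^sup>2)"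
    by (rule set_integrable_cong_AE) (use ae in auto)
  moreover have "(LINT s:{0..t}|lborel. d s) = (LINT s:{0..t}|lborel. d' s)" if "t \<in> {0..1}" for t
  proof (rule set_lebesgue_integral_cong_AE)
    show "AE s\<in>{0..t} in lborel. d s = d' s" using ae by eventually_elim (use that in auto)
  qed auto
  ultimately show ?thesis using d by (simp add: is_cm_deriv_def)
qed

lemma cm_after_deriv:
  assumes v: "v w \<in> cm_space"
  shows "is_cm_deriv (cm_after \<tau> v w) (\<lambda>s. indicat_real {\<tau> w<..} s *\<^sub>R cm_deriv (v w) s)"
proof -
  obtain e where "is_cm_deriv (v w) e" using v by (auto simp: cm_space_def)
  then have d: "is_cm_deriv (v w) (cm_deriv (v w))" by (rule is_cm_deriv_cm_deriv)
  note [measurable] = is_cm_deriv_measurable[OF d]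
  have "set_integrable lborel {0..1} (\<lambda>s. (norm (cm_deriv (v w) s))\<^sup>2)" using d by (simp add: is_cm_deriv_def)
  then have "set_integrable lborel {0..1} (\<lambda>s. (norm (indicat_real {\<tau> w<..} s *\<^sub>R cm_deriv (v w) s))\<^sup>2)"
    unfolding set_integrable_def
    by (rule Bochner_Integration.integrable_bound) (auto simp: indicator_def)
  then show ?thesis by (simp add: is_cm_deriv_def cm_after_def)
qed

section \<open>Measurability into path space\<close>

lemma path_space_continuous: "x \<in> space path_space \<Longrightarrow> continuous_on {0..1} x"
  by (auto simp: path_space_def space_restrict_space)

lemma path_space_coordinate: "t \<in> {0..1} \<Longrightarrow> (\<lambda>x. x t) \<in> borel_measurable path_space"
  unfolding path_space_def by (intro measurable_restrict_space1 measurable_component_singleton)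

lemma path_space_extensional: "x \<in> space path_space \<Longrightarrow> x \<in> extensional {0..1}"
  by (auto simp: path_space_def space_restrict_space space_PiM PiE_def)

lemma measurable_path_spaceI:
  assumes "\<And>t. t \<in> {0..1} \<Longrightarrow> (\<lambda>w. Y w t) \<in> borel_measurable M" and "Y \<in> space M \<rightarrow> space path_space"
  shows "Y \<in> M \<rightarrow>\<^sub>M path_space"
  unfolding path_space_def
proof (rule measurable_restrict_space2)
  show "Y \<in> space M \<rightarrow> {w. continuous_on {0..1} w}"
    using assms(2) path_space_continuous by blast
  show "Y \<in> M \<rightarrow>\<^sub>M Pi\<^sub>M {0..1} (\<lambda>_. borel)"
  proof (rule measurable_PiM_single')
    show "(\<lambda>w x. Y w x) \<in> space M \<rightarrow> {0..1} \<rightarrow>\<^sub>E space borel"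
      using assms(2) path_space_extensional unfolding PiE_def by simp blast
  qed (rule assms(1))
qed

section \<open>Shift families\<close>

context shift_family
begin

interpretation \<nu>: prob_space \<nu> by (rule prob_nu)

lemma space_nu: "space \<nu> = space path_space"
  by (rule sets_eq_imp_space_eq[OF sets_nu])

lemma coordinate_measurable: "s \<in> {0..1} \<Longrightarrow> (\<lambda>w. w s) \<in> borel_measurable \<nu>"
  using path_space_coordinate by (simp cong: measurable_cong_sets add: sets_nu)

lemma sets_completed_filtration:
  assumes X: "\<And>s. s \<in> {0..1} \<Longrightarrow> (\<lambda>w. X w s) \<in> borel_measurable (completion \<nu>)"
  shows "sets (completed_filtration \<nu> X t) = sigma_sets (space \<nu>)
       ({(\<lambda>\<omega>. X \<omega> s) -` B \<inter> space \<nu> | s B. s \<in> {0..1} \<and> s \<le> t \<and> B \<in> sets borel} \<union> null_sets (completion \<nu>))"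
    "space (completed_filtration \<nu> X t) = space \<nu>"
    "sets (completed_filtration \<nu> X t) \<subseteq> sets (completion \<nu>)"
proof -
  let ?G = "{(\<lambda>\<omega>. X \<omega> s) -` B \<inter> space \<nu> | s B. s \<in> {0..1} \<and> s \<le> t \<and> B \<in> sets borel} \<union> null_sets (completion \<nu>)"
  have sub: "?G \<subseteq> sets (completion \<nu>)"
    using measurable_sets[OF X] by auto
  then have P: "?G \<subseteq> Pow (space \<nu>)" using sets.space_closed[of "completion \<nu>"] by auto
  show 1: "sets (completed_filtration \<nu> X t) = sigma_sets (space \<nu>) ?G"
    unfolding completed_filtration_def using P by (simp add: sets_measure_of)
  show "space (completed_filtration \<nu> X t) = space \<nu>"
    unfolding completed_filtration_def using P by (simp add: space_measure_of)
  show "sets (completed_filtration \<nu> X t) \<subseteq> sets (completion \<nu>)"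
    unfolding 1 using sets.sigma_sets_subset[OF sub] by simp
qed

lemma beta_measurable: "\<beta> \<in> completion \<nu> \<rightarrow>\<^sub>M path_space"
  using beta_brownian by (simp add: brownian_motion_def)

lemma beta_coordinate: "s \<in> {0..1} \<Longrightarrow> (\<lambda>w. \<beta> w s) \<in> borel_measurable (completion \<nu>)"
  by (rule measurable_compose[OF beta_measurable path_space_coordinate])

text \<open>Equality of the two completed filtrations is used in both directions: it transfers
  independence from the filtration of \<beta> to the canonical one, and it shows that \<beta>
  generates the latter.\<close>

lemma stopped_brownian_beta: "stopped_brownian (completion \<nu>) (canonical_filtration \<nu>) \<beta> \<tau>"
proof -
  note C = sets_completed_filtration[of "\<lambda>w. w", OF measurable_completion[OF coordinate_measurable], simplified,
      folded canonical_filtration_def]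
  note B = sets_completed_filtration(1)[of \<beta>, OF beta_coordinate, simplified]
  interpret M: prob_space "completion \<nu>" by (rule \<nu>.prob_space_completion)
  show ?thesis
  proof
    show "subalgebra (completion \<nu>) (canonical_filtration \<nu> t)" for t
      using C(2,3) by (simp add: subalgebra_def)
    show "sets (canonical_filtration \<nu> s) \<subseteq> sets (canonical_filtration \<nu> t)" if "s \<le> t" for s t
      unfolding C(1)[of s] C(1)[of t]
    by (intro sigma_sets_mono' Un_mono order_refl) (use that order_trans in blast)
    show "null_sets (completion \<nu>) \<subseteq> sets (canonical_filtration \<nu> t)" for t
      unfolding C(1) by auto
    show "(\<lambda>w. \<beta> w t) \<in> borel_measurable (canonical_filtration \<nu> t)" if t: "t \<in> {0..1}" for t
    proof (rule measurableI)
      fix A :: "(real^'n) set" assume "A \<in> sets borel"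
      then have "(\<lambda>w. \<beta> w t) -` A \<inter> space \<nu> \<in> sets (completed_filtration \<nu> \<beta> t)"
        unfolding B using t by (intro sigma_sets.Basic) auto
      then show "(\<lambda>w. \<beta> w t) -` A \<inter> space (canonical_filtration \<nu> t) \<in> sets (canonical_filtration \<nu> t)"
        using same_filtration[OF t] by (simp add: C(2))
    qed auto
    show "continuous_on {0..1} (\<beta> w)" if "w \<in> space (completion \<nu>)" for w
      using measurable_space[OF beta_measurable that] by (rule path_space_continuous)
    show "distributed (completion \<nu>) lborel (\<lambda>w. \<beta> w t - \<beta> w s) (\<lambda>x. ennreal (gauss (t - s) x))"
      if "0 \<le> s" "s < t" "t \<le> 1" for s t
      using beta_brownian that by (simp add: brownian_motion_def gauss_def)
    show "M.indep_set (sets (canonical_filtration \<nu> s))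
        {(\<lambda>w. \<beta> w t - \<beta> w s) -` A \<inter> space (completion \<nu>) | A. A \<in> sets borel}"
      if "0 \<le> s" "s < t" "t \<le> 1" for s t
    proof -
      have "sets (canonical_filtration \<nu> s) = sets (completed_filtration \<nu> \<beta> s)"
        using that same_filtration[of s] by simp
      then show ?thesis using beta_brownian that by (simp add: brownian_motion_def)
    qed
    have "sets (canonical_filtration \<nu> 1) = sets (completed_filtration \<nu> \<beta> 1)"
      using same_filtration[of 1] by simp
    also have "\<dots> \<subseteq> sigma_sets (space (completion \<nu>))
      ({(\<lambda>w. \<beta> w s) -` B \<inter> space (completion \<nu>) | s B. s \<in> {0..1} \<and> B \<in> sets borel} \<union> null_sets (completion \<nu>))"
      unfolding B space_completion by (intro sigma_sets_mono') auto
    finally show "sets (canonical_filtration \<nu> 1) \<subseteq> sigma_sets (space (completion \<nu>))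
      ({(\<lambda>w. \<beta> w s) -` B \<inter> space (completion \<nu>) | s B. s \<in> {0..1} \<and> B \<in> sets borel} \<union> null_sets (completion \<nu>))" .
    show "sets (canonical_filtration \<nu> t) \<subseteq> sets (canonical_filtration \<nu> 1)" if "1 \<le> t" for t
      unfolding C(1) by (intro sigma_sets_mono') auto
    show "stopping_time (canonical_filtration \<nu>) \<tau>" by (rule tau_stopping)
  qed
qed

sublocale B: stopped_brownian "completion \<nu>" "canonical_filtration \<nu>" \<beta> \<tau>
  by (rule stopped_brownian_beta)

lemma stopped_algebra_eq: "stopped_algebra \<nu> \<tau> = B.pre_sigma \<tau>"
  by (simp add: stopped_algebra_def)

lemma elementary_data_eq: "elementary_data \<nu> k t \<xi> \<longleftrightarrow> B.elementary k t \<xi>"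
  by (simp add: elementary_data_def B.elementary_def)

text \<open>No measurability of Z' is assumed; completeness makes its deviation events measurable,
  as they differ from those of Z by null sets.\<close>

lemma tendsto_in_prob_cong_AE:
  assumes [measurable]: "\<And>m. Z m \<in> borel_measurable (completion \<nu>)" "Y \<in> borel_measurable (completion \<nu>)"
    and ae: "\<And>m. AE w in completion \<nu>. Z m w = Z' m w"
  shows "tendsto_in_prob (completion \<nu>) Z Y \<longleftrightarrow> tendsto_in_prob (completion \<nu>) Z' Y"
proof -
  have "measure (completion \<nu>) {\<omega> \<in> space (completion \<nu>). \<bar>Z m \<omega> - Y \<omega>\<bar> > \<epsilon>}
    = measure (completion \<nu>) {\<omega> \<in> space (completion \<nu>). \<bar>Z' m \<omega> - Y \<omega>\<bar> > \<epsilon>}" for m \<epsilon>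
  proof -
    have ae': "AE w in completion \<nu>. w \<in> {\<omega> \<in> space (completion \<nu>). \<bar>Z m \<omega> - Y \<omega>\<bar> > \<epsilon>}
      \<longleftrightarrow> w \<in> {\<omega> \<in> space (completion \<nu>). \<bar>Z' m \<omega> - Y \<omega>\<bar> > \<epsilon>}"
      using ae[of m] by eventually_elim simp
    moreover have 1: "{\<omega> \<in> space (completion \<nu>). \<bar>Z m \<omega> - Y \<omega>\<bar> > \<epsilon>} \<in> sets (completion \<nu>)" by measurable
    moreover have "{\<omega> \<in> space (completion \<nu>). \<bar>Z' m \<omega> - Y \<omega>\<bar> > \<epsilon>} \<in> sets (completion \<nu>)"
      by (rule completion.in_sets_AE[OF ae' 1]) auto
    ultimately show ?thesis by (intro B.finite_measure_eq_AE)
  qed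
  then show ?thesis by (simp add: tendsto_in_prob_def)
qed

text \<open>Path by path, d and the chosen derivative agree at almost every time, so the
  approximation errors have the same energy. The errors formed with d are the measurable
  ones.\<close>

lemma is_ito_integral_iff:
  assumes d: "B.sqint d" and v: "AE w in completion \<nu>. is_cm_deriv (v w) (d w)"
  shows "is_ito_integral \<nu> \<beta> v X \<longleftrightarrow> B.ito_prob d X"
proof -
  have "tendsto_in_prob (completion \<nu>)
      (\<lambda>m w. energy (\<lambda>s. elementary_integrand (k m) (t m) (\<xi> m) w s - d w s)) (\<lambda>w. 0)
    \<longleftrightarrow> tendsto_in_prob (completion \<nu>)
          (\<lambda>m w. LINT s:{0..1}|lborel.
             (norm (elementary_integrand (k m) (t m) (\<xi> m) w s - cm_deriv (v w) s))\<^sup>2) (\<lambda>w. 0)"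
    if e: "\<And>m. B.elementary (k m) (t m) (\<xi> m)" for k t \<xi>
  proof (rule tendsto_in_prob_cong_AE)
    fix m
    show "(\<lambda>w. energy (\<lambda>s. elementary_integrand (k m) (t m) (\<xi> m) w s - d w s)) \<in> borel_measurable (completion \<nu>)"
      by (rule B.energy_measurable[OF B.sqint_measurable[OF B.sqint_diff(1)[OF B.elementary_sqint[OF e] d]]])
    show "AE w in completion \<nu>. energy (\<lambda>s. elementary_integrand (k m) (t m) (\<xi> m) w s - d w s)
      = (LINT s:{0..1}|lborel. (norm (elementary_integrand (k m) (t m) (\<xi> m) w s - cm_deriv (v w) s))\<^sup>2)"
      using v AE_space
    proof eventually_elim
      case (elim w)
      have [measurable]: "elementary_integrand (k m) (t m) (\<xi> m) w \<in> borel_measurable borel" "cm_deriv (v w) \<in> borel_measurable borel" "d w \<in> borel_measurable borel"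
        by (rule B.path_measurable[OF B.elementary_integrand_measurable[OF e] elim(2)],
            rule is_cm_deriv_measurable[OF is_cm_deriv_cm_deriv[OF elim(1)]], rule is_cm_deriv_measurable[OF elim(1)])
      show ?case
        unfolding energy_def[symmetric]
        by (rule energy_cong_AE) (use cm_deriv_AE[OF elim(1)] in auto)
    qed
  qed simp
  then show ?thesis
    unfolding is_ito_integral_def B.ito_prob_def elementary_data_eq by blast
qed

end

lemma left_inverse_density:
  fixes r :: "'a \<Rightarrow> ennreal"
  assumes N: "sigma_finite_measure (completion N)" and Y [measurable]: "Y \<in> completion N \<rightarrow>\<^sub>M completion N"
    and V [measurable]: "V \<in> completion N \<rightarrow>\<^sub>M N" and inv: "AE w in completion N. V (Y w) = w"
    and [measurable]: "r \<in> borel_measurable (completion N)" "q \<in> borel_measurable (completion N)"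
    and law: "\<And>h. h \<in> borel_measurable (completion N) \<Longrightarrow>
      (\<integral>\<^sup>+ w. r w * h (Y w) \<partial>completion N) = (\<integral>\<^sup>+ w. h w \<partial>completion N)"
    and image: "\<And>h. h \<in> borel_measurable (completion N) \<Longrightarrow>
      (\<integral>\<^sup>+ w. h (Y w) \<partial>completion N) = (\<integral>\<^sup>+ w. q w * h w \<partial>completion N)"
  shows "AE w in completion N. r w * q (Y w) = 1"
proof (rule sigma_finite_measure.density_unique2[OF N])
  fix B assume B [measurable]: "B \<in> sets (completion N)"
  \<comment> \<open>V is measurable into N and not into its completion, so the indicator of B is
    replaced by an N-measurable version before it is composed with V.\<close>
  obtain g where g: "g \<in> borel_measurable N" and eq: "AE w in N. indicator B w = (g w :: ennreal)"
    using completion_ex_borel_measurable[of "indicator B" N] by auto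
  have eq': "AE w in completion N. g (V (Y w)) = indicator B w"
    using inv AE_completion[OF eq] by eventually_elim simp
  have [measurable]: "(\<lambda>w. g (V w)) \<in> borel_measurable (completion N)"
    by (rule measurable_compose[OF V g])
  have "(\<integral>\<^sup>+ w\<in>B. r w * q (Y w) \<partial>completion N) = (\<integral>\<^sup>+ w. r w * (q (Y w) * g (V (Y w))) \<partial>completion N)"
    by (rule nn_integral_cong_AE) (use eq' in \<open>auto simp: mult.assoc\<close>)
  also have "\<dots> = (\<integral>\<^sup>+ w. q w * g (V w) \<partial>completion N)"
    by (rule law) simp
  also have "\<dots> = (\<integral>\<^sup>+ w. g (V (Y w)) \<partial>completion N)"
    by (rule image[symmetric]) simp
  also have "\<dots> = (\<integral>\<^sup>+ w\<in>B. 1 \<partial>completion N)"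
    by (rule nn_integral_cong_AE) (use eq' in auto)
  finally show "(\<integral>\<^sup>+ w\<in>B. r w * q (Y w) \<partial>completion N) = (\<integral>\<^sup>+ w\<in>B. 1 \<partial>completion N)" .
qed simp_all

section \<open>Drifts after the stopping time: versions, densities and laws\<close>

context extended_shift_family
begin

interpretation \<nu>: prob_space \<nu> by (rule prob_nu)

text \<open>The version d belongs to the negative of the drift, because the Girsanov density is
  built from \<open>path_uminus\<close>. Vanishing up to \<tau> is needed at every time, while the
  given adapted version is determined only at almost every time.\<close>

lemma drift_after_version:
  assumes a: "\<alpha> \<in> drifts_after \<nu> \<tau> Dt"
  obtains d where "B.sq_adapted d" "\<And>w s. s \<le> \<tau> w \<Longrightarrow> d w s = 0"
    "AE w in completion \<nu>. is_cm_deriv (path_uminus (\<alpha> w)) (d w)"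
    "AE w in completion \<nu>. is_cm_deriv (\<alpha> w) (\<lambda>s. - d w s)"
proof -
  have L: "\<alpha> \<in> Lpa 2 \<nu>" and La: "\<alpha> \<in> L0a \<nu>"
    using a Dt_subset_G2 by (auto simp: drifts_after_def G_class_def Lpa_def)
  obtain d0 where d0: "adapted_version \<nu> \<alpha> d0" using La by (auto simp: L0a_def)
  obtain v where v: "v \<in> L0a \<nu>" and \<alpha>v: "AE w in \<nu>. \<alpha> w = cm_after \<tau> v w"
    using a by (auto simp: drifts_after_def)
  have [measurable]: "(\<lambda>(w, s). d0 w s) \<in> borel_measurable (completion \<nu> \<Otimes>\<^sub>M lborel)"
    using d0 by (simp add: adapted_version_def)
  have [measurable]: "\<tau> \<in> borel_measurable (completion \<nu>)"
    by (rule measurable_stopping_time[OF tau_stopping B.sets_F_subset]) (simp add: B.space_F)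
  \<comment> \<open>Forcing the value 0 up to \<tau> changes the derivative only on a null set of
    times, as the drift coincides with \<open>cm_after \<tau> v\<close>; adaptedness survives
    because it is known at time t whether \<tau> < t.\<close>
  define d where "d w s = (if \<tau> w < s then - d0 w s else 0)" for w s
  have dm [measurable]: "(\<lambda>(w, s). d w s) \<in> borel_measurable (completion \<nu> \<Otimes>\<^sub>M lborel)"
    unfolding d_def by measurable
  have cm: "AE w in completion \<nu>. is_cm_deriv (\<alpha> w) (\<lambda>s. - d w s)"
    using AE_completion[OF \<alpha>v] d0[unfolded adapted_version_def, THEN conjunct2, THEN conjunct2, THEN AE_completion] AE_space
  proof eventually_elim
    case (elim w)
    have vw: "v w \<in> cm_space" using v elim(3) by (auto simp: L0a_def)
    have "AE s in lborel. s \<in> {0..1} \<longrightarrow> indicat_real {\<tau> w<..} s *\<^sub>R cm_deriv (v w) s = d0 w s"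
      by (rule is_cm_deriv_unique[of "\<alpha> w"]) (use cm_after_deriv[of v w \<tau>] vw elim in auto)
    then have "AE s in lborel. s \<in> {0..1} \<longrightarrow> d0 w s = - d w s"
      by eventually_elim (auto simp: d_def indicator_def split: if_splits)
    moreover have "d w \<in> borel_measurable borel"
      by (rule B.path_measurable[OF dm]) (use elim in simp)
    ultimately show ?case
      by (intro is_cm_deriv_cong_AE[OF elim(2)]) auto
  qed
  have cm': "AE w in completion \<nu>. is_cm_deriv (path_uminus (\<alpha> w)) (d w)"
    using cm by eventually_elim (auto dest: is_cm_deriv_uminus)
  have en: "AE w in completion \<nu>. cm_norm (\<alpha> w) powr 2 = energy (d w)"
    using cm
  proof eventually_elim
    case (elim w)
    have "0 \<le> cm_norm (\<alpha> w)" by (simp add: cm_norm_def energy_def[symmetric] energy_nonneg)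
    then have "cm_norm (\<alpha> w) powr 2 = (cm_norm (\<alpha> w))\<^sup>2" by (simp add: powr_numeral)
    also have "\<dots> = energy (d w)" using cm_norm_sq[OF elim] by (simp add: energy_def)
    finally show ?case .
  qed
  have "B.sqint d"
  proof (rule B.sqintI[OF dm])
    show "AE w in completion \<nu>. set_integrable lborel {0..1} (\<lambda>s. (norm (d w s))\<^sup>2)"
      using cm' by eventually_elim (simp add: is_cm_deriv_def)
    show "integrable (completion \<nu>) (\<lambda>w. energy (d w))"
      using L en by (subst integrable_cong_AE[symmetric, OF _ _ en]) (auto simp: Lpa_def intro: B.energy_measurable[OF dm])
  qed
  moreover have "(\<lambda>w. d w t) \<in> borel_measurable (canonical_filtration \<nu> t)" if t: "t \<in> {0..1}" for t
  proof -
    have [measurable]: "Measurable.pred (canonical_filtration \<nu> t) (\<lambda>w. \<tau> w < t)"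
      by (rule B.stopping_time_less_const[OF tau_stopping])
    have [measurable]: "(\<lambda>w. d0 w t) \<in> borel_measurable (canonical_filtration \<nu> t)"
      using d0 t by (simp add: adapted_version_def)
    show ?thesis unfolding d_def by measurable
  qed
  ultimately have "B.sq_adapted d" by (simp add: B.sq_adapted_def)
  moreover have "d w s = 0" if "s \<le> \<tau> w" for w s
    using that by (simp add: d_def)
  ultimately show ?thesis using cm' cm by (rule that)
qed

text \<open>X witnesses that a stochastic integral exists, so the \<open>SOME\<close> in
  \<open>ito\<close> picks one, and locality on the whole space identifies it with X almost
  surely.\<close>

lemma girsanov_density_eq:
  assumes d: "B.sqint d" and cm: "AE w in completion \<nu>. is_cm_deriv (path_uminus (\<alpha> w)) (d w)"
    and X: "B.ito_L2 d X"
  shows "AE w in completion \<nu>. girsanov_density \<nu> \<beta> \<alpha> w = exp (X w - 1 / 2 * energy (d w))"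
proof -
  have Xp: "B.ito_prob d X" by (rule B.ito_L2_imp_prob[OF X d])
  then have "is_ito_integral \<nu> \<beta> (\<lambda>w. path_uminus (\<alpha> w)) X"
    using is_ito_integral_iff[OF d cm] by blast
  then have "is_ito_integral \<nu> \<beta> (\<lambda>w. path_uminus (\<alpha> w)) (ito \<nu> \<beta> (\<lambda>w. path_uminus (\<alpha> w)))"
    unfolding ito_def by (rule someI[of "is_ito_integral \<nu> \<beta> (\<lambda>w. path_uminus (\<alpha> w))" X])
  then have "B.ito_prob d (ito \<nu> \<beta> (\<lambda>w. path_uminus (\<alpha> w)))"
    using is_ito_integral_iff[OF d cm] by blast
  then have "AE w in completion \<nu>. w \<in> space (completion \<nu>) \<longrightarrow> ito \<nu> \<beta> (\<lambda>w. path_uminus (\<alpha> w)) w = X w"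
    by (rule B.ito_prob_local[OF _ Xp d d]) auto
  then show ?thesis
    using cm AE_space
    by eventually_elim (simp add: girsanov_density_def wick_exp_def cm_norm_sq)
qed

lemma shift_measurable:
  assumes "\<alpha> \<in> Dt" shows "W \<alpha> \<in> completion \<nu> \<rightarrow>\<^sub>M path_space"
proof (rule measurable_path_spaceI)
  show "(\<lambda>w. W \<alpha> w t) \<in> borel_measurable (completion \<nu>)" if "t \<in> {0..1}" for t
    using Dt_adapted[OF assms] that by (intro B.measurable_F_imp[of _ t]) (auto simp: adapted_map_def)
  show "W \<alpha> \<in> space (completion \<nu>) \<rightarrow> space path_space"
    using Dt_adapted[OF assms] by (simp add: adapted_map_def)
qed

lemma girsanov_density_pos: "0 < girsanov_density \<nu> \<beta> \<alpha> w"
  by (simp add: girsanov_density_def wick_exp_def)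

text \<open>A Bochner integral equal to 1 forces integrability, since non-integrable functions have
  integral 0 by convention.\<close>

lemma girsanov_density_measurable:
  assumes "\<alpha> \<in> Dt" shows "girsanov_density \<nu> \<beta> \<alpha> \<in> borel_measurable (completion \<nu>)"
proof -
  have "(LINT w|completion \<nu>. girsanov_density \<nu> \<beta> \<alpha> w) = 1"
    using assms Dt_subset_G2 by (auto simp: G_class_def)
  then have "integrable (completion \<nu>) (girsanov_density \<nu> \<beta> \<alpha>)"
    using not_integrable_integral_eq by force
  then show ?thesis by auto
qed

lemma shift_law_borel:
  assumes a: "\<alpha> \<in> Dt" and h: "h \<in> borel_measurable \<nu>"
  shows "(\<integral>\<^sup>+ w. ennreal (girsanov_density \<nu> \<beta> \<alpha> w) * h (W \<alpha> w) \<partial>completion \<nu>) = (\<integral>\<^sup>+ w. h w \<partial>\<nu>)"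
proof -
  note [measurable] = shift_measurable[OF a] girsanov_density_measurable[OF a]
  have [measurable]: "h \<in> borel_measurable path_space" using h by (simp cong: measurable_cong_sets add: sets_nu)
  have "(\<integral>\<^sup>+ w. ennreal (girsanov_density \<nu> \<beta> \<alpha> w) * h (W \<alpha> w) \<partial>completion \<nu>)
    = (\<integral>\<^sup>+ w. h (W \<alpha> w) \<partial>girsanov_measure \<nu> \<beta> \<alpha>)"
    unfolding girsanov_measure_def by (subst nn_integral_density) auto
  also have "\<dots> = (\<integral>\<^sup>+ w. h w \<partial>distr (girsanov_measure \<nu> \<beta> \<alpha>) path_space (W \<alpha>))"
    by (subst nn_integral_distr) (auto simp: girsanov_measure_def)
  also have "\<dots> = (\<integral>\<^sup>+ w. h w \<partial>\<nu>)"
    unfolding Dt_law[OF a]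
    by (subst nn_integral_distr) (auto intro: measurable_ident_sets[OF sets_nu, unfolded id_def])
  finally show ?thesis .
qed

text \<open>The preimage of a null set has zero mass under the Girsanov density, and this density is
  strictly positive; so the preimage is null.\<close>

lemma shift_AE:
  assumes a: "\<alpha> \<in> Dt" and P: "AE w in \<nu>. P w"
  shows "AE w in completion \<nu>. P (W \<alpha> w)"
proof -
  note W [measurable] = shift_measurable[OF a]
  note [measurable] = girsanov_density_measurable[OF a]
  obtain N where N: "N \<in> null_sets \<nu>" "{w \<in> space \<nu>. \<not> P w} \<subseteq> N"
    using P by (auto simp: eventually_ae_filter)
  have Np [measurable]: "N \<in> sets path_space" using N(1) sets_nu by auto
  have "(\<integral>\<^sup>+ w. ennreal (girsanov_density \<nu> \<beta> \<alpha> w) * indicator N (W \<alpha> w) \<partial>completion \<nu>) = (\<integral>\<^sup>+ w. indicator N w \<partial>\<nu>)"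
    by (rule shift_law_borel[OF a]) (use N(1) in auto)
  also have "\<dots> = 0" using N(1) by (subst nn_integral_indicator) auto
  finally have "AE w in completion \<nu>. ennreal (girsanov_density \<nu> \<beta> \<alpha> w) * indicator N (W \<alpha> w) = 0"
    by (subst (asm) nn_integral_0_iff_AE) auto
  then show ?thesis
    using AE_space
  proof eventually_elim
    case (elim w)
    have "W \<alpha> w \<in> space \<nu>" using measurable_space[OF W elim(2)] by (simp add: space_nu)
    moreover have "W \<alpha> w \<notin> N" using elim(1) girsanov_density_pos[of \<alpha> w] by (auto simp: indicator_def ennreal_eq_0_iff split: if_splits)
    ultimately show ?case using N(2) by auto
  qed
qed

text \<open>Preimages of null sets are null by \<open>shift_AE\<close>, so functions measurable only
  for the completion, such as f and L, can be composed with the shift.\<close>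

lemma shift_measurable_completion:
  assumes a: "\<alpha> \<in> Dt" shows "W \<alpha> \<in> completion \<nu> \<rightarrow>\<^sub>M completion \<nu>"
proof (rule completion.measurable_completion2)
  show W: "W \<alpha> \<in> completion \<nu> \<rightarrow>\<^sub>M \<nu>"
    using shift_measurable[OF a] by (simp cong: measurable_cong_sets add: sets_nu)
  show "null_sets \<nu> \<subseteq> null_sets (distr (completion \<nu>) \<nu> (W \<alpha>))"
  proof
    fix N assume N: "N \<in> null_sets \<nu>"
    then have [measurable]: "N \<in> sets \<nu>" by auto
    have "AE w in completion \<nu>. W \<alpha> w \<notin> N" by (rule shift_AE[OF a AE_not_in[OF N]])
    then have "AE w in completion \<nu>. w \<notin> W \<alpha> -` N \<inter> space (completion \<nu>)" by eventually_elim simp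
    then have "W \<alpha> -` N \<inter> space (completion \<nu>) \<in> null_sets (completion \<nu>)"
      by (subst AE_iff_null_sets) (use measurable_sets[OF W] in auto)
    then show "N \<in> null_sets (distr (completion \<nu>) \<nu> (W \<alpha>))"
      using W N by (subst null_sets_distr_iff) auto
  qed
qed

lemma shift_law:
  assumes a: "\<alpha> \<in> Dt" and h: "h \<in> borel_measurable (completion \<nu>)"
  shows "(\<integral>\<^sup>+ w. ennreal (girsanov_density \<nu> \<beta> \<alpha> w) * h (W \<alpha> w) \<partial>completion \<nu>) = (\<integral>\<^sup>+ w. h w \<partial>completion \<nu>)"
proof -
  obtain h' where h': "h' \<in> borel_measurable \<nu>" and eq: "AE w in \<nu>. h w = h' w"
    using completion_ex_borel_measurable[OF h] by auto
  have "(\<integral>\<^sup>+ w. ennreal (girsanov_density \<nu> \<beta> \<alpha> w) * h (W \<alpha> w) \<partial>completion \<nu>)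
    = (\<integral>\<^sup>+ w. ennreal (girsanov_density \<nu> \<beta> \<alpha> w) * h' (W \<alpha> w) \<partial>completion \<nu>)"
    by (rule nn_integral_cong_AE) (use shift_AE[OF a eq] in auto)
  also have "\<dots> = (\<integral>\<^sup>+ w. h' w \<partial>\<nu>)" by (rule shift_law_borel[OF a h'])
  also have "\<dots> = (\<integral>\<^sup>+ w. h w \<partial>completion \<nu>)"
    unfolding nn_integral_completion by (rule nn_integral_cong_AE) (use eq in auto)
  finally show ?thesis .
qed

lemma cond_exp_drift_after:
  assumes a: "\<alpha> \<in> drifts_after \<nu> \<tau> Dt" and f: "f \<in> borel_measurable (completion \<nu>)"
    and fi: "integrable (completion \<nu>) (\<lambda>w. exp (- f w))"
  defines "L \<equiv> real_cond_exp (completion \<nu>) (stopped_algebra \<nu> \<tau>) (\<lambda>w. exp (- f w))"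
    and "T \<equiv> \<lambda>w. f (W \<alpha> w) + 1 / 2 * (cm_norm (\<alpha> w))\<^sup>2"
  shows "AE w in completion \<nu>. ereal (- ln (L w)) \<le> ext_cond_exp (completion \<nu>) (stopped_algebra \<nu> \<tau>) T w"
    and "(AE w in completion \<nu>. girsanov_density \<nu> \<beta> \<alpha> w * (exp (- f (W \<alpha> w)) / L (W \<alpha> w)) = 1) \<Longrightarrow>
       AE w in completion \<nu>. ext_cond_exp (completion \<nu>) (stopped_algebra \<nu> \<tau>) T w = ereal (- ln (L w))"
proof -
  have aD: "\<alpha> \<in> Dt" using a by (simp add: drifts_after_def)
  obtain d where d: "B.sq_adapted d" and z: "\<And>w s. s \<le> \<tau> w \<Longrightarrow> d w s = 0"
    and cm': "AE w in completion \<nu>. is_cm_deriv (path_uminus (\<alpha> w)) (d w)"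
    and cm: "AE w in completion \<nu>. is_cm_deriv (\<alpha> w) (\<lambda>s. - d w s)"
    using drift_after_version[OF a] by blast
  obtain X where X: "B.ito_L2 d X" by (rule B.ito_L2_exists[OF d])
  have \<rho>: "AE w in completion \<nu>. girsanov_density \<nu> \<beta> \<alpha> w = exp (X w - 1 / 2 * energy (d w))"
    by (rule girsanov_density_eq[OF _ cm' X]) (use d in \<open>simp add: B.sq_adapted_def\<close>)
  note Y [measurable] = shift_measurable_completion[OF aD]
  have \<beta>Y: "AE w in completion \<nu>. \<forall>s\<in>{0..1}. \<beta> (W \<alpha> w) s = \<beta> w s - (LINT r:{0..s}|lborel. d w r)"
    using AE_completion[OF Dt_beta_W[OF aD]] cm
    by eventually_elim (simp add: path_add_def is_cm_deriv_def set_lebesgue_integral_def)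
  have law: "(\<integral>\<^sup>+ w. ennreal (exp (X w - 1 / 2 * energy (d w))) * h (W \<alpha> w) \<partial>completion \<nu>) = (\<integral>\<^sup>+ w. h w \<partial>completion \<nu>)"
    if "h \<in> borel_measurable (completion \<nu>)" for h
    unfolding shift_law[OF aD that, symmetric] by (rule nn_integral_cong_AE) (use \<rho> in auto)
  have "\<alpha> \<in> Lpa 2 \<nu>" using aD Dt_subset_G2 by (auto simp: G_class_def)
  then have "(\<lambda>w. cm_norm (\<alpha> w) powr 2) \<in> borel_measurable (completion \<nu>)" by (auto simp: Lpa_def)
  moreover have "cm_norm (\<alpha> w) powr 2 = (cm_norm (\<alpha> w))\<^sup>2" for w
    by (simp add: cm_norm_def energy_def[symmetric] energy_nonneg powr_numeral)
  ultimately have "(\<lambda>w. (cm_norm (\<alpha> w))\<^sup>2) \<in> borel_measurable (completion \<nu>)" by simp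
  then have T: "T \<in> borel_measurable (completion \<nu>)"
    unfolding T_def using measurable_compose[OF Y f] by measurable
  have TY: "AE w in completion \<nu>. T w = f (W \<alpha> w) + 1 / 2 * energy (d w)"
    using cm by eventually_elim (simp add: T_def cm_norm_sq energy_def)
  note main = B.cond_exp_stopped_drift[OF d z X Y \<beta>Y law f fi T TY, folded stopped_algebra_eq L_def]
  show "AE w in completion \<nu>. ereal (- ln (L w)) \<le> ext_cond_exp (completion \<nu>) (stopped_algebra \<nu> \<tau>) T w"
    by (rule main(1))
  show "AE w in completion \<nu>. ext_cond_exp (completion \<nu>) (stopped_algebra \<nu> \<tau>) T w = ereal (- ln (L w))"
    if eq: "AE w in completion \<nu>. girsanov_density \<nu> \<beta> \<alpha> w * (exp (- f (W \<alpha> w)) / L (W \<alpha> w)) = 1"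
  proof (rule main(2))
    show "AE w in completion \<nu>. exp (X w - 1 / 2 * energy (d w)) * (exp (- f (W \<alpha> w)) / L (W \<alpha> w)) = 1"
      using eq \<rho> by eventually_elim simp
  qed
qed

lemma left_invertible_density:
  assumes a: "\<alpha> \<in> Dt" and inv: "left_invertible \<nu> (W \<alpha>)" and [measurable]: "q \<in> borel_measurable (completion \<nu>)"
    and RN: "AE w in \<nu>. RN_deriv \<nu> (distr (completion \<nu>) path_space (W \<alpha>)) w = ennreal (q w)"
  shows "AE w in completion \<nu>. girsanov_density \<nu> \<beta> \<alpha> w * q (W \<alpha> w) = 1"
proof -
  obtain V where V: "V \<in> completion \<nu> \<rightarrow>\<^sub>M path_space" "AE w in \<nu>. V (W \<alpha> w) = w"
    and ac: "absolutely_continuous \<nu> (distr (completion \<nu>) path_space (W \<alpha>))"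
    using inv unfolding left_invertible_def by blast
  note [measurable] = girsanov_density_measurable[OF a]
  note W [measurable] = shift_measurable[OF a]
  have image: "(\<integral>\<^sup>+ w. h (W \<alpha> w) \<partial>completion \<nu>) = (\<integral>\<^sup>+ w. ennreal (q w) * h w \<partial>completion \<nu>)"
    if h: "h \<in> borel_measurable (completion \<nu>)" for h
  proof -
    obtain h' where h': "h' \<in> borel_measurable \<nu>" and eq: "AE w in \<nu>. h w = h' w"
      using completion_ex_borel_measurable[OF h] by auto
    have [measurable]: "h' \<in> borel_measurable path_space" using h' by (simp cong: measurable_cong_sets add: sets_nu)
    have "(\<integral>\<^sup>+ w. h (W \<alpha> w) \<partial>completion \<nu>) = (\<integral>\<^sup>+ w. h' (W \<alpha> w) \<partial>completion \<nu>)"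
      by (rule nn_integral_cong_AE[OF shift_AE[OF a eq]])
    also have "\<dots> = (\<integral>\<^sup>+ w. h' w \<partial>distr (completion \<nu>) path_space (W \<alpha>))"
      by (subst nn_integral_distr) auto
    also have "\<dots> = (\<integral>\<^sup>+ w. RN_deriv \<nu> (distr (completion \<nu>) path_space (W \<alpha>)) w * h' w \<partial>\<nu>)"
      by (rule \<nu>.RN_deriv_nn_integral[OF ac _ h']) (simp add: sets_nu)
    also have "\<dots> = (\<integral>\<^sup>+ w. ennreal (q w) * h w \<partial>completion \<nu>)"
      unfolding nn_integral_completion by (rule nn_integral_cong_AE) (use RN eq in auto)
    finally show ?thesis .
  qed
  have "AE w in completion \<nu>. ennreal (girsanov_density \<nu> \<beta> \<alpha> w) * ennreal (q (W \<alpha> w)) = 1"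
  proof (rule left_inverse_density[of \<nu> "W \<alpha>" V "\<lambda>w. ennreal (girsanov_density \<nu> \<beta> \<alpha> w)" "\<lambda>w. ennreal (q w)"])
    show "sigma_finite_measure (completion \<nu>)" by unfold_locales
    show "V \<in> completion \<nu> \<rightarrow>\<^sub>M \<nu>" using V(1) by (simp cong: measurable_cong_sets add: sets_nu)
  qed (use V(2) shift_measurable_completion[OF a] shift_law[OF a] image in \<open>auto simp: AE_completion_iff\<close>)
  then show ?thesis
  proof eventually_elim
    case (elim w)
    then have "ennreal (girsanov_density \<nu> \<beta> \<alpha> w * q (W \<alpha> w)) = ennreal 1"
      using girsanov_density_pos[of \<alpha> w] by (simp add: ennreal_mult'[symmetric] less_imp_le)
    moreover have "ennreal (girsanov_density \<nu> \<beta> \<alpha> w * q (W \<alpha> w)) \<noteq> 0" using calculation by simp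
    ultimately show ?case by (simp add: ennreal_eq_1)
  qed
qed

end

text \<open>For values of f at least -1 the exponential is at most e, which is where the constant
  comes from; below -1 the factor |f| exceeds 1 and the given integrand dominates.\<close>

lemma integrable_exp_uminus:
  fixes f :: "'a \<Rightarrow> real"
  assumes M: "finite_measure M" and [measurable]: "f \<in> borel_measurable M"
    and i: "integrable M (\<lambda>w. \<bar>f w\<bar> * (1 + exp (- f w)))"
  shows "integrable M (\<lambda>w. exp (- f w))"
proof (rule Bochner_Integration.integrable_bound)
  show "integrable M (\<lambda>w. exp 1 + \<bar>f w\<bar> * (1 + exp (- f w)))"
    by (rule Bochner_Integration.integrable_add[OF finite_measure.integrable_const[OF M] i])
  have "exp (- x) \<le> exp 1 + \<bar>x\<bar> * (1 + exp (- x))" for x :: real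
  proof (cases "- x \<le> 1")
    case True
    then have "exp (- x) \<le> exp 1" by simp
    moreover have "0 \<le> \<bar>x\<bar> * (1 + exp (- x))" by (simp add: add_nonneg_nonneg)
    ultimately show ?thesis by linarith
  next
    case False
    have "exp (- x) \<le> 1 * (1 + exp (- x))" by simp
    also have "\<dots> \<le> \<bar>x\<bar> * (1 + exp (- x))"
      using False by (intro mult_right_mono) (auto simp: add_nonneg_nonneg)
    also have "\<dots> \<le> exp 1 + \<bar>x\<bar> * (1 + exp (- x))" by simp
    finally show ?thesis .
  qed
  then show "AE w in M. norm (exp (- f w)) \<le> norm (exp 1 + \<bar>f w\<bar> * (1 + exp (- f w)))"
    by (auto intro!: AE_I2 order_trans[OF _ abs_ge_self])
qed measurable

theorem theorem6:
  fixes \<nu> :: "'n::finite path measure"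
    and \<tau> :: "'n path \<Rightarrow> real"
    and \<beta> :: "'n path \<Rightarrow> 'n path"
    and W :: "('n path \<Rightarrow> 'n path) \<Rightarrow> 'n path \<Rightarrow> 'n path"
    and Dt :: "('n path \<Rightarrow> 'n path) set"
    and f :: "'n path \<Rightarrow> real"
  assumes "extended_shift_family \<nu> \<tau> \<beta> W Dt"
    and "f \<in> borel_measurable (completion \<nu>)"
    and "integrable (completion \<nu>) (\<lambda>w. \<bar>f w\<bar> * (1 + exp (- f w)))"
    and "\<exists>u \<in> drifts_after \<nu> \<tau> Dt \<inter> Lpa 2 \<nu>.
           left_invertible \<nu> (W u) \<and>
           (AE w in \<nu>. RN_deriv \<nu> (distr (completion \<nu>) path_space (W u)) w =
              ennreal (exp (- f w) /
                real_cond_exp (completion \<nu>) (stopped_algebra \<nu> \<tau>) (\<lambda>x. exp (- f x)) w))"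
  shows "is_ess_inf (completion \<nu>)
           ((\<lambda>\<alpha>. ext_cond_exp (completion \<nu>) (stopped_algebra \<nu> \<tau>)
                    (\<lambda>w. f (W \<alpha> w) + 1 / 2 * (cm_norm (\<alpha> w))\<^sup>2))
              ` (drifts_after \<nu> \<tau> Dt \<inter> Lpa 2 \<nu>))
           (\<lambda>w. ereal (- ln (real_cond_exp (completion \<nu>) (stopped_algebra \<nu> \<tau>)
                               (\<lambda>x. exp (- f x)) w)))"
proof -
  interpret extended_shift_family \<nu> \<tau> \<beta> W Dt by (rule assms(1))
  note f [measurable] = assms(2)
  let ?L = "real_cond_exp (completion \<nu>) (stopped_algebra \<nu> \<tau>) (\<lambda>x. exp (- f x))"
  let ?J = "\<lambda>\<alpha>. ext_cond_exp (completion \<nu>) (stopped_algebra \<nu> \<tau>) (\<lambda>w. f (W \<alpha> w) + 1 / 2 * (cm_norm (\<alpha> w))\<^sup>2)"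
  have fi: "integrable (completion \<nu>) (\<lambda>w. exp (- f w))"
    by (rule integrable_exp_uminus[OF B.finite_measure_axioms f assms(3)])
  interpret C: finite_measure_subalgebra "completion \<nu>" "stopped_algebra \<nu> \<tau>"
    unfolding stopped_algebra_eq by (rule B.finite_measure_subalgebra_pre_sigma)
  have L [measurable]: "?L \<in> borel_measurable (completion \<nu>)" by simp
  obtain u where u: "u \<in> drifts_after \<nu> \<tau> Dt \<inter> Lpa 2 \<nu>" and inv: "left_invertible \<nu> (W u)"
    and RN: "AE w in \<nu>. RN_deriv \<nu> (distr (completion \<nu>) path_space (W u)) w = ennreal (exp (- f w) / ?L w)"
    using assms(4) by blast
  have "AE w in completion \<nu>. girsanov_density \<nu> \<beta> u w * (exp (- f (W u w)) / ?L (W u w)) = 1"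
    by (rule left_invertible_density[OF _ inv _ RN]) (use u in \<open>auto simp: drifts_after_def\<close>)
  then have opt: "AE w in completion \<nu>. ?J u w = ereal (- ln (?L w))"
    using u by (intro cond_exp_drift_after(2)[OF _ f fi]) auto
  show ?thesis
    unfolding is_ess_inf_def
  proof (intro conjI ballI impI)
    show "(\<lambda>w. ereal (- ln (?L w))) \<in> borel_measurable (completion \<nu>)" by measurable
    show "AE w in completion \<nu>. ereal (- ln (?L w)) \<le> Y w" if "Y \<in> ?J ` (drifts_after \<nu> \<tau> Dt \<inter> Lpa 2 \<nu>)" for Y
      using that cond_exp_drift_after(1)[OF _ f fi] by auto
    \<comment> \<open>Every lower bound is tested at the single drift u, so the uncountable family
      needs no reduction to a countable one.\<close>
    show "AE w in completion \<nu>. Z w \<le> ereal (- ln (?L w))"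
      if "\<forall>Y\<in>?J ` (drifts_after \<nu> \<tau> Dt \<inter> Lpa 2 \<nu>). AE w in completion \<nu>. Z w \<le> Y w" for Z
    proof -
      have "AE w in completion \<nu>. Z w \<le> ?J u w" using that u by blast
      then show ?thesis using opt by eventually_elim simp
    qed
  qed
qed

end
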